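(* Let $k$ be a field and $N\subseteq M$ an irreducible extension of $k$-algebras (i.e. $C_M(N)=k1$) of depth 2. Then $N\subseteq M$ is strongly separable if and only if there is a finite-dimensional semisimple and cosemisimple Hopf algebra $H$ over $k$ such that $M/N$ is an $H$-Galois extension.
   Context: $C_R(S)=\{r\in R:rs=sr\ \forall s\in S\}$. Let $M_1=\mathrm{End}(M_N)$ (right $N$-module endomorphisms of $M$), containing $M$ via left multiplications, and $M_2=\mathrm{End}((M_1)_M)$, containing $M_1$ via left multiplications. The extension has depth 2 if $M_1$ is a free right $M$-module with a basis contained in $C_{M_1}(N)$ and $M_2$ is a free right $M_1$-module with a basis contained in $C_{M_2}(M)$. The irreducible extension $N\subseteq M$ is strongly separable if there are an $N$-$N$-bimodule map $E:M\to N$ and elements $x_1,\dots,x_n,y_1,\dots,y_n\in M$ with $\sum_iE(mx_i)y_i=m=\sum_ix_iE(y_im)$ for all $m\in M$, $E(1)\neq0$ and $\sum_ix_iy_i\neq0$. $M/N$ is an $H$-Galois extension if $M$ is a right $H$-comodule algebra via $\rho:M\to M\otimes H$, $\rho(a)=a_{(0)}\otimes a_{(1)}$, with $N=\{b\in M:\rho(b)=b\otimes1\}$, and the Galois map $\beta:M\otimes_NM\to M\otimes H$, $a\otimes a'\mapsto aa'_{(0)}\otimes a'_{(1)}$, is bijective. *)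

theory Defs
  imports Main
begin

text \<open>A k-algebra structure on the ring 'm is a ring homomorphism from the field 'k
  into the centre of 'm; scalar multiplication is c.m = iota c * m.\<close>
definition kalg :: "('k::field \<Rightarrow> 'm::ring_1) \<Rightarrow> bool" where
  "kalg \<iota> \<longleftrightarrow> \<iota> 1 = 1 \<and> (\<forall>a b. \<iota> (a + b) = \<iota> a + \<iota> b) \<and> (\<forall>a b. \<iota> (a * b) = \<iota> a * \<iota> b)
     \<and> (\<forall>c m. \<iota> c * m = m * \<iota> c)"

definition subalg :: "('k::field \<Rightarrow> 'm::ring_1) \<Rightarrow> 'm set \<Rightarrow> bool" where
  "subalg \<iota> N \<longleftrightarrow> range \<iota> \<subseteq> N \<and> (\<forall>a\<in>N. \<forall>b\<in>N. a + b \<in> N \<and> a * b \<in> N \<and> - a \<in> N)"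

definition centralizer :: "'m::ring_1 set \<Rightarrow> 'm set" where
  "centralizer S = {r. \<forall>s\<in>S. r * s = s * r}"

definition irreducible_ext :: "('k::field \<Rightarrow> 'm::ring_1) \<Rightarrow> 'm set \<Rightarrow> bool" where
  "irreducible_ext \<iota> N \<longleftrightarrow> centralizer N = range \<iota>"

definition lm :: "'m::ring_1 \<Rightarrow> 'm \<Rightarrow> 'm" where
  "lm m = (\<lambda>x. m * x)"

definition E1 :: "'m::ring_1 set \<Rightarrow> ('m \<Rightarrow> 'm) set" where
  "E1 N = {f. (\<forall>x y. f (x + y) = f x + f y) \<and> (\<forall>x n. n \<in> N \<longrightarrow> f (x * n) = f x * n)}"

text \<open>M2 = End((M1)_M), the right M-action on M1 being f.m = f o lm m.
  Elements are represented extensionally (value 0 outside M1).\<close>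
definition M2 :: "'m::ring_1 set \<Rightarrow> (('m \<Rightarrow> 'm) \<Rightarrow> ('m \<Rightarrow> 'm)) set" where
  "M2 N = {\<phi>. (\<forall>f\<in>E1 N. \<phi> f \<in> E1 N) \<and> (\<forall>f. f \<notin> E1 N \<longrightarrow> \<phi> f = (\<lambda>_. 0))
       \<and> (\<forall>f\<in>E1 N. \<forall>g\<in>E1 N. \<phi> (\<lambda>x. f x + g x) = (\<lambda>x. \<phi> f x + \<phi> g x))
       \<and> (\<forall>f\<in>E1 N. \<forall>m. \<phi> (f \<circ> lm m) = \<phi> f \<circ> lm m)}"

definition depth2 :: "'m::ring_1 set \<Rightarrow> bool" where
  "depth2 N \<longleftrightarrow>
    (\<exists>B. B \<subseteq> E1 N \<and> (\<forall>b\<in>B. \<forall>n\<in>N. b \<circ> lm n = lm n \<circ> b) \<and>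
       (\<forall>f\<in>E1 N. \<exists>!c. (\<forall>b. b \<notin> B \<longrightarrow> c b = 0) \<and> finite {b. c b \<noteq> 0} \<and>
           f = (\<lambda>x. \<Sum>b\<in>{b. c b \<noteq> 0}. b (c b * x)))) \<and>
    (\<exists>B2. B2 \<subseteq> M2 N \<and> (\<forall>\<beta>\<in>B2. \<forall>m. \<forall>f\<in>E1 N. \<beta> (lm m \<circ> f) = lm m \<circ> \<beta> f) \<and>
       (\<forall>\<phi>\<in>M2 N. \<exists>!c. (\<forall>\<beta>. \<beta> \<notin> B2 \<longrightarrow> c \<beta> = (\<lambda>_. 0)) \<and> (\<forall>\<beta>. c \<beta> \<in> E1 N) \<and>
           finite {\<beta>. c \<beta> \<noteq> (\<lambda>_. 0)} \<and>
           (\<forall>f\<in>E1 N. \<phi> f = (\<lambda>x. \<Sum>\<beta>\<in>{\<beta>. c \<beta> \<noteq> (\<lambda>_. 0)}. \<beta> (c \<beta> \<circ> f) x))))"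

definition strongly_separable :: "'m::ring_1 set \<Rightarrow> bool" where
  "strongly_separable N \<longleftrightarrow>
    (\<exists>E. (\<forall>m. E m \<in> N) \<and> (\<forall>a b. E (a + b) = E a + E b) \<and>
         (\<forall>n\<in>N. \<forall>m. E (n * m) = n * E m \<and> E (m * n) = E m * n) \<and>
         (\<exists>(k::nat) x y. (\<forall>m. (\<Sum>i<k. E (m * x i) * y i) = m \<and> (\<Sum>i<k. x i * E (y i * m)) = m)
             \<and> E 1 \<noteq> 0 \<and> (\<Sum>i<k. x i * y i) \<noteq> 0))"

text \<open>H has basis h_0..h_(d-1); h_i h_j = sum_p C i j p h_p, unit = sum_i u i h_i,
  Delta h_i = sum_(j,l) D i j l h_j (x) h_l, counit eps h_i = e i,
  antipode S h_i = sum_j S i j h_j.\<close>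
definition hopf_alg :: "nat \<Rightarrow> (nat \<Rightarrow> nat \<Rightarrow> nat \<Rightarrow> 'k::field) \<Rightarrow> (nat \<Rightarrow> 'k)
    \<Rightarrow> (nat \<Rightarrow> nat \<Rightarrow> nat \<Rightarrow> 'k) \<Rightarrow> (nat \<Rightarrow> 'k) \<Rightarrow> bool" where
  "hopf_alg d C u D e \<longleftrightarrow>
    (\<forall>i<d. \<forall>j<d. \<forall>l<d. \<forall>q<d. (\<Sum>p<d. C i j p * C p l q) = (\<Sum>p<d. C j l p * C i p q)) \<and>
    (\<forall>j<d. \<forall>q<d. (\<Sum>i<d. u i * C i j q) = (if j = q then 1 else 0) \<and>
                  (\<Sum>i<d. u i * C j i q) = (if j = q then 1 else 0)) \<and>
    (\<forall>i<d. \<forall>a<d. \<forall>b<d. \<forall>l<d. (\<Sum>j<d. D i j l * D j a b) = (\<Sum>p<d. D i a p * D p b l)) \<and>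
    (\<forall>i<d. \<forall>l<d. (\<Sum>j<d. e j * D i j l) = (if i = l then 1 else 0)) \<and>
    (\<forall>i<d. \<forall>j<d. (\<Sum>l<d. e l * D i j l) = (if i = j then 1 else 0)) \<and>
    (\<forall>i<d. \<forall>j<d. \<forall>a<d. \<forall>b<d. (\<Sum>p<d. C i j p * D p a b) =
        (\<Sum>a1<d. \<Sum>b1<d. \<Sum>a2<d. \<Sum>b2<d. D i a1 b1 * D j a2 b2 * C a1 a2 a * C b1 b2 b)) \<and>
    (\<forall>a<d. \<forall>b<d. (\<Sum>i<d. u i * D i a b) = u a * u b) \<and>
    (\<forall>i<d. \<forall>j<d. (\<Sum>p<d. C i j p * e p) = e i * e j) \<and>
    (\<Sum>i<d. u i * e i) = 1 \<and>
    (\<exists>S. \<forall>i<d. \<forall>q<d.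
        (\<Sum>j<d. \<Sum>l<d. \<Sum>p<d. D i j l * S j p * C p l q) = e i * u q \<and>
        (\<Sum>j<d. \<Sum>l<d. \<Sum>p<d. D i j l * S l p * C j p q) = e i * u q)"

definition vecs :: "nat \<Rightarrow> (nat \<Rightarrow> 'k::zero) set" where
  "vecs d = {v. \<forall>i\<ge>d. v i = 0}"

definition alg_mul :: "nat \<Rightarrow> (nat \<Rightarrow> nat \<Rightarrow> nat \<Rightarrow> 'k::field) \<Rightarrow> (nat \<Rightarrow> 'k) \<Rightarrow> (nat \<Rightarrow> 'k) \<Rightarrow> nat \<Rightarrow> 'k" where
  "alg_mul d C v w = (\<lambda>q. if q < d then (\<Sum>i<d. \<Sum>j<d. v i * w j * C i j q) else 0)"

definition subspace_d :: "nat \<Rightarrow> (nat \<Rightarrow> 'k::field) set \<Rightarrow> bool" where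
  "subspace_d d L \<longleftrightarrow> L \<subseteq> vecs d \<and> (\<lambda>_. 0) \<in> L \<and>
     (\<forall>x\<in>L. \<forall>y\<in>L. (\<lambda>i. x i + y i) \<in> L) \<and> (\<forall>c. \<forall>x\<in>L. (\<lambda>i. c * x i) \<in> L)"

definition left_ideal_d :: "nat \<Rightarrow> (nat \<Rightarrow> nat \<Rightarrow> nat \<Rightarrow> 'k::field) \<Rightarrow> (nat \<Rightarrow> 'k) set \<Rightarrow> bool" where
  "left_ideal_d d C L \<longleftrightarrow> subspace_d d L \<and> (\<forall>h\<in>vecs d. \<forall>x\<in>L. alg_mul d C h x \<in> L)"

text \<open>Right coideal = right H-subcomodule of H_H: Delta(L) \<subseteq> L (x) H.\<close>
definition right_coideal_d :: "nat \<Rightarrow> (nat \<Rightarrow> nat \<Rightarrow> nat \<Rightarrow> 'k::field) \<Rightarrow> (nat \<Rightarrow> 'k) set \<Rightarrow> bool" where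
  "right_coideal_d d D L \<longleftrightarrow> subspace_d d L \<and>
     (\<forall>v\<in>L. \<forall>l<d. (\<lambda>j. if j < d then (\<Sum>i<d. v i * D i j l) else 0) \<in> L)"

definition complemented_d :: "nat \<Rightarrow> ((nat \<Rightarrow> 'k::field) set \<Rightarrow> bool) \<Rightarrow> bool" where
  "complemented_d d P \<longleftrightarrow> (\<forall>L. P L \<longrightarrow> (\<exists>L'. P L' \<and> L \<inter> L' = {\<lambda>_. 0} \<and>
      (\<forall>v\<in>vecs d. \<exists>x\<in>L. \<exists>y\<in>L'. v = (\<lambda>i. x i + y i))))"

definition semisimple_alg :: "nat \<Rightarrow> (nat \<Rightarrow> nat \<Rightarrow> nat \<Rightarrow> 'k::field) \<Rightarrow> bool" where
  "semisimple_alg d C \<longleftrightarrow> complemented_d d (left_ideal_d d C)"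

definition cosemisimple_coalg :: "nat \<Rightarrow> (nat \<Rightarrow> nat \<Rightarrow> nat \<Rightarrow> 'k::field) \<Rightarrow> bool" where
  "cosemisimple_coalg d D \<longleftrightarrow> complemented_d d (right_coideal_d d D)"

text \<open>rho a = sum_(i<d) R i a (x) h_i.\<close>
definition comodule_alg :: "nat \<Rightarrow> (nat \<Rightarrow> nat \<Rightarrow> nat \<Rightarrow> 'k::field) \<Rightarrow> (nat \<Rightarrow> 'k)
    \<Rightarrow> (nat \<Rightarrow> nat \<Rightarrow> nat \<Rightarrow> 'k) \<Rightarrow> (nat \<Rightarrow> 'k) \<Rightarrow> ('k \<Rightarrow> 'm::ring_1) \<Rightarrow> (nat \<Rightarrow> 'm \<Rightarrow> 'm) \<Rightarrow> bool" where
  "comodule_alg d C u D e \<iota> R \<longleftrightarrow>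
    (\<forall>i<d. (\<forall>a b. R i (a + b) = R i a + R i b) \<and> (\<forall>c a. R i (\<iota> c * a) = \<iota> c * R i a)) \<and>
    (\<forall>j<d. \<forall>i<d. \<forall>a. R j (R i a) = (\<Sum>p<d. \<iota> (D p j i) * R p a)) \<and>
    (\<forall>a. (\<Sum>i<d. \<iota> (e i) * R i a) = a) \<and>
    (\<forall>q<d. \<forall>a b. R q (a * b) = (\<Sum>i<d. \<Sum>j<d. R i a * R j b * \<iota> (C i j q))) \<and>
    (\<forall>q<d. R q 1 = \<iota> (u q))"

definition coinv :: "nat \<Rightarrow> (nat \<Rightarrow> 'k) \<Rightarrow> ('k \<Rightarrow> 'm::ring_1) \<Rightarrow> (nat \<Rightarrow> 'm \<Rightarrow> 'm) \<Rightarrow> 'm set" where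
  "coinv d u \<iota> R = {b. \<forall>q<d. R q b = \<iota> (u q) * b}"

text \<open>Formal k-linear combinations of pairs (a,b) represent elements of the free
  k-space on M x M; tens_rel is the subspace of relations defining M (x)_N M.\<close>
definition dlt :: "'m \<Rightarrow> 'm \<Rightarrow> ('m \<times> 'm) \<Rightarrow> 'k::field" where
  "dlt a b = (\<lambda>p. if p = (a, b) then 1 else 0)"

definition tens_gens :: "('k::field \<Rightarrow> 'm::ring_1) \<Rightarrow> 'm set \<Rightarrow> (('m \<times> 'm) \<Rightarrow> 'k) set" where
  "tens_gens \<iota> N =
     {\<lambda>p. dlt (a + a') b p - dlt a b p - dlt a' b p | a a' b. True} \<union>
     {\<lambda>p. dlt a (b + b') p - dlt a b p - dlt a b' p | a b b'. True} \<union>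
     {\<lambda>p. dlt (a * n) b p - dlt a (n * b) p | a n b. n \<in> N} \<union>
     {\<lambda>p. dlt (\<iota> c * a) b p - c * dlt a b p | c a b. True}"

inductive_set tens_rel :: "('k::field \<Rightarrow> 'm::ring_1) \<Rightarrow> 'm set \<Rightarrow> (('m \<times> 'm) \<Rightarrow> 'k) set"
  for \<iota> N where
  zero: "(\<lambda>_. 0) \<in> tens_rel \<iota> N"
| step: "f \<in> tens_rel \<iota> N \<Longrightarrow> g \<in> tens_gens \<iota> N \<Longrightarrow> (\<lambda>p. f p + c * g p) \<in> tens_rel \<iota> N"

text \<open>Galois map on formal sums: a (x) a' |-> sum_q a * R q a' (x) h_q.\<close>
definition galois_map :: "('k::field \<Rightarrow> 'm::ring_1) \<Rightarrow> (nat \<Rightarrow> 'm \<Rightarrow> 'm) \<Rightarrow> (('m \<times> 'm) \<Rightarrow> 'k) \<Rightarrow> nat \<Rightarrow> 'm" where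
  "galois_map \<iota> R f = (\<lambda>q. \<Sum>p\<in>{p. f p \<noteq> 0}. \<iota> (f p) * fst p * R q (snd p))"

definition galois :: "nat \<Rightarrow> ('k::field \<Rightarrow> 'm::ring_1) \<Rightarrow> 'm set \<Rightarrow> (nat \<Rightarrow> 'm \<Rightarrow> 'm) \<Rightarrow> bool" where
  "galois d \<iota> N R \<longleftrightarrow>
     (\<forall>f. finite {p. f p \<noteq> 0} \<longrightarrow> (\<forall>q<d. galois_map \<iota> R f q = 0) \<longrightarrow> f \<in> tens_rel \<iota> N) \<and>
     (\<forall>v. \<exists>f. finite {p. f p \<noteq> 0} \<and> (\<forall>q<d. galois_map \<iota> R f q = v q))"

end

theory Submission
  imports Defs "Jordan_Normal_Form.Determinant" "HOL-Library.Function_Algebras"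
begin

text \<open>
  Both directions work with the algebra \<open>A\<close> of \<open>N\<close>-\<open>N\<close>-bimodule endomorphisms of \<open>M\<close>, which is the
  dual of \<open>H\<close>; the coordinate maps \<open>R i\<close> of the coaction form a basis of \<open>A\<close>, so that structure
  constants of \<open>H\<close> are coefficients of identities between maps \<open>M \<rightarrow> M\<close> and \<open>M \<otimes>\<^sub>N M \<rightarrow> M\<close>.

  If \<open>E\<close> is a Frobenius homomorphism with dual bases \<open>x\<^sub>i, y\<^sub>i\<close>, the adjoints with respect to \<open>E\<close> of a
  basis of \<open>End M\<^sub>N\<close> as in the definition of depth two form a free right \<open>M\<close>-basis \<open>R i\<close> of
  \<open>End \<^sub>N M\<close>, and irreducibility makes it a \<open>k\<close>-basis of \<open>A\<close>. Expanding \<open>R q (a b)\<close> in this basis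
  gives the coproduct of \<open>A\<close>, and taking adjoints, \<open>E (a(v) w) = E (v S(a)(w))\<close>, gives its antipode.
  The forms \<open>\<Sum>\<^sub>i a(x\<^sub>i) b(y\<^sub>i)\<close> and \<open>(S \<otimes> 1) \<Delta>(E)\<close> are multiples of separability elements of \<open>H\<close> and of
  \<open>A\<close>, whence \<open>H\<close> is semisimple and cosemisimple.

  Conversely, semisimplicity and cosemisimplicity provide two-sided integrals \<open>z\<close> of \<open>H\<close> and \<open>E\<close> of \<open>A\<close>
  with \<open>\<epsilon>(z) = 1\<close> and \<open>E(1) = 1\<close>. The preimage \<open>\<Sum>\<^sub>i x\<^sub>i \<otimes> y\<^sub>i\<close> of \<open>1 \<otimes> z\<close> under the Galois map
  commutes with \<open>M\<close>, which yields dual bases up to the factor \<open>\<tau> = E(z)\<close>. If \<open>\<tau>\<close> vanished, the identity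
  \<open>\<Sum>\<^sub>i x\<^sub>i E (b(y\<^sub>i) m) = \<tau> S(b)(m)\<close> would force \<open>z (\<Sum> E\<^sub>1 S(E\<^sub>2)) = 0\<close>, although this value is
  \<open>E(1) \<epsilon>(z) = 1\<close>.
\<close>

section \<open>Linear algebra in coordinates\<close>

text \<open>\<open>semisimple_alg\<close> and \<open>cosemisimple_coalg\<close> provide complements
  for left ideals and right coideals only, hence integrals invariant on one side. The other side
  follows because the defects \<open>z h - e(h) z\<close> multiply to zero among themselves, and
  such operators vanish on a module with complements. For \<open>E\<close> the two sides have
  separate tasks: one puts the values of \<open>E\<close> into \<open>N\<close>, the other makes
  \<open>E\<close> absorb every \<open>R l\<close>, which yields adjoints through the antipode.

  In the opposite direction, \<open>E 1\<close> and the index \<open>\<Sum>i. x i * y i\<close>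
  commute with \<open>N\<close> and are therefore scalars. They are exactly the factors by which the
  two invariant forms miss being separability elements: multiplied out,
  \<open>(S \<otimes> 1) \<Delta>(E)\<close> gives the first and
  \<open>\<Sum>i. R p (x i) * R q (y i)\<close> gives the second. Strong separability says that both
  can be divided by.

  Two finiteness points: a depth two basis may a priori be infinite and is cut down by the finite
  dual bases; and adjoints under \<open>E\<close> give the antipode law on one side only, the other
  being a consequence of finite dimension.\<close>

lemma matrix_left_right_inverse:
  fixes F G :: "'i \<Rightarrow> 'i \<Rightarrow> 'k::field"
  assumes fin: "finite I"
    and FG: "\<And>i j. i \<in> I \<Longrightarrow> j \<in> I \<Longrightarrow> (\<Sum>k\<in>I. F i k * G k j) = (if i = j then 1 else 0)"
    and ij: "i \<in> I" "j \<in> I"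
  shows "(\<Sum>k\<in>I. G i k * F k j) = (if i = j then 1 else 0)"
proof -
  define n where "n = card I"
  obtain h where h: "bij_betw h {0..<n} I"
    using ex_bij_betw_nat_finite[OF fin] unfolding n_def by blast
  define A where "A = mat n n (\<lambda>(a, b). F (h a) (h b))"
  define B where "B = mat n n (\<lambda>(a, b). G (h a) (h b))"
  have hI: "h a \<in> I" if "a < n" for a using h that by (auto simp: bij_betw_def)
  have inj: "h a = h b \<longleftrightarrow> a = b" if "a < n" "b < n" for a b
    using h that by (auto simp: bij_betw_def inj_on_def)
  have re: "(\<Sum>k\<in>I. f k) = (\<Sum>a = 0..<n. f (h a))" for f :: "'i \<Rightarrow> 'k"
    using sum.reindex_bij_betw[OF h, of f] by simp
  have "A * B = 1\<^sub>m n"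
  proof (rule eq_matI)
    fix a b assume "a < dim_row (1\<^sub>m n :: 'k mat)" "b < dim_col (1\<^sub>m n :: 'k mat)"
    then have ab: "a < n" "b < n" by auto
    then have "(A * B) $$ (a, b) = (\<Sum>k\<in>I. F (h a) k * G k (h b))"
      by (simp add: A_def B_def scalar_prod_def re)
    then show "(A * B) $$ (a, b) = 1\<^sub>m n $$ (a, b)" using ab by (simp add: FG hI inj)
  qed (auto simp: A_def B_def)
  then have BA: "B * A = 1\<^sub>m n"
    using mat_mult_left_right_inverse[of A n B] by (simp add: A_def B_def)
  obtain a b where ab: "a < n" "b < n" "i = h a" "j = h b"
    using h ij by (force simp: bij_betw_def)
  have "(B * A) $$ (a, b) = (\<Sum>k\<in>I. G i k * F k j)"
    using ab by (simp add: A_def B_def scalar_prod_def re)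
  then show ?thesis using ab BA inj by simp
qed

section \<open>Left ideals and right coideals as stable subspaces of one kind\<close>

definition mop :: "nat \<Rightarrow> (nat \<Rightarrow> nat \<Rightarrow> nat \<Rightarrow> 'k::field) \<Rightarrow> nat \<Rightarrow> (nat \<Rightarrow> 'k) \<Rightarrow> nat \<Rightarrow> 'k" where
  "mop d P l v = (\<lambda>j. if j < d then (\<Sum>i<d. v i * P l i j) else 0)"

definition stable_d :: "nat \<Rightarrow> (nat \<Rightarrow> nat \<Rightarrow> nat \<Rightarrow> 'k::field) \<Rightarrow> (nat \<Rightarrow> 'k) set \<Rightarrow> bool" where
  "stable_d d P L \<longleftrightarrow> subspace_d d L \<and> (\<forall>l<d. \<forall>v\<in>L. mop d P l v \<in> L)"

lemma mop_add: "mop d P l (\<lambda>i. v i + w i) = (\<lambda>i. mop d P l v i + mop d P l w i)"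
  by (auto simp: mop_def fun_eq_iff algebra_simps sum.distrib)

lemma mop_scale: "mop d P l (\<lambda>i. c * v i) = (\<lambda>i. c * mop d P l v i)"
  by (auto simp: mop_def fun_eq_iff algebra_simps sum_distrib_left)

lemma mop_zero [simp]: "mop d P l (\<lambda>_. 0) = (\<lambda>_. 0)"
  by (auto simp: mop_def)

lemma mop_sum: "mop d P l (\<lambda>i. \<Sum>k\<in>K. f k i) = (\<lambda>i. \<Sum>k\<in>K. mop d P l (f k) i)"
  by (induct K rule: infinite_finite_induct) (auto simp: mop_add)

lemma mop_vecs [simp]: "mop d P l v \<in> vecs d"
  by (auto simp: mop_def vecs_def)

lemma subspace_dD:
  assumes "subspace_d d L"
  shows "x \<in> L \<Longrightarrow> x \<in> vecs d" "(\<lambda>_. 0) \<in> L"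
    "x \<in> L \<Longrightarrow> y \<in> L \<Longrightarrow> (\<lambda>i. x i + y i) \<in> L" "x \<in> L \<Longrightarrow> (\<lambda>i. c * x i) \<in> L"
  using assms by (auto simp: subspace_d_def)

lemma subspace_d_sum:
  assumes "subspace_d d L" "\<And>k. k \<in> K \<Longrightarrow> f k \<in> L"
  shows "(\<lambda>i. \<Sum>k\<in>K. f k i) \<in> L"
  using assms(2)
  by (induct K rule: infinite_finite_induct) (auto intro: subspace_dD[OF assms(1)])

lemma subspace_d_diff:
  assumes "subspace_d d L" "x \<in> L" "y \<in> L"
  shows "(\<lambda>i. x i - y i) \<in> L"
  using subspace_dD(3)[OF assms(1,2) subspace_dD(4)[OF assms(1,3), of "-1"]] by simp

lemma left_ideal_eq_stable: "left_ideal_d d C = stable_d d C"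
proof (intro ext iffI)
  fix L assume L: "left_ideal_d d C L"
  show "stable_d d C L"
    unfolding stable_d_def
  proof (intro conjI allI impI ballI)
    show "subspace_d d L" using L by (simp add: left_ideal_d_def)
    fix l v assume l: "l < d" and v: "v \<in> L"
    define h where "h = (\<lambda>i. if i = l then 1 else 0::'a)"
    have "h \<in> vecs d" using l by (auto simp: h_def vecs_def)
    then have "alg_mul d C h v \<in> L" using L v by (auto simp: left_ideal_d_def)
    moreover have "(\<Sum>i<d. \<Sum>j<d. h i * v j * C i j q) = (\<Sum>i<d. v i * C l i q)" for q
    proof -
      have "(\<Sum>i<d. \<Sum>j<d. h i * v j * C i j q) = (\<Sum>i<d. if i = l then \<Sum>j<d. v j * C l j q else 0)"
        by (rule sum.cong) (auto simp: h_def)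
      also have "\<dots> = (\<Sum>j<d. v j * C l j q)" using l by simp
      finally show ?thesis .
    qed
    ultimately show "mop d C l v \<in> L" by (simp only: alg_mul_def mop_def)
  qed
next
  fix L assume L: "stable_d d C L"
  show "left_ideal_d d C L"
    unfolding left_ideal_d_def
  proof (intro conjI ballI)
    show s: "subspace_d d L" using L by (simp add: stable_d_def)
    fix h x assume x: "x \<in> L"
    have "alg_mul d C h x = (\<lambda>q. \<Sum>i<d. h i * mop d C i x q)"
      by (auto simp: alg_mul_def mop_def fun_eq_iff sum_distrib_left mult.assoc)
    then show "alg_mul d C h x \<in> L"
      using L x by (auto intro!: subspace_d_sum[OF s] subspace_dD(4)[OF s] simp: stable_d_def)
  qed
qed

lemma right_coideal_eq_stable: "right_coideal_d d D = stable_d d (\<lambda>l i j. D i j l)"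
  by (auto simp: fun_eq_iff right_coideal_d_def stable_d_def mop_def)

lemma subspace_projection:
  fixes L :: "(nat \<Rightarrow> 'k::field) set"
  assumes L: "subspace_d d L"
  obtains X where "\<And>v w. X (\<lambda>i. v i + w i) = (\<lambda>i. X v i + X w i)"
    "\<And>c v. X (\<lambda>i. c * v i) = (\<lambda>i. c * X v i)"
    "\<And>v. X v \<in> L" "\<And>v. v \<in> L \<Longrightarrow> X v = v"
proof -
  interpret vs: vector_space "\<lambda>c (f::nat \<Rightarrow> 'k) i. c * f i"
    by unfold_locales (auto simp: fun_eq_iff algebra_simps)
  interpret vp: vector_space_pair "\<lambda>c (f::nat \<Rightarrow> 'k) i. c * f i" "\<lambda>c (f::nat \<Rightarrow> 'k) i. c * f i"
    by unfold_locales
  have sub: "vs.subspace L"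
    unfolding vs.subspace_def using subspace_dD[OF L]
    by (auto simp: zero_fun_def plus_fun_def)
  have lin: "Vector_Spaces.linear (\<lambda>c (f::nat \<Rightarrow> 'k) i. c * f i) (\<lambda>c (f::nat \<Rightarrow> 'k) i. c * f i) id"
    using vs.linear_id by (simp add: id_def)
  \<comment> \<open>A left inverse on \<open>L\<close> of the identity, with range inside
    \<open>L\<close>, is a projection onto \<open>L\<close>.\<close>
  obtain X where X: "Vector_Spaces.linear (\<lambda>c (f::nat \<Rightarrow> 'k) i. c * f i) (\<lambda>c (f::nat \<Rightarrow> 'k) i. c * f i) X"
    "range X \<subseteq> L" "\<forall>x\<in>L. X (id x) = x"
    using vp.linear_exists_left_inverse_on[OF lin sub] by (auto simp: image_subset_iff)
  show thesis
  proof (rule that)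
    show "X (\<lambda>i. v i + w i) = (\<lambda>i. X v i + X w i)" for v w
      using vp.linear_add[OF X(1), of v w] by (simp add: plus_fun_def)
    show "X (\<lambda>i. c * v i) = (\<lambda>i. c * X v i)" for c v
      using vp.linear_scale[OF X(1), of c v] by simp
  qed (use X in auto)
qed

text \<open>Maschke's theorem in the form: a projection averaged over a separability element
  \<open>\<Sum>l m. s l m (b\<^sub>l \<otimes> b\<^sub>m)\<close> becomes a module map.\<close>

lemma complemented_of_separability_element:
  assumes mm: "\<And>k l v. k < d \<Longrightarrow> l < d \<Longrightarrow> mop d P k (mop d P l v) = (\<lambda>j. \<Sum>p<d. c k l p * mop d P p v j)"
    and unit: "\<And>v j. v \<in> vecs d \<Longrightarrow> (\<Sum>l<d. \<Sum>m<d. s l m * mop d P l (mop d P m v) j) = v j"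
    and cas: "\<And>k m p. k < d \<Longrightarrow> m < d \<Longrightarrow> p < d \<Longrightarrow>
      (\<Sum>l<d. s l m * c k l p) = (\<Sum>l<d. s p l * c l k m)"
  shows "complemented_d d (stable_d d P)"
  unfolding complemented_d_def
proof (intro allI impI)
  fix L assume "stable_d d P L"
  then have sub: "subspace_d d L" and st: "\<And>l v. l < d \<Longrightarrow> v \<in> L \<Longrightarrow> mop d P l v \<in> L"
    by (auto simp: stable_d_def)
  obtain X where X: "\<And>v w. X (\<lambda>i. v i + w i) = (\<lambda>i. X v i + X w i)"
    "\<And>c v. X (\<lambda>i. c * v i) = (\<lambda>i. c * X v i)"
    "\<And>v. X v \<in> L" "\<And>v. v \<in> L \<Longrightarrow> X v = v"
    using subspace_projection[OF sub] by blast
  have X0: "X (\<lambda>_. 0) = (\<lambda>_. 0)" using X(2)[of 0] by simp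
  have Xsum: "X (\<lambda>i. \<Sum>k\<in>K. f k i) = (\<lambda>i. \<Sum>k\<in>K. X (f k) i)" for f and K :: "nat set"
    by (induct K rule: infinite_finite_induct) (auto simp: X X0)
  \<comment> \<open>The projection averaged over the separability element:
    \<open>Y = \<Sum> s l m b_l X b_m\<close>.\<close>
  define Y where "Y v = (\<lambda>j. \<Sum>l<d. \<Sum>m<d. s l m * mop d P l (X (mop d P m v)) j)" for v
  have YL: "Y v \<in> L" for v
    unfolding Y_def by (intro subspace_d_sum[OF sub] subspace_dD(4)[OF sub] st X(3)) auto
  have Yid: "Y v = v" if "v \<in> L" for v
  proof
    fix j
    have "Y v j = (\<Sum>l<d. \<Sum>m<d. s l m * mop d P l (mop d P m v) j)"
      unfolding Y_def by (intro sum.cong refl) (use st that X(4) in auto)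
    then show "Y v j = v j" using unit subspace_dD(1)[OF sub that] by simp
  qed
  have Yadd: "Y (\<lambda>i. v i + w i) = (\<lambda>i. Y v i + Y w i)" for v w
    by (auto simp: Y_def mop_add X algebra_simps sum.distrib)
  have Yscale: "Y (\<lambda>i. a * v i) = (\<lambda>i. a * Y v i)" for a v
    by (auto simp: Y_def mop_scale X algebra_simps sum_distrib_left)
  have Ycomm: "Y (mop d P k v) = mop d P k (Y v)" if k: "k < d" for k v
  proof
    fix j
    have "mop d P k (Y v) j = (\<Sum>l<d. \<Sum>m<d. s l m * mop d P k (mop d P l (X (mop d P m v))) j)"
      unfolding Y_def by (simp add: mop_sum mop_scale)
    also have "\<dots> = (\<Sum>l<d. \<Sum>m<d. \<Sum>p<d. s l m * c k l p * mop d P p (X (mop d P m v)) j)"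
      by (intro sum.cong refl) (use k in \<open>auto simp: mm sum_distrib_left mult.assoc\<close>)
    also have "\<dots> = (\<Sum>m<d. \<Sum>p<d. \<Sum>l<d. s l m * c k l p * mop d P p (X (mop d P m v)) j)"
      by (subst sum.swap, rule sum.cong[OF refl], rule sum.swap)
    \<comment> \<open>\<open>cas\<close> compares the coefficients of
      \<open>b_p \<otimes> b_m\<close> in \<open>b_k s\<close> and \<open>s b_k\<close>; it carries
      \<open>b_k\<close> from the left of \<open>X\<close> to its right.\<close>
    also have "\<dots> = (\<Sum>m<d. \<Sum>p<d. (\<Sum>l<d. s p l * c l k m) * mop d P p (X (mop d P m v)) j)"
      by (intro sum.cong refl) (use k in \<open>auto simp: cas[symmetric] sum_distrib_right\<close>)
    also have "\<dots> = (\<Sum>p<d. \<Sum>m<d. \<Sum>l<d. s p l * c l k m * mop d P p (X (mop d P m v)) j)"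
      by (subst sum.swap) (simp add: sum_distrib_right)
    also have "\<dots> = (\<Sum>p<d. \<Sum>l<d. \<Sum>m<d. s p l * c l k m * mop d P p (X (mop d P m v)) j)"
      by (rule sum.cong[OF refl], rule sum.swap)
    also have "\<dots> = (\<Sum>p<d. \<Sum>l<d. s p l * mop d P p (X (mop d P l (mop d P k v))) j)"
      by (intro sum.cong refl)
        (use k in \<open>auto simp: mm Xsum X mop_sum mop_scale sum_distrib_left mult.assoc\<close>)
    finally show "Y (mop d P k v) j = mop d P k (Y v) j" by (simp add: Y_def)
  qed
  have Y0: "Y (\<lambda>_. 0) = (\<lambda>_. 0)" using Yscale[of 0] by simp
  show "\<exists>L'. stable_d d P L' \<and> L \<inter> L' = {\<lambda>_. 0} \<and> (\<forall>v\<in>vecs d. \<exists>x\<in>L. \<exists>y\<in>L'. v = (\<lambda>i. x i + y i))"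
  proof (intro exI conjI)
    \<comment> \<open>The complement is the kernel of \<open>Y\<close>, stable because
      \<open>Y\<close> commutes with the operators.\<close>
    define L' where "L' = {v \<in> vecs d. Y v = (\<lambda>_. 0)}"
    show "stable_d d P L'"
      unfolding stable_d_def subspace_d_def L'_def
      by (auto simp: Y0 Yadd Yscale Ycomm) (auto simp: vecs_def)
    show "L \<inter> L' = {\<lambda>_. 0}"
      using Yid Y0 subspace_dD(2)[OF sub] by (auto simp: L'_def vecs_def)
    show "\<forall>v\<in>vecs d. \<exists>x\<in>L. \<exists>y\<in>L'. v = (\<lambda>i. x i + y i)"
    proof
      fix v :: "nat \<Rightarrow> 'a" assume v: "v \<in> vecs d"
      have "Y (\<lambda>i. v i + (-1) * Y v i) = (\<lambda>_. 0)"
        by (simp only: Yadd Yscale Yid[OF YL]) simp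
      moreover have "(\<lambda>i. v i + (-1) * Y v i) \<in> vecs d"
        using v subspace_dD(1)[OF sub YL, of v] by (auto simp: vecs_def)
      ultimately have "(\<lambda>i. v i + (-1) * Y v i) \<in> L'" by (simp add: L'_def)
      moreover have "v = (\<lambda>i. Y v i + (v i + (-1) * Y v i))" by simp
      ultimately show "\<exists>x\<in>L. \<exists>y\<in>L'. v = (\<lambda>i. x i + y i)" using YL[of v]
        by (intro bexI[of _ "Y v"] bexI[of _ "\<lambda>i. v i + (-1) * Y v i"])
    qed
  qed
qed

section \<open>Invariants obtained from complements\<close>

lemma complement_obtain:
  assumes "complemented_d d P" "P L"
  obtains L' where "P L'" "L \<inter> L' = {\<lambda>_. 0}"
    "\<And>v. v \<in> vecs d \<Longrightarrow> \<exists>x\<in>L. \<exists>y\<in>L'. v = (\<lambda>i. x i + y i)"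
proof -
  have "\<exists>L'. P L' \<and> L \<inter> L' = {\<lambda>_. 0} \<and> (\<forall>v\<in>vecs d. \<exists>x\<in>L. \<exists>y\<in>L'. v = (\<lambda>i. x i + y i))"
    using assms by (simp add: complemented_d_def)
  then show thesis by (elim exE conjE) (rule that, auto)
qed

lemma delta_expand:
  fixes v :: "nat \<Rightarrow> 'k::field"
  assumes "v \<in> vecs d"
  shows "v = (\<lambda>i. \<Sum>k<d. v k * (if i = k then 1 else 0))"
proof
  fix i
  have "(\<Sum>k<d. v k * (if i = k then 1 else 0)) = (\<Sum>k<d. if i = k then v k else 0)"
    by (rule sum.cong) auto
  then show "v i = (\<Sum>k<d. v k * (if i = k then 1 else 0))" using assms by (auto simp: vecs_def)
qed

text \<open>The line through \<open>u\<close> is stable. Projection onto it along a stable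
  complement has the form \<open>v \<mapsto> t(v) u\<close>, and stability of its kernel makes
  \<open>t\<close> transform by the same character \<open>\<chi>\<close> as
  \<open>u\<close>.\<close>

lemma invariant_functional:
  fixes P :: "nat \<Rightarrow> nat \<Rightarrow> nat \<Rightarrow> 'k::field"
  assumes comp: "complemented_d d (stable_d d P)"
    and inv: "\<And>l j. l < d \<Longrightarrow> j < d \<Longrightarrow> (\<Sum>i<d. u i * P l i j) = \<chi> l * u j"
    and nz: "i0 < d" "u i0 \<noteq> 0"
  obtains t where "(\<Sum>i<d. u i * t i) = 1"
    "\<And>l i. l < d \<Longrightarrow> i < d \<Longrightarrow> (\<Sum>j<d. P l i j * t j) = \<chi> l * t i"
proof -
  define w where "w = (\<lambda>i. if i < d then u i else 0)"
  define L where "L = {v. \<exists>c. v = (\<lambda>i. c * w i)}"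
  have mw: "mop d P l w = (\<lambda>i. \<chi> l * w i)" if "l < d" for l
    using inv that by (auto simp: mop_def w_def fun_eq_iff)
  have "stable_d d P L"
    unfolding stable_d_def
  proof (intro conjI allI impI ballI)
    have *: "(\<lambda>_. 0) \<in> L" unfolding L_def by (intro CollectI exI[of _ 0]) simp
    have **: "(\<lambda>i. x i + y i) \<in> L" if "x \<in> L" "y \<in> L" for x y
    proof -
      obtain a b where "x = (\<lambda>i. a * w i)" "y = (\<lambda>i. b * w i)"
        using \<open>x \<in> L\<close> \<open>y \<in> L\<close> unfolding L_def by blast
      then show ?thesis unfolding L_def by (intro CollectI exI[of _ "a + b"]) (simp add: distrib_right)
    qed
    have ***: "(\<lambda>i. c * x i) \<in> L" if "x \<in> L" for c x
    proof -
      obtain a where "x = (\<lambda>i. a * w i)" using \<open>x \<in> L\<close> unfolding L_def by blast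
      then show ?thesis unfolding L_def by (intro CollectI exI[of _ "c * a"]) (simp add: mult.assoc)
    qed
    have "L \<subseteq> vecs d" by (auto simp: L_def vecs_def w_def)
    then show "subspace_d d L"
      using * ** *** by (simp add: subspace_d_def)
    fix l v assume lv: "l < d" "v \<in> L"
    then obtain a where "v = (\<lambda>i. a * w i)" unfolding L_def by blast
    moreover have "w \<in> L" unfolding L_def by (intro CollectI exI[of _ 1]) simp
    ultimately show "mop d P l v \<in> L" by (simp add: mop_scale mw lv ***)
  qed
  from complement_obtain[OF comp this] obtain L' where L': "stable_d d P L'" "L \<inter> L' = {\<lambda>_. 0}"
    "\<And>v. v \<in> vecs d \<Longrightarrow> \<exists>x\<in>L. \<exists>y\<in>L'. v = (\<lambda>i. x i + y i)" by blast
  have sub: "subspace_d d L'" using L'(1) by (simp add: stable_d_def)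
  \<comment> \<open>The value of the functional at the \<open>k\<close>-th basis vector is the
    coefficient of its component along \<open>w\<close>.\<close>
  have "\<exists>c. (\<lambda>i. (if i = k then 1 else 0) - c * w i) \<in> L'" if "k < d" for k
  proof -
    have "(\<lambda>i. if i = k then 1 else 0 :: 'k) \<in> vecs d" using that by (auto simp: vecs_def)
    then obtain x y where "x \<in> L" "y \<in> L'" "(\<lambda>i. if i = k then 1 else 0) = (\<lambda>i. x i + y i)"
      using L'(3) by blast
    then obtain c where "(\<lambda>i. if i = k then 1 else 0) = (\<lambda>i. c * w i + y i)"
      by (auto simp: L_def)
    then have "y = (\<lambda>i. (if i = k then 1 else 0) - c * w i)"
      by (metis (no_types, lifting) add_diff_cancel_left' ext)
    then show ?thesis using \<open>y \<in> L'\<close> by blast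
  qed
  then obtain t where t: "\<And>k. k < d \<Longrightarrow> (\<lambda>i. (if i = k then 1 else 0) - t k * w i) \<in> L'"
    by metis
  have dec: "(\<lambda>i. v i - (\<Sum>k<d. v k * t k) * w i) \<in> L'" if "v \<in> vecs d" for v
  proof -
    have "(\<lambda>i. \<Sum>k<d. v k * ((if i = k then 1 else 0) - t k * w i)) \<in> L'"
      by (intro subspace_d_sum[OF sub] subspace_dD(4)[OF sub] t) auto
    also have "(\<lambda>i. \<Sum>k<d. v k * ((if i = k then 1 else 0) - t k * w i))
        = (\<lambda>i. (\<Sum>k<d. v k * (if i = k then 1 else 0)) - (\<Sum>k<d. v k * t k) * w i)"
      by (simp add: right_diff_distrib sum_subtractf sum_distrib_right mult.assoc)
    also have "\<dots> = (\<lambda>i. v i - (\<Sum>k<d. v k * t k) * w i)"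
      using delta_expand[OF that] by metis
    finally show ?thesis .
  qed
  have zero: "c = 0" if "(\<lambda>i. c * w i) \<in> L'" for c
  proof -
    have "(\<lambda>i. c * w i) \<in> L \<inter> L'" using that by (auto simp: L_def)
    then have "(\<lambda>i. c * w i) = (\<lambda>_. 0)" using L'(2) by simp
    from fun_cong[OF this, of i0] show ?thesis using nz by (simp add: w_def)
  qed
  have tL': "(\<Sum>k<d. v k * t k) = 0" if "v \<in> L'" for v
  proof -
    have "(\<lambda>i. v i - (v i - (\<Sum>k<d. v k * t k) * w i)) \<in> L'"
      by (intro subspace_d_diff[OF sub] that dec subspace_dD(1)[OF sub])
    then show ?thesis by (intro zero) simp
  qed
  have wv: "w \<in> vecs d" by (auto simp: w_def vecs_def)
  have tw: "(\<Sum>k<d. w k * t k) = 1"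
  proof -
    have "(\<lambda>i. (1 - (\<Sum>k<d. w k * t k)) * w i) \<in> L'"
      using dec[OF wv] by (simp add: left_diff_distrib)
    from zero[OF this] show ?thesis by simp
  qed
  show thesis
  proof (rule that)
    show "(\<Sum>i<d. u i * t i) = 1" using tw by (simp add: w_def)
    fix l i assume l: "l < d" and i: "i < d"
    \<comment> \<open>The component of the \<open>i\<close>-th basis vector in \<open>L'\<close>;
      its image under the operator \<open>l\<close> stays in \<open>L'\<close>, where
      \<open>t\<close> vanishes, and this is the claimed identity.\<close>
    define v where "v = (\<lambda>r. (if r = i then 1 else 0) - t i * w r)"
    have "mop d P l v \<in> L'" using t[OF i] L'(1) l by (auto simp: stable_d_def v_def)
    moreover have "mop d P l v = (\<lambda>j. if j < d then P l i j - t i * \<chi> l * w j else 0)"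
    proof
      fix j
      have "v = (\<lambda>r. (if r = i then 1 else 0) + (- t i) * w r)" by (auto simp: v_def)
      then have "mop d P l v j = mop d P l (\<lambda>r. if r = i then 1 else 0) j + (- t i) * mop d P l w j"
        by (simp only: mop_add mop_scale)
      also have "mop d P l (\<lambda>r. if r = i then 1 else 0) j = (if j < d then P l i j else 0)"
      proof -
        have "(\<Sum>r<d. (if r = i then 1 else 0) * P l r j) = (\<Sum>r<d. if r = i then P l r j else 0)"
          by (rule sum.cong) auto
        then show ?thesis using i by (simp add: mop_def)
      qed
      finally show "mop d P l v j = (if j < d then P l i j - t i * \<chi> l * w j else 0)"
        by (simp add: mw l) (simp add: w_def)
    qed
    ultimately have "(\<Sum>k<d. (P l i k - t i * \<chi> l * w k) * t k) = 0"
      using tL' by fastforce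
    then have "(\<Sum>k<d. P l i k * t k) = t i * \<chi> l * (\<Sum>k<d. w k * t k)"
      by (simp add: left_diff_distrib sum_subtractf sum_distrib_left mult.assoc)
    then show "(\<Sum>j<d. P l i j * t j) = \<chi> l * t i" using tw by (simp add: mult.commute)
  qed
qed

text \<open>Dual to \<open>invariant_functional\<close>: the kernel of \<open>e\<close> is stable,
  and \<open>t\<close> is the component of \<open>u\<close> in a stable complement. The vector
  \<open>mop d P l t - \<chi> l * t\<close> lies in that complement and is killed by
  \<open>e\<close>, so it is zero.\<close>

lemma invariant_vector:
  fixes P :: "nat \<Rightarrow> nat \<Rightarrow> nat \<Rightarrow> 'k::field"
  assumes comp: "complemented_d d (stable_d d P)"
    and inv: "\<And>l i. l < d \<Longrightarrow> i < d \<Longrightarrow> (\<Sum>j<d. P l i j * e j) = \<chi> l * e i"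
    and nz: "(\<Sum>i<d. u i * e i) = 1"
  obtains t where "(\<Sum>i<d. t i * e i) = 1"
    "\<And>l j. l < d \<Longrightarrow> j < d \<Longrightarrow> (\<Sum>i<d. t i * P l i j) = \<chi> l * t j"
proof -
  define ev where "ev v = (\<Sum>i<d. v i * e i)" for v
  have ev_add: "ev (\<lambda>i. v i + w i) = ev v + ev w" for v w
    by (simp add: ev_def distrib_right sum.distrib)
  have ev_scale: "ev (\<lambda>i. c * v i) = c * ev v" for c v
    by (simp add: ev_def sum_distrib_left mult.assoc)
  have ev_mop: "ev (mop d P l v) = \<chi> l * ev v" if "l < d" for l v
  proof -
    have "ev (mop d P l v) = (\<Sum>j<d. \<Sum>i<d. v i * P l i j * e j)"
      by (simp add: ev_def mop_def sum_distrib_right)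
    also have "\<dots> = (\<Sum>i<d. v i * (\<Sum>j<d. P l i j * e j))"
      by (subst sum.swap) (simp add: sum_distrib_left mult.assoc)
    also have "\<dots> = \<chi> l * ev v"
      using inv that by (simp add: ev_def sum_distrib_left mult.left_commute)
    finally show ?thesis .
  qed
  define L where "L = {v \<in> vecs d. ev v = 0}"
  have "stable_d d P L"
    by (auto simp: stable_d_def subspace_d_def L_def ev_add ev_scale ev_mop)
      (auto simp: vecs_def ev_def)
  from complement_obtain[OF comp this] obtain L' where L': "stable_d d P L'" "L \<inter> L' = {\<lambda>_. 0}"
    "\<And>v. v \<in> vecs d \<Longrightarrow> \<exists>x\<in>L. \<exists>y\<in>L'. v = (\<lambda>i. x i + y i)" by blast
  have sub: "subspace_d d L'" using L'(1) by (simp add: stable_d_def)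
  have "(\<lambda>i. if i < d then u i else 0) \<in> vecs d" by (auto simp: vecs_def)
  then obtain x t where xt: "x \<in> L" "t \<in> L'" "(\<lambda>i. if i < d then u i else 0) = (\<lambda>i. x i + t i)"
    using L'(3) by blast
  have "ev (\<lambda>i. if i < d then u i else 0) = 1" using nz by (simp add: ev_def)
  then have t1: "ev t = 1" using xt by (simp add: ev_add L_def)
  show thesis
  proof (rule that)
    show "(\<Sum>i<d. t i * e i) = 1" using t1 by (simp add: ev_def)
    fix l j assume l: "l < d" and j: "j < d"
    define w where "w = (\<lambda>i. mop d P l t i + (- \<chi> l) * t i)"
    have "w \<in> L'"
      unfolding w_def by (intro subspace_dD[OF sub]) (use L'(1) l xt in \<open>auto simp: stable_d_def\<close>)
    moreover have "ev w = 0" by (simp only: w_def ev_add ev_scale ev_mop[OF l] t1) simp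
    ultimately have "w \<in> L \<inter> L'" using subspace_dD(1)[OF sub] by (auto simp: L_def)
    then have "w = (\<lambda>_. 0)" using L'(2) by blast
    from fun_cong[OF this, of j] show "(\<Sum>i<d. t i * P l i j) = \<chi> l * t j"
      using j by (simp add: w_def mop_def)
  qed
qed

text \<open>The span of the \<open>Y k\<close> plays the role of a nilpotent ideal, which acts as zero on a
  semisimple module.\<close>

lemma square_zero_operators_vanish:
  assumes comp: "complemented_d d (stable_d d P)"
    and add: "\<And>k v w. k < d \<Longrightarrow> Y k (\<lambda>i. v i + w i) = (\<lambda>i. Y k v i + Y k w i)"
    and scale: "\<And>k c v. k < d \<Longrightarrow> Y k (\<lambda>i. c * v i) = (\<lambda>i. c * Y k v i)"
    and pres: "\<And>k L v. k < d \<Longrightarrow> stable_d d P L \<Longrightarrow> v \<in> L \<Longrightarrow> Y k v \<in> L"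
    and sq: "\<And>k l v. k < d \<Longrightarrow> l < d \<Longrightarrow> v \<in> vecs d \<Longrightarrow> Y k (Y l v) = (\<lambda>_. 0)"
    and ideal: "\<And>k l v. k < d \<Longrightarrow> l < d \<Longrightarrow> v \<in> vecs d \<Longrightarrow> (\<And>p. p < d \<Longrightarrow> Y p v = (\<lambda>_. 0))
        \<Longrightarrow> Y k (mop d P l v) = (\<lambda>_. 0)"
    and v: "v \<in> vecs d" "k < d"
  shows "Y k v = (\<lambda>_. 0)"
proof -
  define L where "L = {v \<in> vecs d. \<forall>k<d. Y k v = (\<lambda>_. 0)}"
  have Y0: "Y k (\<lambda>_. 0) = (\<lambda>_. 0)" if "k < d" for k using scale[OF that, of 0] by simp
  have "stable_d d P L"
    by (auto simp: stable_d_def subspace_d_def L_def add scale Y0 ideal) (auto simp: vecs_def)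
  from complement_obtain[OF comp this] obtain L' where L': "stable_d d P L'" "L \<inter> L' = {\<lambda>_. 0}"
    "\<And>v. v \<in> vecs d \<Longrightarrow> \<exists>x\<in>L. \<exists>y\<in>L'. v = (\<lambda>i. x i + y i)" by blast
  have sub: "subspace_d d L'" using L'(1) by (simp add: stable_d_def)
  obtain x y where xy: "x \<in> L" "y \<in> L'" "v = (\<lambda>i. x i + y i)" using L'(3)[OF v(1)] by blast
  have yv: "y \<in> vecs d" using subspace_dD(1)[OF sub xy(2)] .
  \<comment> \<open>\<open>Y k y\<close> stays in the complement by \<open>pres\<close> and lies in
    the common kernel \<open>L\<close> by \<open>sq\<close>, so it is zero.\<close>
  have m: "Y k y \<in> L'" by (rule pres) (use v L' xy in auto)
  then have "Y k y \<in> L"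
    using sq[OF _ v(2) yv] subspace_dD(1)[OF sub] by (auto simp: L_def)
  then have "Y k y = (\<lambda>_. 0)" using m L'(2) by blast
  then show ?thesis using xy v by (simp add: add L_def)
qed

section \<open>Integrals of a semisimple and cosemisimple Hopf algebra\<close>

lemma hopf_algD:
  assumes "hopf_alg d C u D e"
  shows hopf_assoc: "\<And>i j l q. i < d \<Longrightarrow> j < d \<Longrightarrow> l < d \<Longrightarrow> q < d \<Longrightarrow>
      (\<Sum>p<d. C i j p * C p l q) = (\<Sum>p<d. C j l p * C i p q)"
    and hopf_unit_left: "\<And>j q. j < d \<Longrightarrow> q < d \<Longrightarrow> (\<Sum>i<d. u i * C i j q) = (if j = q then 1 else 0)"
    and hopf_unit_right: "\<And>j q. j < d \<Longrightarrow> q < d \<Longrightarrow> (\<Sum>i<d. u i * C j i q) = (if j = q then 1 else 0)"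
    and hopf_coassoc: "\<And>i a b l. i < d \<Longrightarrow> a < d \<Longrightarrow> b < d \<Longrightarrow> l < d \<Longrightarrow>
      (\<Sum>j<d. D i j l * D j a b) = (\<Sum>p<d. D i a p * D p b l)"
    and hopf_counit_left: "\<And>i l. i < d \<Longrightarrow> l < d \<Longrightarrow> (\<Sum>j<d. e j * D i j l) = (if i = l then 1 else 0)"
    and hopf_counit_right: "\<And>i j. i < d \<Longrightarrow> j < d \<Longrightarrow> (\<Sum>l<d. e l * D i j l) = (if i = j then 1 else 0)"
    and hopf_comult_unit: "\<And>a b. a < d \<Longrightarrow> b < d \<Longrightarrow> (\<Sum>i<d. u i * D i a b) = u a * u b"
    and hopf_counit_mult: "\<And>i j. i < d \<Longrightarrow> j < d \<Longrightarrow> (\<Sum>p<d. C i j p * e p) = e i * e j"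
    and hopf_counit_unit: "(\<Sum>i<d. u i * e i) = 1"
    and hopf_antipode: "\<exists>S. \<forall>i<d. \<forall>q<d.
        (\<Sum>j<d. \<Sum>l<d. \<Sum>p<d. D i j l * S j p * C p l q) = e i * u q \<and>
        (\<Sum>j<d. \<Sum>l<d. \<Sum>p<d. D i j l * S l p * C j p q) = e i * u q"
  using assms unfolding hopf_alg_def by auto

lemma mop_mop_alg:
  assumes "\<And>i j l q. i < d \<Longrightarrow> j < d \<Longrightarrow> l < d \<Longrightarrow> q < d \<Longrightarrow>
      (\<Sum>p<d. C i j p * C p l q) = (\<Sum>p<d. C j l p * C i p q)"
    and kl: "k < d" "l < d"
  shows "mop d C k (mop d C l v) = (\<lambda>j. \<Sum>p<d. C k l p * mop d C p v j)"
proof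
  fix q
  show "mop d C k (mop d C l v) q = (\<Sum>p<d. C k l p * mop d C p v q)"
  proof (cases "q < d")
    case True
    have "mop d C k (mop d C l v) q = (\<Sum>i<d. \<Sum>r<d. v r * (C l r i * C k i q))"
      using True by (simp add: mop_def sum_distrib_right mult.assoc)
    also have "\<dots> = (\<Sum>r<d. v r * (\<Sum>i<d. C l r i * C k i q))"
      by (subst sum.swap) (simp add: sum_distrib_left)
    also have "\<dots> = (\<Sum>r<d. v r * (\<Sum>p<d. C k l p * C p r q))"
      using assms True by simp
    also have "\<dots> = (\<Sum>r<d. \<Sum>p<d. C k l p * (v r * C p r q))"
      by (simp add: sum_distrib_left mult_ac)
    also have "\<dots> = (\<Sum>p<d. C k l p * mop d C p v q)"
      using True by (subst sum.swap) (simp add: mop_def sum_distrib_left)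
    finally show ?thesis .
  qed (simp add: mop_def)
qed

text \<open>By coassociativity these operators multiply like the dual basis,
  \<open>h_k^* h_l^* = \<Sum>p. D p k l h_p^*\<close>.\<close>

lemma mop_mop_coalg:
  assumes "\<And>i a b l. i < d \<Longrightarrow> a < d \<Longrightarrow> b < d \<Longrightarrow> l < d \<Longrightarrow>
      (\<Sum>j<d. D i j l * D j a b) = (\<Sum>p<d. D i a p * D p b l)"
    and kl: "k < d" "l < d"
  shows "mop d (\<lambda>l i j. D i j l) k (mop d (\<lambda>l i j. D i j l) l v)
    = (\<lambda>j. \<Sum>p<d. D p k l * mop d (\<lambda>l i j. D i j l) p v j)"
proof
  fix q
  show "mop d (\<lambda>l i j. D i j l) k (mop d (\<lambda>l i j. D i j l) l v) q
    = (\<Sum>p<d. D p k l * mop d (\<lambda>l i j. D i j l) p v q)"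
  proof (cases "q < d")
    case True
    have "mop d (\<lambda>l i j. D i j l) k (mop d (\<lambda>l i j. D i j l) l v) q
        = (\<Sum>i<d. \<Sum>r<d. v r * (D r i l * D i q k))"
      using True by (simp add: mop_def sum_distrib_right mult.assoc)
    also have "\<dots> = (\<Sum>r<d. v r * (\<Sum>i<d. D r i l * D i q k))"
      by (subst sum.swap) (simp add: sum_distrib_left)
    also have "\<dots> = (\<Sum>r<d. v r * (\<Sum>p<d. D r q p * D p k l))"
      using assms True by simp
    also have "\<dots> = (\<Sum>r<d. \<Sum>p<d. D p k l * (v r * D r q p))"
      by (simp add: sum_distrib_left mult_ac)
    also have "\<dots> = (\<Sum>p<d. D p k l * mop d (\<lambda>l i j. D i j l) p v q)"
      using True by (subst sum.swap) (simp add: mop_def sum_distrib_left)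
    finally show ?thesis .
  qed (simp add: mop_def)
qed

lemma mop_comb_stable:
  assumes "stable_d d P L" "v \<in> L"
  shows "(\<lambda>j. \<Sum>l<d. z l * mop d P l v j) \<in> L"
proof -
  have s: "subspace_d d L" using assms by (simp add: stable_d_def)
  show ?thesis
    by (intro subspace_d_sum[OF s] subspace_dD(4)[OF s]) (use assms in \<open>auto simp: stable_d_def\<close>)
qed

text \<open>The complement of the unit line gives an integral \<open>t\<close> of the dual algebra
  on one side. For the other side, the defects \<open>h_k^* t - u k t\<close> multiply to zero and
  hence act as zero.\<close>

lemma cosemisimple_integral:
  fixes D :: "nat \<Rightarrow> nat \<Rightarrow> nat \<Rightarrow> 'k::field"
  assumes H: "hopf_alg d C u D e" and "cosemisimple_coalg d D"
  obtains t where "(\<Sum>i<d. u i * t i) = 1"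
    "\<And>l i. l < d \<Longrightarrow> i < d \<Longrightarrow> (\<Sum>j<d. D i j l * t j) = u l * t i"
    "\<And>l i. l < d \<Longrightarrow> i < d \<Longrightarrow> (\<Sum>j<d. D i l j * t j) = u l * t i"
proof -
  note HD = hopf_algD[OF H]
  define P where "P = (\<lambda>l i j. D i j l)"
  have comp: "complemented_d d (stable_d d P)"
    using assms(2) by (simp add: cosemisimple_coalg_def right_coideal_eq_stable P_def)
  have "\<exists>i<d. u i \<noteq> 0"
  proof (rule ccontr)
    assume "\<not> (\<exists>i<d. u i \<noteq> 0)"
    then have "(\<Sum>i<d. u i * e i) = 0" by (intro sum.neutral) auto
    then show False using HD(9) by simp
  qed
  then obtain i0 where i0: "i0 < d" "u i0 \<noteq> 0" by blast
  have "(\<Sum>i<d. u i * P l i j) = u l * u j" if "l < d" "j < d" for l j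
    using HD(7)[OF that(2,1)] by (simp add: P_def mult.commute)
  \<comment> \<open>The unit of \<open>H\<close> is grouplike, so the operator \<open>l\<close>
    multiplies it by \<open>u l\<close>.\<close>
  from invariant_functional[where \<chi> = u, OF comp this i0]
  obtain t where t: "(\<Sum>i<d. u i * t i) = 1"
    "\<And>l i. l < d \<Longrightarrow> i < d \<Longrightarrow> (\<Sum>j<d. P l i j * t j) = u l * t i" by blast
  \<comment> \<open>\<open>Z\<close> is the action of \<open>t\<close>, and \<open>Y k\<close> that
    of \<open>h_k^* t - u k t\<close>; the known side of invariance is
    \<open>t h_k^* = u k t\<close>, shown below as \<open>Z_mop\<close>.\<close>
  define Z where "Z v = (\<lambda>j. \<Sum>l<d. t l * mop d P l v j)" for v
  define Y where "Y k v = (\<lambda>j. mop d P k (Z v) j + (- u k) * Z v j)" for k v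
  have mm: "mop d P k (mop d P l v) = (\<lambda>j. \<Sum>p<d. D p k l * mop d P p v j)"
    if "k < d" "l < d" for k l v
    unfolding P_def by (rule mop_mop_coalg[OF HD(4) that])
  have Z_add: "Z (\<lambda>i. v i + w i) = (\<lambda>i. Z v i + Z w i)" for v w
    by (simp add: Z_def mop_add distrib_left sum.distrib)
  have Z_scale: "Z (\<lambda>i. c * v i) = (\<lambda>i. c * Z v i)" for c v
    by (simp add: Z_def mop_scale sum_distrib_left mult.left_commute)
  have Z_mop: "Z (mop d P k v) = (\<lambda>j. u k * Z v j)" if k: "k < d" for k v
  proof
    fix j
    have "Z (mop d P k v) j = (\<Sum>l<d. \<Sum>p<d. t l * (D p l k * mop d P p v j))"
      unfolding Z_def by (intro sum.cong refl) (use k in \<open>auto simp: mm sum_distrib_left\<close>)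
    also have "\<dots> = (\<Sum>p<d. (\<Sum>l<d. P k p l * t l) * mop d P p v j)"
      by (subst sum.swap) (simp add: sum_distrib_right mult_ac P_def)
    also have "\<dots> = (\<Sum>p<d. u k * t p * mop d P p v j)"
      by (intro sum.cong refl) (use t(2) k in auto)
    also have "\<dots> = u k * Z v j" by (simp add: Z_def sum_distrib_left mult.assoc)
    finally show "Z (mop d P k v) j = u k * Z v j" .
  qed
  have ZY: "Z (Y k v) = (\<lambda>_. 0)" if "k < d" for k v
    using that by (simp only: Y_def Z_add Z_scale Z_mop) simp
  have Y0: "Y k v = (\<lambda>_. 0)" if "v \<in> vecs d" "k < d" for k v
  proof (rule square_zero_operators_vanish[OF comp _ _ _ _ _ that])
    fix k l :: nat and v w :: "nat \<Rightarrow> 'k" and c :: 'k and L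
    assume k: "k < d"
    show "Y k (\<lambda>i. v i + w i) = (\<lambda>i. Y k v i + Y k w i)"
      by (auto simp: Y_def Z_add mop_add algebra_simps)
    show "Y k (\<lambda>i. c * v i) = (\<lambda>i. c * Y k v i)"
      by (auto simp: Y_def Z_scale mop_scale algebra_simps)
    show "Y k v \<in> L" if L: "stable_d d P L" "v \<in> L"
    proof -
      have s: "subspace_d d L" using L by (simp add: stable_d_def)
      have "Z v \<in> L" unfolding Z_def by (rule mop_comb_stable[OF L])
      then show ?thesis
        unfolding Y_def by (intro subspace_dD[OF s]) (use k L in \<open>auto simp: stable_d_def\<close>)
    qed
    assume l: "l < d"
    show "Y k (Y l v) = (\<lambda>_. 0)" unfolding Y_def[of k] ZY[OF l] by simp
    assume "\<And>p. p < d \<Longrightarrow> Y p v = (\<lambda>_. 0)"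
    then have "Y k v = (\<lambda>_. 0)" using k .
    moreover have "Y k (mop d P l v) = (\<lambda>j. u l * Y k v j)"
      unfolding Y_def by (auto simp: Z_mop[OF l] mop_scale algebra_simps)
    ultimately show "Y k (mop d P l v) = (\<lambda>_. 0)" by simp
  qed
  \<comment> \<open>The counit recovers \<open>v l\<close>, so the vanishing of the operators
    \<open>Y k\<close> can be read as an identity between the coordinates of
    \<open>t\<close>.\<close>
  have ev: "(\<Sum>j<d. e j * mop d P l v j) = v l" if l: "l < d" for l v
  proof -
    have "(\<Sum>j<d. e j * mop d P l v j) = (\<Sum>j<d. \<Sum>i<d. v i * (e j * D i j l))"
      by (simp add: mop_def P_def sum_distrib_left mult_ac)
    also have "\<dots> = (\<Sum>i<d. v i * (\<Sum>j<d. e j * D i j l))"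
      by (subst sum.swap) (simp add: sum_distrib_left)
    also have "\<dots> = (\<Sum>i<d. if i = l then v i else 0)"
      by (intro sum.cong refl) (use HD(5) l in auto)
    finally show ?thesis using l by simp
  qed
  show thesis
  proof (rule that)
    show "(\<Sum>i<d. u i * t i) = 1" by fact
    show "(\<Sum>j<d. D i j l * t j) = u l * t i" if "l < d" "i < d" for l i
      using t(2)[OF that] by (simp add: P_def)
    fix k i assume k: "k < d" and i: "i < d"
    define v where "v = (\<lambda>r. if r = i then 1 else 0 :: 'k)"
    have vv: "v \<in> vecs d" using i by (auto simp: v_def vecs_def)
    have mv: "mop d P l v j = D i j l" if "j < d" for l j
    proof -
      have "(\<Sum>r<d. v r * P l r j) = (\<Sum>r<d. if r = i then P l r j else 0)"
        by (rule sum.cong) (auto simp: v_def)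
      then show ?thesis using i that by (simp add: mop_def P_def)
    qed
    have "0 = (\<Sum>j<d. e j * Y k v j)" using Y0[OF vv k] by simp
    also have "\<dots> = (\<Sum>j<d. e j * mop d P k (Z v) j) - u k * (\<Sum>j<d. e j * Z v j)"
      by (simp add: Y_def algebra_simps sum.distrib sum_subtractf sum_distrib_left)
    also have "(\<Sum>j<d. e j * Z v j) = (\<Sum>l<d. t l * (\<Sum>j<d. e j * mop d P l v j))"
      unfolding Z_def sum_distrib_left by (subst sum.swap) (simp add: mult.left_commute)
    also have "\<dots> = (\<Sum>l<d. if l = i then t l else 0)"
      by (intro sum.cong refl) (auto simp: ev v_def)
    also have "\<dots> = t i" using i by simp
    also have "(\<Sum>j<d. e j * mop d P k (Z v) j) = Z v k" using ev[OF k] .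
    also have "\<dots> = (\<Sum>j<d. D i k j * t j)" using k by (simp add: Z_def mv mult.commute)
    finally show "(\<Sum>j<d. D i k j * t j) = u k * t i" by simp
  qed
qed

text \<open>A stable complement of the kernel of the counit contains \<open>z\<close> with
  \<open>h z = e(h) z\<close>; the defects \<open>z h_k - e k z\<close> multiply to zero, act as
  zero on the semisimple module \<open>H\<close>, and so vanish.\<close>

lemma semisimple_integral:
  fixes C :: "nat \<Rightarrow> nat \<Rightarrow> nat \<Rightarrow> 'k::field"
  assumes H: "hopf_alg d C u D e" and "semisimple_alg d C"
  obtains z where "(\<Sum>i<d. z i * e i) = 1"
    "\<And>l j. l < d \<Longrightarrow> j < d \<Longrightarrow> (\<Sum>i<d. z i * C i l j) = e l * z j"
proof -
  note HD = hopf_algD[OF H]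
  have comp: "complemented_d d (stable_d d C)"
    using assms(2) by (simp add: semisimple_alg_def left_ideal_eq_stable)
  obtain z where z: "(\<Sum>i<d. z i * e i) = 1"
    "\<And>l j. l < d \<Longrightarrow> j < d \<Longrightarrow> (\<Sum>i<d. z i * C l i j) = e l * z j"
    using invariant_vector[where \<chi> = e, OF comp HD(8,9)] by blast
  define Z where "Z v = (\<lambda>j. \<Sum>l<d. z l * mop d C l v j)" for v
  \<comment> \<open>Left multiplication by \<open>z h_k - e k z\<close>. The product of two such
    elements is zero since \<open>h_k z = e k z\<close>.\<close>
  define Y where "Y k v = (\<lambda>j. Z (mop d C k v) j + (- e k) * Z v j)" for k v
  have mm: "mop d C k (mop d C l v) = (\<lambda>j. \<Sum>p<d. C k l p * mop d C p v j)"
    if "k < d" "l < d" for k l v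
    by (rule mop_mop_alg[OF HD(1) that])
  have Z_add: "Z (\<lambda>i. v i + w i) = (\<lambda>i. Z v i + Z w i)" for v w
    by (simp add: Z_def mop_add distrib_left sum.distrib)
  have Z_scale: "Z (\<lambda>i. c * v i) = (\<lambda>i. c * Z v i)" for c v
    by (simp add: Z_def mop_scale sum_distrib_left mult.left_commute)
  have Z_sum: "Z (\<lambda>i. \<Sum>k\<in>K. f k i) = (\<lambda>i. \<Sum>k\<in>K. Z (f k) i)" for f and K :: "nat set"
    using Z_scale[of 0] by (induct K rule: infinite_finite_induct) (auto simp: Z_add)
  have mop_Z: "mop d C k (Z v) = (\<lambda>j. e k * Z v j)" if k: "k < d" for k v
  proof
    fix j
    have "mop d C k (Z v) j = (\<Sum>l<d. \<Sum>p<d. z l * (C k l p * mop d C p v j))"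
      unfolding Z_def mop_sum mop_scale
      by (intro sum.cong refl) (use k in \<open>auto simp: mm sum_distrib_left\<close>)
    also have "\<dots> = (\<Sum>p<d. (\<Sum>l<d. z l * C k l p) * mop d C p v j)"
      by (subst sum.swap) (simp only: sum_distrib_right mult.assoc)
    also have "\<dots> = (\<Sum>p<d. e k * z p * mop d C p v j)"
      by (intro sum.cong refl) (use z(2) k in auto)
    also have "\<dots> = e k * Z v j" by (simp add: Z_def sum_distrib_left mult.assoc)
    finally show "mop d C k (Z v) j = e k * Z v j" .
  qed
  have Y_eq: "Y k v = Z (\<lambda>j. mop d C k v j + (- e k) * v j)" for k v
    by (simp only: Y_def Z_add Z_scale)
  have Y0: "Y k v = (\<lambda>_. 0)" if "v \<in> vecs d" "k < d" for k v
  proof (rule square_zero_operators_vanish[OF comp _ _ _ _ _ that])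
    fix k l :: nat and v w :: "nat \<Rightarrow> 'k" and c :: 'k and L
    assume k: "k < d"
    show "Y k (\<lambda>i. v i + w i) = (\<lambda>i. Y k v i + Y k w i)"
      by (auto simp: Y_def Z_add mop_add algebra_simps)
    show "Y k (\<lambda>i. c * v i) = (\<lambda>i. c * Y k v i)"
      by (auto simp: Y_def Z_scale mop_scale algebra_simps)
    show "Y k v \<in> L" if L: "stable_d d C L" "v \<in> L"
    proof -
      have s: "subspace_d d L" using L by (simp add: stable_d_def)
      have "(\<lambda>j. mop d C k v j + (- e k) * v j) \<in> L"
        by (intro subspace_dD[OF s]) (use k L in \<open>auto simp: stable_d_def\<close>)
      then show ?thesis unfolding Y_eq unfolding Z_def by (rule mop_comb_stable[OF L(1)])
    qed
    assume l: "l < d"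
    show "Y k (Y l v) = (\<lambda>_. 0)"
      unfolding Y_eq[of l] Y_def[of k] mop_Z[OF k] Z_scale by simp
    assume "\<And>p. p < d \<Longrightarrow> Y p v = (\<lambda>_. 0)"
    then have Zp: "Z (mop d C p v) = (\<lambda>j. e p * Z v j)" if "p < d" for p
      using that by (simp add: Y_def fun_eq_iff)
    show "Y k (mop d C l v) = (\<lambda>_. 0)"
    proof
      fix j
      have "Z (mop d C k (mop d C l v)) j = (\<Sum>p<d. C k l p * e p) * Z v j"
        by (simp add: mm k l Z_sum Z_scale Zp sum_distrib_right mult.assoc)
      then show "Y k (mop d C l v) j = 0"
        by (simp add: Y_def HD(8) k l Zp)
    qed
  qed
  show thesis
  proof (rule that)
    show "(\<Sum>i<d. z i * e i) = 1" by fact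
    fix k j assume k: "k < d" and j: "j < d"
    \<comment> \<open>Evaluation at the unit turns the vanishing of the operator \<open>Y k\<close>
      into \<open>z h_k = e k z\<close>.\<close>
    define v where "v = (\<lambda>i. if i < d then u i else 0)"
    have vv: "v \<in> vecs d" by (auto simp: v_def vecs_def)
    have mu: "mop d C l v j = (if l = j then 1 else 0)" if "l < d" "j < d" for l j
      using HD(3)[OF that] that by (simp add: mop_def v_def)
    have mlk: "mop d C l (mop d C k v) j = C l k j" if "l < d" for l
    proof -
      have "mop d C l (mop d C k v) j = (\<Sum>p<d. if p = j then C l k p else 0)"
        unfolding mm[OF that k] by (intro sum.cong refl) (use mu j in auto)
      then show ?thesis using j by simp
    qed
    have "(\<Sum>l<d. z l * mop d C l v j) = (\<Sum>l<d. if l = j then z l else 0)"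
      by (intro sum.cong refl) (use mu j in auto)
    then have "Z v j = z j" using j by (simp add: Z_def)
    moreover have "Z (mop d C k v) j = (\<Sum>i<d. z i * C i k j)"
      by (simp add: Z_def mlk)
    moreover have "Y k v j = 0" using Y0[OF vv k] by simp
    ultimately show "(\<Sum>i<d. z i * C i k j) = e k * z j" by (simp add: Y_def)
  qed
qed

section \<open>Formal sums and the tensor product over the subalgebra\<close>

lemma sum_lessThan_delta [simp]:
  fixes f :: "nat \<Rightarrow> 'a::semiring_1"
  assumes "j < d"
  shows "(\<Sum>i<d. f i * (if i = j then 1 else 0)) = f j" "(\<Sum>i<d. f i * (if j = i then 1 else 0)) = f j"
    "(\<Sum>i<d. (if i = j then 1 else 0) * f i) = f j" "(\<Sum>i<d. (if j = i then 1 else 0) * f i) = f j"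
proof -
  have "(\<Sum>i<d. f i * (if i = j then 1 else 0)) = (\<Sum>i<d. if i = j then f i else 0)"
    by (rule sum.cong) auto
  then show 1: "(\<Sum>i<d. f i * (if i = j then 1 else 0)) = f j" using assms by simp
  have "(\<Sum>i<d. (if i = j then 1 else 0) * f i) = (\<Sum>i<d. if i = j then f i else 0)"
    by (rule sum.cong) auto
  then show 2: "(\<Sum>i<d. (if i = j then 1 else 0) * f i) = f j" using assms by simp
  show "(\<Sum>i<d. f i * (if j = i then 1 else 0)) = f j" using 1 by (simp only: eq_commute[of j])
  show "(\<Sum>i<d. (if j = i then 1 else 0) * f i) = f j" using 2 by (simp only: eq_commute[of j])
qed

locale k_alg =
  fixes \<iota> :: "'k::field \<Rightarrow> 'm::ring_1"
  assumes kalg: "kalg \<iota>"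
begin

lemma io_1 [simp]: "\<iota> 1 = 1"
  and io_add: "\<iota> (a + b) = \<iota> a + \<iota> b"
  and io_mult: "\<iota> (a * b) = \<iota> a * \<iota> b"
  and io_comm: "m * \<iota> c = \<iota> c * m"
  using kalg unfolding kalg_def by metis+

lemma io_0 [simp]: "\<iota> 0 = 0"
  using io_add[of 0 0] by simp

lemma io_minus: "\<iota> (- a) = - \<iota> a"
  using io_add[of "- a" a] by (simp add: eq_neg_iff_add_eq_0)

lemma io_sum: "\<iota> (\<Sum>k\<in>K. f k) = (\<Sum>k\<in>K. \<iota> (f k))"
  by (induct K rule: infinite_finite_induct) (auto simp: io_add)

lemma io_left_comm: "x * (\<iota> c * y) = \<iota> c * (x * y)"
  by (simp only: mult.assoc[symmetric] io_comm[of x])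

lemma io_inverse: "c \<noteq> 0 \<Longrightarrow> \<iota> (inverse c) * \<iota> c = 1"
  by (simp add: io_mult[symmetric])

lemma io_eq_0_iff [simp]: "\<iota> c = 0 \<longleftrightarrow> c = 0"
proof
  assume "\<iota> c = 0"
  then show "c = 0" using io_inverse[of c] by (cases "c = 0") simp_all
qed simp

definition sm :: "'k \<Rightarrow> 'm \<Rightarrow> 'm" (infixr "\<cdot>" 75) where
  "c \<cdot> x = \<iota> c * x"

lemma sm_sm [simp]: "a \<cdot> b \<cdot> x = (a * b) \<cdot> x"
  by (simp add: sm_def io_mult mult.assoc)

lemma sm_mult [simp]: "(c \<cdot> x) * y = c \<cdot> (x * y)"
  by (simp add: sm_def mult.assoc)

lemma mult_sm [simp]: "x * (c \<cdot> y) = c \<cdot> (x * y)"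
  by (simp add: sm_def io_left_comm)

lemma mult_io [simp]: "x * \<iota> c = c \<cdot> x"
  by (simp only: sm_def io_comm[of x])

lemma sm_1 [simp]: "1 \<cdot> x = x"
  and sm_0 [simp]: "0 \<cdot> x = 0"
  and sm_zero [simp]: "c \<cdot> 0 = 0"
  by (auto simp: sm_def)

lemma sm_add_right: "c \<cdot> (x + y) = c \<cdot> x + c \<cdot> y"
  and sm_add_left: "(a + b) \<cdot> x = a \<cdot> x + b \<cdot> x"
  by (simp_all add: sm_def io_add algebra_simps)

lemma sm_sum_right: "c \<cdot> (\<Sum>k\<in>K. g k) = (\<Sum>k\<in>K. c \<cdot> g k)"
  by (simp add: sm_def sum_distrib_left)

lemma sm_sum_left: "(\<Sum>k\<in>K. f k) \<cdot> x = (\<Sum>k\<in>K. f k \<cdot> x)"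
  by (simp add: sm_def io_sum sum_distrib_right)

lemma sm_minus_left: "(- a) \<cdot> x = - (a \<cdot> x)"
  by (simp add: sm_def io_minus)

lemma io_sm: "\<iota> c = c \<cdot> 1"
  by (simp add: sm_def)

definition lin :: "('m \<times> 'm \<Rightarrow> 'm) \<Rightarrow> ('m \<times> 'm \<Rightarrow> 'k) \<Rightarrow> 'm" where
  "lin F f = (\<Sum>p\<in>{p. f p \<noteq> 0}. f p \<cdot> F p)"

lemma lin_superset:
  assumes "finite A" "{p. f p \<noteq> 0} \<subseteq> A"
  shows "lin F f = (\<Sum>p\<in>A. f p \<cdot> F p)"
  unfolding lin_def by (rule sum.mono_neutral_left) (use assms in auto)

lemma finite_support_step:
  fixes f g :: "'p \<Rightarrow> 'k"
  assumes "finite {p. f p \<noteq> 0}" "finite {p. g p \<noteq> 0}"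
  shows "finite {p. f p + c * g p \<noteq> 0}"
  by (rule finite_subset[OF _ finite_UnI[OF assms]]) auto

lemma lin_step:
  assumes "finite {p. f p \<noteq> 0}" "finite {p. g p \<noteq> 0}"
  shows "lin F (\<lambda>p. f p + c * g p) = lin F f + c \<cdot> lin F g"
proof -
  let ?A = "{p. f p \<noteq> 0} \<union> {p. g p \<noteq> 0}"
  have A: "finite ?A" using assms by simp
  have "{p. f p + c * g p \<noteq> 0} \<subseteq> ?A" by auto
  then show ?thesis
    by (simp add: lin_superset[OF A] sm_add_left sum.distrib sm_sum_right)
qed

lemma finite_support_dlt [simp]: "finite {p. (dlt a b p :: 'k) \<noteq> 0}"
  by (rule finite_subset[of _ "{(a, b)}"]) (auto simp: dlt_def)

lemma lin_dlt [simp]: "lin F (dlt a b) = F (a, b)"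
proof -
  have "{p. (dlt a b p :: 'k) \<noteq> 0} = {(a, b)}" by (auto simp: dlt_def)
  then show ?thesis by (simp add: lin_def dlt_def)
qed

lemma lin_comb:
  assumes "finite S" "\<And>s. s \<in> S \<Longrightarrow> finite {p. g s p \<noteq> 0}"
  shows "finite {p. (\<Sum>s\<in>S. c s * g s p) \<noteq> 0}"
    and "lin F (\<lambda>p. \<Sum>s\<in>S. c s * g s p) = (\<Sum>s\<in>S. c s \<cdot> lin F (g s))"
proof -
  have "finite {p. (\<Sum>s\<in>S. c s * g s p) \<noteq> 0} \<and>
    lin F (\<lambda>p. \<Sum>s\<in>S. c s * g s p) = (\<Sum>s\<in>S. c s \<cdot> lin F (g s))"
    using assms
  proof (induct S)
    case empty
    then show ?case by (simp add: lin_def)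
  next
    case (insert s S)
    then have "finite {p. (\<Sum>s\<in>S. c s * g s p) + c s * g s p \<noteq> 0}
      \<and> lin F (\<lambda>p. (\<Sum>s\<in>S. c s * g s p) + c s * g s p) = (\<Sum>s\<in>S. c s \<cdot> lin F (g s)) + c s \<cdot> lin F (g s)"
      by (subst lin_step) (auto intro: finite_support_step)
    then show ?case using insert by (simp add: add.commute)
  qed
  then show "finite {p. (\<Sum>s\<in>S. c s * g s p) \<noteq> 0}"
    and "lin F (\<lambda>p. \<Sum>s\<in>S. c s * g s p) = (\<Sum>s\<in>S. c s \<cdot> lin F (g s))" by auto
qed

text \<open>The universal property of \<open>M \<otimes>_N M\<close> in the form needed for formal
  sums: a balanced bilinear \<open>F\<close> descends to the quotient.\<close>

lemma lin_tens_rel: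
  assumes F: "\<And>a a' b. F (a + a', b) = F (a, b) + F (a', b)"
    "\<And>a b b'. F (a, b + b') = F (a, b) + F (a, b')"
    "\<And>a n b. n \<in> N \<Longrightarrow> F (a * n, b) = F (a, n * b)"
    "\<And>c a b. F (c \<cdot> a, b) = c \<cdot> F (a, b)"
    and f: "f \<in> tens_rel \<iota> N"
  shows "lin F f = 0"
proof -
  have g: "finite {p. g p \<noteq> 0} \<and> lin F g = 0" if "g \<in> tens_gens \<iota> N" for g
  proof -
    have two: "finite {p. dlt a b p - c * dlt a' b' p \<noteq> 0} \<and>
        lin F (\<lambda>p. dlt a b p - c * dlt a' b' p) = F (a, b) - c \<cdot> F (a', b')" for a b a' b' c
      using finite_support_step[OF finite_support_dlt finite_support_dlt, of a b "- c" a' b']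
        lin_step[OF finite_support_dlt finite_support_dlt, of F a b "- c" a' b']
      by (simp add: sm_minus_left)
    have three: "finite {p. dlt a b p - dlt a' b' p - dlt a'' b'' p \<noteq> (0::'k)} \<and>
        lin F (\<lambda>p. dlt a b p - dlt a' b' p - dlt a'' b'' p) = F (a, b) - F (a', b') - F (a'', b'')"
      for a b a' b' a'' b''
      using finite_support_step[OF conjunct1[OF two] finite_support_dlt, of a b 1 a' b' "-1" a'' b'']
        lin_step[OF conjunct1[OF two] finite_support_dlt, of F a b 1 a' b' "-1" a'' b'']
        conjunct2[OF two, of a b 1 a' b']
      by (simp add: sm_minus_left)
    show ?thesis
      using that unfolding tens_gens_def Un_iff mem_Collect_eq
    proof (elim disjE exE conjE)
      fix a a' b assume "g = (\<lambda>p. dlt (a + a') b p - dlt a b p - dlt a' b p)"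
      then show ?thesis using three[of "a + a'" b a b a' b] F(1)[of a a' b] by simp
    next
      fix a b b' assume "g = (\<lambda>p. dlt a (b + b') p - dlt a b p - dlt a b' p)"
      then show ?thesis using three[of a "b + b'" a b a b'] F(2)[of a b b'] by simp
    next
      fix a n b assume n: "n \<in> N" and "g = (\<lambda>p. dlt (a * n) b p - dlt a (n * b) p)"
      then show ?thesis using two[of "a * n" b 1 a "n * b"] F(3)[OF n, of a b] by simp
    next
      fix a b c assume "g = (\<lambda>p. dlt (\<iota> c * a) b p - c * dlt a b p)"
      then show ?thesis using two[of "c \<cdot> a" b c a b] F(4)[of c a b] by (simp add: sm_def[symmetric])
    qed
  qed
  from f have "finite {p. f p \<noteq> 0} \<and> lin F f = 0"
  proof induct
    case zero
    then show ?case by (simp add: lin_def)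
  next
    case (step f g c)
    then show ?case using g[of g] by (simp add: lin_step finite_support_step)
  qed
  then show ?thesis by simp
qed

lemma galois_map_eq_lin: "galois_map \<iota> R f q = lin (\<lambda>p. fst p * R q (snd p)) f"
  by (simp add: galois_map_def lin_def sm_def mult.assoc)

end

section \<open>From Galois extensions to strongly separable extensions\<close>

locale comodule_algebra = k_alg \<iota> for \<iota> :: "'k::field \<Rightarrow> 'm::ring_1" +
  fixes d :: nat and C :: "nat \<Rightarrow> nat \<Rightarrow> nat \<Rightarrow> 'k" and u and D :: "nat \<Rightarrow> nat \<Rightarrow> nat \<Rightarrow> 'k" and e
    and R :: "nat \<Rightarrow> 'm \<Rightarrow> 'm"
  assumes comodule: "comodule_alg d C u D e \<iota> R"
begin

lemma comodule_sm:
  "(\<forall>i<d. (\<forall>a b. R i (a + b) = R i a + R i b) \<and> (\<forall>c a. R i (c \<cdot> a) = c \<cdot> R i a)) \<and>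
    (\<forall>j<d. \<forall>i<d. \<forall>a. R j (R i a) = (\<Sum>p<d. D p j i \<cdot> R p a)) \<and>
    (\<forall>a. (\<Sum>i<d. e i \<cdot> R i a) = a) \<and>
    (\<forall>q<d. \<forall>a b. R q (a * b) = (\<Sum>i<d. \<Sum>j<d. C i j q \<cdot> (R i a * R j b))) \<and>
    (\<forall>q<d. R q 1 = \<iota> (u q))"
  using comodule unfolding comodule_alg_def mult_io sm_def[symmetric] .

lemma coinv_sm: "coinv d u \<iota> R = {b. \<forall>q<d. R q b = u q \<cdot> b}"
  by (simp add: coinv_def sm_def)

lemma R_add: "i < d \<Longrightarrow> R i (a + b) = R i a + R i b"
  and R_scale: "i < d \<Longrightarrow> R i (c \<cdot> a) = c \<cdot> R i a"
  and R_R: "j < d \<Longrightarrow> i < d \<Longrightarrow> R j (R i a) = (\<Sum>p<d. D p j i \<cdot> R p a)"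
  and R_counit: "(\<Sum>i<d. e i \<cdot> R i a) = a"
  and R_mult: "q < d \<Longrightarrow> R q (a * b) = (\<Sum>i<d. \<Sum>j<d. C i j q \<cdot> (R i a * R j b))"
  and R_one: "q < d \<Longrightarrow> R q 1 = \<iota> (u q)"
proof -
  show "R i (a + b) = R i a + R i b" if "i < d"
    using that by (rule comodule_sm[THEN conjunct1, rule_format, THEN conjunct1, rule_format])
  show "R i (c \<cdot> a) = c \<cdot> R i a" if "i < d"
    using that by (rule comodule_sm[THEN conjunct1, rule_format, THEN conjunct2, rule_format])
  show "R j (R i a) = (\<Sum>p<d. D p j i \<cdot> R p a)" if "j < d" "i < d"
    using that by (rule comodule_sm[THEN conjunct2, THEN conjunct1, rule_format])
  show "(\<Sum>i<d. e i \<cdot> R i a) = a"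
    by (rule comodule_sm[THEN conjunct2, THEN conjunct2, THEN conjunct1, rule_format])
  show "R q (a * b) = (\<Sum>i<d. \<Sum>j<d. C i j q \<cdot> (R i a * R j b))" if "q < d"
    using that by (rule comodule_sm[THEN conjunct2, THEN conjunct2, THEN conjunct2, THEN conjunct1, rule_format])
  show "R q 1 = \<iota> (u q)" if "q < d"
    using that by (rule comodule_sm[THEN conjunct2, THEN conjunct2, THEN conjunct2, THEN conjunct2, rule_format])
qed

lemma R_zero: "i < d \<Longrightarrow> R i 0 = 0"
  using R_add[of i 0 0] by simp

lemma R_sum: "i < d \<Longrightarrow> R i (\<Sum>k\<in>K. f k) = (\<Sum>k\<in>K. R i (f k))"
  by (induct K rule: infinite_finite_induct) (auto simp: R_add R_zero)

end

locale hopf_galois = comodule_algebra \<iota> d C u D e R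
  for \<iota> :: "'k::field \<Rightarrow> 'm::ring_1" and d C u D e R +
  assumes hopf: "hopf_alg d C u D e"
    and semisimple: "semisimple_alg d C" and cosemisimple: "cosemisimple_coalg d D"
    and galois: "galois d \<iota> (coinv d u \<iota> R) R"
    and irreducible: "irreducible_ext \<iota> (coinv d u \<iota> R)"
begin

text \<open>For a coinvariant, \<open>\<rho>(n) = n \<otimes> 1\<close>; in the product formula for
  \<open>R q\<close> one factor of \<open>H\<close> is then the unit.\<close>

lemma R_coinv:
  assumes n: "n \<in> coinv d u \<iota> R" and q: "q < d"
  shows R_coinv_left: "R q (n * b) = n * R q b" and R_coinv_right: "R q (b * n) = R q b * n"
proof -
  have Rn: "R i n = u i \<cdot> n" if "i < d" for i using n that unfolding coinv_sm by blast
  have "R q (n * b) = (\<Sum>i<d. \<Sum>j<d. C i j q \<cdot> (R i n * R j b))" by (rule R_mult[OF q])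
  also have "\<dots> = (\<Sum>i<d. \<Sum>j<d. (u i * C i j q) \<cdot> (n * R j b))"
    by (intro sum.cong refl) (simp add: Rn mult.commute)
  also have "\<dots> = (\<Sum>j<d. (\<Sum>i<d. u i * C i j q) \<cdot> (n * R j b))"
    by (subst sum.swap) (simp add: sm_sum_left)
  also have "\<dots> = (\<Sum>j<d. if j = q then n * R j b else 0)"
    by (intro sum.cong refl) (use hopf_unit_left[OF hopf] q in auto)
  finally show "R q (n * b) = n * R q b" using q by simp
  have "R q (b * n) = (\<Sum>j<d. \<Sum>i<d. C j i q \<cdot> (R j b * R i n))" by (rule R_mult[OF q])
  also have "\<dots> = (\<Sum>j<d. \<Sum>i<d. (u i * C j i q) \<cdot> (R j b * n))"
    by (intro sum.cong refl) (simp add: Rn mult.commute)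
  also have "\<dots> = (\<Sum>j<d. (\<Sum>i<d. u i * C j i q) \<cdot> (R j b * n))"
    by (simp add: sm_sum_left)
  also have "\<dots> = (\<Sum>j<d. if j = q then R j b * n else 0)"
    by (intro sum.cong refl) (use hopf_unit_right[OF hopf] q in auto)
  finally show "R q (b * n) = R q b * n" using q by simp
qed

lemma galois_surj:
  obtains S :: "('m \<times> 'm) set" and X where "finite S" "\<And>q. q < d \<Longrightarrow> (\<Sum>s\<in>S. X s * R q (snd s)) = v q"
proof -
  obtain f where f: "finite {p. f p \<noteq> 0}" "\<forall>q<d. galois_map \<iota> R f q = v q"
    using galois unfolding galois_def by blast
  show thesis
    by (rule that[of "{p. f p \<noteq> 0}" "\<lambda>p. f p \<cdot> fst p"]) (use f in \<open>auto simp: galois_map_eq_lin lin_def\<close>)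
qed

text \<open>Surjectivity of the Galois map supplies a preimage of \<open>1 \<otimes> h_q\<close>,
  and applying it to the relation isolates \<open>c q\<close>.\<close>

lemma independent:
  assumes "\<And>x. (\<Sum>q<d. R q x * c q) = 0" and "q < d"
  shows "c q = 0"
proof -
  obtain S :: "('m \<times> 'm) set" and X where S: "finite S"
    "\<And>r. r < d \<Longrightarrow> (\<Sum>s\<in>S. X s * R r (snd s)) = (if r = q then 1 else 0)"
    using that by (rule galois_surj)
  have "0 = (\<Sum>s\<in>S. X s * (\<Sum>r<d. R r (snd s) * c r))" by (simp add: assms)
  also have "\<dots> = (\<Sum>r<d. (\<Sum>s\<in>S. X s * R r (snd s)) * c r)"
    by (simp only: sum_distrib_left sum_distrib_right mult.assoc, subst sum.swap) simp
  also have "\<dots> = (\<Sum>r<d. (if r = q then 1 else 0) * c r)" by (intro sum.cong refl) (simp add: S)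
  finally show ?thesis using assms(2) by simp
qed

end

text \<open>The coordinates \<open>t\<close> are those of an integral \<open>E\<close> of the dual of \<open>H\<close>, normalised by \<open>E 1 = 1\<close>,
  the coordinates \<open>z\<close> are those of an integral of \<open>H\<close> of counit 1, and \<open>f\<close> represents the preimage
  of \<open>1 \<otimes> z\<close> under the Galois map.\<close>

locale hopf_galois_integrals = hopf_galois \<iota> d C u D e R
  for \<iota> :: "'k::field \<Rightarrow> 'm::ring_1" and d C u D e R +
  fixes t z :: "nat \<Rightarrow> 'k" and S :: "nat \<Rightarrow> nat \<Rightarrow> 'k" and f :: "'m \<times> 'm \<Rightarrow> 'k"
  assumes t1: "(\<Sum>i<d. u i * t i) = 1"
    and tr: "\<And>l i. l < d \<Longrightarrow> i < d \<Longrightarrow> (\<Sum>j<d. D i j l * t j) = u l * t i"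
    and tl: "\<And>l i. l < d \<Longrightarrow> i < d \<Longrightarrow> (\<Sum>j<d. D i l j * t j) = u l * t i"
    and z1: "(\<Sum>i<d. z i * e i) = 1"
    and zr: "\<And>l j. l < d \<Longrightarrow> j < d \<Longrightarrow> (\<Sum>i<d. z i * C i l j) = e l * z j"
    and anti: "\<And>i q. i < d \<Longrightarrow> q < d \<Longrightarrow>
      (\<Sum>j<d. \<Sum>l<d. \<Sum>p<d. D i j l * S l p * C j p q) = e i * u q"
    and f: "finite {p. f p \<noteq> 0}" "\<And>q. q < d \<Longrightarrow> galois_map \<iota> R f q = \<iota> (z q)"
begin

abbreviation "N \<equiv> coinv d u \<iota> R"

definition E :: "'m \<Rightarrow> 'm" where
  "E a = (\<Sum>i<d. t i \<cdot> R i a)"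

lemma E_add: "E (a + b) = E a + E b"
  by (simp add: E_def R_add sm_add_right sum.distrib)

lemma E_scale: "E (c \<cdot> a) = c \<cdot> E a"
  by (simp add: E_def R_scale sm_sum_right mult.commute)

lemma E_zero: "E 0 = 0"
  using E_add[of 0 0] by simp

lemma E_sum: "E (\<Sum>k\<in>K. h k) = (\<Sum>k\<in>K. E (h k))"
  by (induct K rule: infinite_finite_induct) (auto simp: E_add E_zero)

text \<open>Invariance \<open>tr\<close> is used here; the opposite invariance \<open>tl\<close>
  gives \<open>E_N\<close>, by computing \<open>R l (E a)\<close> instead of
  \<open>E (R l a)\<close>.\<close>

lemma E_R:
  assumes l: "l < d"
  shows "E (R l a) = u l \<cdot> E a"
proof -
  have "E (R l a) = (\<Sum>j<d. \<Sum>p<d. (D p j l * t j) \<cdot> R p a)"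
    unfolding E_def by (intro sum.cong refl)
      (simp add: R_R l sum_distrib_left sm_sum_right mult.commute)
  also have "\<dots> = (\<Sum>p<d. (\<Sum>j<d. D p j l * t j) \<cdot> R p a)"
    by (subst sum.swap) (simp add: sm_sum_left)
  also have "\<dots> = u l \<cdot> E a"
    by (simp add: tr l E_def sum_distrib_left sm_sum_right mult.assoc)
  finally show ?thesis .
qed

lemma E_N: "E a \<in> N"
  unfolding coinv_sm
proof (intro CollectI allI impI)
  fix l assume l: "l < d"
  have "R l (E a) = (\<Sum>j<d. \<Sum>p<d. (D p l j * t j) \<cdot> R p a)"
    unfolding E_def R_sum[OF l] by (intro sum.cong refl)
      (simp add: R_scale R_R l sum_distrib_left sm_sum_right mult.commute)
  also have "\<dots> = (\<Sum>p<d. (\<Sum>j<d. D p l j * t j) \<cdot> R p a)"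
    by (subst sum.swap) (simp add: sm_sum_left)
  also have "\<dots> = u l \<cdot> E a"
    by (simp add: tl l E_def sum_distrib_left sm_sum_right mult.assoc)
  finally show "R l (E a) = u l \<cdot> E a" .
qed

lemma E_1: "E 1 = 1"
  using t1 by (simp add: E_def R_one io_sm sm_sum_left[symmetric] mult.commute)

lemma E_bimod:
  assumes "n \<in> N"
  shows "E (n * m) = n * E m" "E (m * n) = E m * n"
  using assms by (simp_all add: E_def R_coinv_left R_coinv_right sum_distrib_left sum_distrib_right mult.assoc)

text \<open>\<open>gm p j = t(h_p h_j)\<close>: the coproduct of the integral, in the coordinates of
  the dual basis.\<close>

definition gm :: "nat \<Rightarrow> nat \<Rightarrow> 'k" where
  "gm p j = (\<Sum>q<d. t q * C p j q)"

lemma E_mult: "E (a * b) = (\<Sum>p<d. \<Sum>j<d. gm p j \<cdot> (R p a * R j b))"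
proof -
  have "E (a * b) = (\<Sum>q<d. \<Sum>p<d. \<Sum>j<d. (t q * C p j q) \<cdot> (R p a * R j b))"
    by (simp add: E_def R_mult sum_distrib_left sm_sum_right mult.assoc)
  also have "\<dots> = (\<Sum>p<d. \<Sum>j<d. \<Sum>q<d. (t q * C p j q) \<cdot> (R p a * R j b))"
    by (subst sum.swap, rule sum.cong[OF refl], rule sum.swap)
  finally show ?thesis by (simp add: gm_def sm_sum_left)
qed

section \<open>The preimage of \<open>1 \<otimes> z\<close> under the Galois map\<close>

definition supp :: "('m \<times> 'm) set" where
  "supp = {p. f p \<noteq> 0}"

text \<open>The scalar of each formal term is absorbed into its left leg, so that the tensor reads
  \<open>\<Sum>s\<in>supp. cas_left s \<otimes> snd s\<close>.\<close>

definition cas_left :: "'m \<times> 'm \<Rightarrow> 'm" where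
  "cas_left p = f p \<cdot> fst p"

lemma finA: "finite supp"
  using f by (simp add: supp_def)

lemma xR:
  assumes "q < d"
  shows "(\<Sum>s\<in>supp. cas_left s * R q (snd s)) = z q \<cdot> 1"
  using f(2)[OF assms] by (simp add: galois_map_eq_lin lin_def supp_def cas_left_def io_sm)

lemma xy: "(\<Sum>s\<in>supp. cas_left s * snd s) = 1"
proof -
  have "(\<Sum>s\<in>supp. cas_left s * snd s) = (\<Sum>s\<in>supp. cas_left s * (\<Sum>q<d. e q \<cdot> R q (snd s)))"
    by (simp add: R_counit)
  also have "\<dots> = (\<Sum>q<d. e q \<cdot> (\<Sum>s\<in>supp. cas_left s * R q (snd s)))"
    by (simp only: sum_distrib_left sm_sum_right mult_sm) (rule sum.swap)
  also have "\<dots> = (\<Sum>q<d. z q * e q) \<cdot> 1"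
    by (simp add: xR sm_sum_left mult.commute)
  finally show ?thesis by (simp add: z1)
qed

text \<open>In terms of the Galois map, \<open>\<Sum> x \<otimes> y m\<close> goes to
  \<open>m \<otimes> z\<close>, since \<open>z h = e(h) z\<close> collapses the coaction on
  \<open>m\<close> to its counit.\<close>

lemma xRm:
  assumes q: "q < d"
  shows "(\<Sum>s\<in>supp. cas_left s * R q (snd s * m)) = z q \<cdot> m"
proof -
  have "(\<Sum>s\<in>supp. cas_left s * R q (snd s * m))
      = (\<Sum>s\<in>supp. \<Sum>i<d. \<Sum>j<d. C i j q \<cdot> (cas_left s * R i (snd s) * R j m))"
    by (simp add: R_mult q sum_distrib_left sm_sum_right mult.assoc)
  also have "\<dots> = (\<Sum>i<d. \<Sum>j<d. \<Sum>s\<in>supp. C i j q \<cdot> (cas_left s * R i (snd s) * R j m))"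
    by (subst sum.swap, rule sum.cong[OF refl], rule sum.swap)
  also have "\<dots> = (\<Sum>i<d. \<Sum>j<d. C i j q \<cdot> (z i \<cdot> R j m))"
    by (simp add: sum_distrib_left[symmetric] sm_sum_right[symmetric] sum_distrib_right[symmetric] xR)
  also have "\<dots> = (\<Sum>j<d. \<Sum>i<d. (z i * C i j q) \<cdot> R j m)"
    by (subst sum.swap) (simp add: mult.commute)
  also have "\<dots> = (\<Sum>j<d. (\<Sum>i<d. z i * C i j q) \<cdot> R j m)"
    by (simp add: sm_sum_left)
  also have "\<dots> = z q \<cdot> (\<Sum>j<d. e j \<cdot> R j m)"
    by (simp add: zr q sm_sum_right mult.commute)
  finally show ?thesis by (simp add: R_counit)
qed

definition \<tau> :: 'k where
  "\<tau> = (\<Sum>q<d. t q * z q)"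

lemma xE: "(\<Sum>s\<in>supp. cas_left s * E (snd s * m)) = \<tau> \<cdot> m"
proof -
  have "(\<Sum>s\<in>supp. cas_left s * E (snd s * m)) = (\<Sum>q<d. t q \<cdot> (\<Sum>s\<in>supp. cas_left s * R q (snd s * m)))"
    by (simp only: E_def sum_distrib_left sm_sum_right mult_sm) (rule sum.swap)
  also have "\<dots> = \<tau> \<cdot> m"
    by (simp add: xRm \<tau>_def sm_sum_left)
  finally show ?thesis .
qed

section \<open>Adjoints under the integral, and nonvanishing of \<open>\<tau>\<close>\<close>

text \<open>The transposed antipode applied to \<open>h_j^*\<close>, acting on \<open>M\<close>;
  hence the sum over the first index of \<open>S\<close>.\<close>

definition SR :: "nat \<Rightarrow> 'm \<Rightarrow> 'm" where
  "SR j m = (\<Sum>r<d. S r j \<cdot> R r m)"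

lemma anti_R:
  assumes i: "i < d"
  shows "(\<Sum>b<d. \<Sum>j<d. C b j i \<cdot> R b (SR j m)) = u i \<cdot> m"
proof -
  have "(\<Sum>b<d. \<Sum>j<d. C b j i \<cdot> R b (SR j m))
      = (\<Sum>b<d. \<Sum>j<d. \<Sum>r<d. \<Sum>p<d. (D p b r * S r j * C b j i) \<cdot> R p m)"
  proof (intro sum.cong refl)
    fix b j assume "b \<in> {..<d}" "j \<in> {..<d}"
    then have "R b (SR j m) = (\<Sum>r<d. S r j \<cdot> (\<Sum>p<d. D p b r \<cdot> R p m))"
      by (simp add: SR_def R_sum R_scale R_R)
    then show "C b j i \<cdot> R b (SR j m) = (\<Sum>r<d. \<Sum>p<d. (D p b r * S r j * C b j i) \<cdot> R p m)"
      by (simp add: sum_distrib_left sm_sum_right mult_ac)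
  qed
  also have "\<dots> = (\<Sum>b<d. \<Sum>r<d. \<Sum>j<d. \<Sum>p<d. (D p b r * S r j * C b j i) \<cdot> R p m)"
    by (rule sum.cong[OF refl], rule sum.swap)
  also have "\<dots> = (\<Sum>b<d. \<Sum>r<d. \<Sum>p<d. \<Sum>j<d. (D p b r * S r j * C b j i) \<cdot> R p m)"
    by (rule sum.cong[OF refl], rule sum.cong[OF refl], rule sum.swap)
  also have "\<dots> = (\<Sum>b<d. \<Sum>p<d. \<Sum>r<d. \<Sum>j<d. (D p b r * S r j * C b j i) \<cdot> R p m)"
    by (rule sum.cong[OF refl], rule sum.swap)
  also have "\<dots> = (\<Sum>p<d. \<Sum>b<d. \<Sum>r<d. \<Sum>j<d. (D p b r * S r j * C b j i) \<cdot> R p m)"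
    by (rule sum.swap)
  also have "\<dots> = (\<Sum>p<d. (e p * u i) \<cdot> R p m)"
    by (intro sum.cong refl) (simp add: anti[symmetric] i sm_sum_left)
  also have "\<dots> = u i \<cdot> (\<Sum>p<d. e p \<cdot> R p m)"
    by (simp add: sm_sum_right mult.commute)
  finally show ?thesis by (simp add: R_counit)
qed

text \<open>In Sweedler notation \<open>a(v) m = a_1(v S(a_2)(m))\<close>: the right side expands to
  \<open>a_1(v) a_2(S(a_3)(m))\<close>, and \<open>anti_R\<close> collapses
  \<open>a_2 S(a_3)\<close>.\<close>

lemma R_times:
  assumes q: "q < d"
  shows "R q v * m = (\<Sum>i<d. \<Sum>j<d. C i j q \<cdot> R i (v * SR j m))"
proof -
  have "(\<Sum>i<d. \<Sum>j<d. C i j q \<cdot> R i (v * SR j m))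
      = (\<Sum>i<d. \<Sum>j<d. \<Sum>a<d. \<Sum>b<d. (C a b i * C i j q) \<cdot> (R a v * R b (SR j m)))"
    by (intro sum.cong refl)
      (simp add: R_mult sum_distrib_left sm_sum_right mult.commute)
  also have "\<dots> = (\<Sum>i<d. \<Sum>a<d. \<Sum>j<d. \<Sum>b<d. (C a b i * C i j q) \<cdot> (R a v * R b (SR j m)))"
    by (rule sum.cong[OF refl], rule sum.swap)
  also have "\<dots> = (\<Sum>a<d. \<Sum>i<d. \<Sum>j<d. \<Sum>b<d. (C a b i * C i j q) \<cdot> (R a v * R b (SR j m)))"
    by (rule sum.swap)
  also have "\<dots> = (\<Sum>a<d. \<Sum>j<d. \<Sum>i<d. \<Sum>b<d. (C a b i * C i j q) \<cdot> (R a v * R b (SR j m)))"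
    by (rule sum.cong[OF refl], rule sum.swap)
  also have "\<dots> = (\<Sum>a<d. \<Sum>j<d. \<Sum>b<d. \<Sum>i<d. (C a b i * C i j q) \<cdot> (R a v * R b (SR j m)))"
    by (rule sum.cong[OF refl], rule sum.cong[OF refl], rule sum.swap)
  also have "\<dots> = (\<Sum>a<d. \<Sum>j<d. \<Sum>b<d. (\<Sum>i<d. C b j i * C a i q) \<cdot> (R a v * R b (SR j m)))"
    by (intro sum.cong refl)
      (simp add: sm_sum_left[symmetric] hopf_assoc[OF hopf] q)
  also have "\<dots> = (\<Sum>a<d. \<Sum>j<d. \<Sum>b<d. \<Sum>i<d. C a i q \<cdot> (R a v * (C b j i \<cdot> R b (SR j m))))"
    by (simp add: sm_sum_left mult.commute)
  also have "\<dots> = (\<Sum>a<d. \<Sum>j<d. \<Sum>i<d. \<Sum>b<d. C a i q \<cdot> (R a v * (C b j i \<cdot> R b (SR j m))))"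
    by (rule sum.cong[OF refl], rule sum.cong[OF refl], rule sum.swap)
  also have "\<dots> = (\<Sum>a<d. \<Sum>i<d. \<Sum>j<d. \<Sum>b<d. C a i q \<cdot> (R a v * (C b j i \<cdot> R b (SR j m))))"
    by (rule sum.cong[OF refl], rule sum.swap)
  also have "\<dots> = (\<Sum>a<d. \<Sum>i<d. \<Sum>b<d. \<Sum>j<d. C a i q \<cdot> (R a v * (C b j i \<cdot> R b (SR j m))))"
    by (rule sum.cong[OF refl], rule sum.cong[OF refl], rule sum.swap)
  also have "\<dots> = (\<Sum>a<d. \<Sum>i<d. C a i q \<cdot> (R a v * (u i \<cdot> m)))"
    by (intro sum.cong refl) (simp only: sum_distrib_left[symmetric] sm_sum_right[symmetric], simp add: anti_R)
  also have "\<dots> = (\<Sum>a<d. \<Sum>i<d. C a i q \<cdot> (R a v * R i 1)) * m"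
    by (simp add: R_one sum_distrib_right mult.assoc io_sm)
  also have "\<dots> = R q v * m" using R_mult[OF q, of v 1] by simp
  finally show ?thesis by simp
qed

text \<open>Apply \<open>E\<close> to \<open>R_times\<close>: by \<open>E_R\<close> the outer
  \<open>a_1\<close> is replaced by its counit, leaving \<open>E (v * S(a)(m))\<close>.\<close>

lemma E_adj:
  assumes q: "q < d"
  shows "E (R q v * m) = E (v * SR q m)"
proof -
  have "E (R q v * m) = (\<Sum>i<d. \<Sum>j<d. (u i * C i j q) \<cdot> E (v * SR j m))"
    by (simp add: R_times q E_sum E_scale E_R mult.commute)
  also have "\<dots> = (\<Sum>j<d. (\<Sum>i<d. u i * C i j q) \<cdot> E (v * SR j m))"
    by (subst sum.swap) (simp add: sm_sum_left)
  also have "\<dots> = (\<Sum>j<d. if j = q then E (v * SR j m) else 0)"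
    by (intro sum.cong refl) (use hopf_unit_left[OF hopf] q in auto)
  finally show ?thesis using q by simp
qed

lemma tau_nonzero: "\<tau> \<noteq> 0"
proof
  assume \<tau>0: "\<tau> = 0"
  \<comment> \<open>\<open>L p b\<close> is the value of \<open>h_p^* h_b^*\<close> on
    \<open>z\<close>.\<close>
  define L where "L p b = (\<Sum>r<d. D r p b * z r)" for p b
  have xL: "(\<Sum>s\<in>supp. cas_left s * R p (R b (snd s))) = L p b \<cdot> 1" if "p < d" "b < d" for p b
  proof -
    have "(\<Sum>s\<in>supp. cas_left s * R p (R b (snd s))) = (\<Sum>r<d. D r p b \<cdot> (\<Sum>s\<in>supp. cas_left s * R r (snd s)))"
      using that by (simp only: R_R sum_distrib_left sm_sum_right mult_sm lessThan_iff cong: sum.cong) (rule sum.swap)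
    then show ?thesis by (simp add: xR L_def sm_sum_left)
  qed
  have gL: "(\<Sum>p<d. gm p j * L p b) = 0" if b: "b < d" and j: "j < d" for b j
  proof -
    have "(\<Sum>j<d. R j m * \<iota> (\<Sum>p<d. gm p j * L p b)) = 0" for m
    proof -
      \<comment> \<open>Moving \<open>R b\<close> across \<open>E\<close> leaves
        \<open>\<tau>\<close> times \<open>SR b m\<close>, which is zero; expanding the same sum by
        \<open>E_mult\<close> gives a relation between the \<open>R j m\<close>, and
        \<open>independent\<close> makes its coefficients vanish.\<close>
      have "0 = (\<Sum>s\<in>supp. cas_left s * E (R b (snd s) * m))"
        using xE[of "SR b m"] b by (simp add: E_adj \<tau>0)
      also have "\<dots> = (\<Sum>s\<in>supp. \<Sum>p<d. \<Sum>j<d. gm p j \<cdot> (cas_left s * R p (R b (snd s)) * R j m))"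
        by (simp add: E_mult sum_distrib_left sm_sum_right mult.assoc)
      also have "\<dots> = (\<Sum>p<d. \<Sum>j<d. \<Sum>s\<in>supp. gm p j \<cdot> (cas_left s * R p (R b (snd s)) * R j m))"
        by (subst sum.swap, rule sum.cong[OF refl], rule sum.swap)
      also have "\<dots> = (\<Sum>p<d. \<Sum>j<d. gm p j \<cdot> (L p b \<cdot> R j m))"
        by (simp add: sum_distrib_left[symmetric] sm_sum_right[symmetric] sum_distrib_right[symmetric] xL b)
      also have "\<dots> = (\<Sum>j<d. \<Sum>p<d. (gm p j * L p b) \<cdot> R j m)"
        by (subst sum.swap) (simp add: mult.assoc)
      finally show ?thesis by (simp add: sm_sum_left)
    qed
    then have "\<iota> (\<Sum>p<d. gm p j * L p b) = 0"
      using independent[where c = "\<lambda>j. \<iota> (\<Sum>p<d. gm p j * L p b)"] j by blast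
    then show ?thesis by simp
  qed
  \<comment> \<open>Contracting these vanishing coefficients with \<open>S b j\<close> computes
    \<open>t(z_1 S(z_2))\<close>, which the antipode law evaluates to
    \<open>e(z) t(1) = 1\<close>.\<close>
  have "(\<Sum>r<d. \<Sum>q<d. t q * z r * (\<Sum>p<d. \<Sum>b<d. \<Sum>j<d. D r p b * S b j * C p j q)) = 0"
  proof -
    have "0 = (\<Sum>b<d. \<Sum>j<d. S b j * (\<Sum>p<d. gm p j * L p b))" by (simp add: gL)
    also have "\<dots> = (\<Sum>b<d. \<Sum>j<d. \<Sum>p<d. \<Sum>r<d. \<Sum>q<d. t q * z r * (D r p b * S b j * C p j q))"
      by (simp add: gm_def L_def sum_product sum_distrib_left sm_sum_right mult_ac)
    also have "\<dots> = (\<Sum>b<d. \<Sum>j<d. \<Sum>p<d. \<Sum>q<d. \<Sum>r<d. t q * z r * (D r p b * S b j * C p j q))"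
      by (rule sum.cong[OF refl], rule sum.cong[OF refl], rule sum.cong[OF refl], rule sum.swap)
    also have "\<dots> = (\<Sum>b<d. \<Sum>p<d. \<Sum>j<d. \<Sum>q<d. \<Sum>r<d. t q * z r * (D r p b * S b j * C p j q))"
      by (rule sum.cong[OF refl], rule sum.swap)
    also have "\<dots> = (\<Sum>p<d. \<Sum>b<d. \<Sum>j<d. \<Sum>q<d. \<Sum>r<d. t q * z r * (D r p b * S b j * C p j q))"
      by (rule sum.swap)
    also have "\<dots> = (\<Sum>p<d. \<Sum>b<d. \<Sum>q<d. \<Sum>j<d. \<Sum>r<d. t q * z r * (D r p b * S b j * C p j q))"
      by (rule sum.cong[OF refl], rule sum.cong[OF refl], rule sum.swap)
    also have "\<dots> = (\<Sum>p<d. \<Sum>q<d. \<Sum>b<d. \<Sum>j<d. \<Sum>r<d. t q * z r * (D r p b * S b j * C p j q))"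
      by (rule sum.cong[OF refl], rule sum.swap)
    also have "\<dots> = (\<Sum>q<d. \<Sum>p<d. \<Sum>b<d. \<Sum>j<d. \<Sum>r<d. t q * z r * (D r p b * S b j * C p j q))"
      by (rule sum.swap)
    also have "\<dots> = (\<Sum>q<d. \<Sum>p<d. \<Sum>b<d. \<Sum>r<d. \<Sum>j<d. t q * z r * (D r p b * S b j * C p j q))"
      by (rule sum.cong[OF refl], rule sum.cong[OF refl], rule sum.cong[OF refl], rule sum.swap)
    also have "\<dots> = (\<Sum>q<d. \<Sum>p<d. \<Sum>r<d. \<Sum>b<d. \<Sum>j<d. t q * z r * (D r p b * S b j * C p j q))"
      by (rule sum.cong[OF refl], rule sum.cong[OF refl], rule sum.swap)
    also have "\<dots> = (\<Sum>q<d. \<Sum>r<d. \<Sum>p<d. \<Sum>b<d. \<Sum>j<d. t q * z r * (D r p b * S b j * C p j q))"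
      by (rule sum.cong[OF refl], rule sum.swap)
    also have "\<dots> = (\<Sum>r<d. \<Sum>q<d. \<Sum>p<d. \<Sum>b<d. \<Sum>j<d. t q * z r * (D r p b * S b j * C p j q))"
      by (rule sum.swap)
    finally show ?thesis by (simp add: sum_distrib_left sm_sum_right)
  qed
  moreover have "(\<Sum>r<d. \<Sum>q<d. t q * z r * (\<Sum>p<d. \<Sum>b<d. \<Sum>j<d. D r p b * S b j * C p j q))
      = (\<Sum>r<d. \<Sum>q<d. (z r * e r) * (u q * t q))"
    by (intro sum.cong refl) (subst anti, simp, simp, simp add: mult_ac)
  moreover have "\<dots> = 1" by (simp add: sum_product[symmetric] z1 t1)
  ultimately show False by simp
qed

text \<open>The tensors \<open>\<Sum> m x \<otimes> y\<close> and
  \<open>\<Sum> x \<otimes> y m\<close> both have Galois image \<open>m \<otimes> z\<close>, so they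
  agree by injectivity; then \<open>E \<otimes> id\<close> is applied to them.\<close>

lemma central: "(\<Sum>s\<in>supp. E (m * cas_left s) * snd s) = (\<Sum>s\<in>supp. E (cas_left s) * snd s) * m"
proof -
  \<comment> \<open>The formal difference of the two tensors.\<close>
  define h where "h = (\<lambda>p. (\<Sum>s\<in>supp. f s * dlt (m * fst s) (snd s) p) + (-1) * (\<Sum>s\<in>supp. f s * dlt (fst s) (snd s * m) p))"
  have fin: "finite {p. (\<Sum>s\<in>supp. f s * dlt (m * fst s) (snd s) p) \<noteq> 0}"
    "finite {p. (\<Sum>s\<in>supp. f s * dlt (fst s) (snd s * m) p) \<noteq> 0}"
    by (rule lin_comb(1)[OF finA], simp)+
  have lin_h: "lin F h = (\<Sum>s\<in>supp. f s \<cdot> F (m * fst s, snd s)) - (\<Sum>s\<in>supp. f s \<cdot> F (fst s, snd s * m))" for F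
    unfolding h_def lin_step[OF fin] by (simp add: lin_comb(2)[OF finA] sm_minus_left)
  have "finite {p. h p \<noteq> 0}" unfolding h_def by (rule finite_support_step[OF fin])
  moreover have "galois_map \<iota> R h q = 0" if q: "q < d" for q
  proof -
    have "galois_map \<iota> R h q = m * (\<Sum>s\<in>supp. cas_left s * R q (snd s)) - (\<Sum>s\<in>supp. cas_left s * R q (snd s * m))"
      by (simp add: galois_map_eq_lin lin_h cas_left_def sum_distrib_left sm_sum_right mult.assoc)
    then show ?thesis using q by (simp add: xR xRm)
  qed
  ultimately have "h \<in> tens_rel \<iota> N" using galois by (auto simp: galois_def)
  then have "lin (\<lambda>p. E (fst p) * snd p) h = 0"
    by (rule lin_tens_rel[rotated -1]) (auto simp: E_add E_scale E_bimod algebra_simps)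
  then show ?thesis
    by (simp add: lin_h cas_left_def E_scale sum_distrib_right mult.assoc)
qed

lemma strongly_separable_coinv: "strongly_separable N"
proof -
  \<comment> \<open>By \<open>central\<close>, one dual basis sum is \<open>\<kappa> * m\<close>,
    the other being \<open>\<tau> \<cdot> m\<close> by \<open>xE\<close>. Irreducibility makes
    \<open>\<kappa>\<close> a scalar, and evaluating \<open>E \<kappa>\<close> in two ways
    identifies it with \<open>\<tau>\<close>.\<close>
  define \<kappa> where "\<kappa> = (\<Sum>s\<in>supp. E (cas_left s) * snd s)"
  have "\<kappa> \<in> centralizer N"
    unfolding centralizer_def
  proof (intro CollectI ballI)
    fix n assume n: "n \<in> N"
    have "\<kappa> * n = (\<Sum>s\<in>supp. E (n * cas_left s) * snd s)" by (simp add: central \<kappa>_def)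
    also have "\<dots> = n * \<kappa>" using n by (simp add: E_bimod \<kappa>_def sum_distrib_left sm_sum_right mult.assoc)
    finally show "\<kappa> * n = n * \<kappa>" .
  qed
  then obtain c where c: "\<kappa> = \<iota> c" using irreducible by (auto simp: irreducible_ext_def)
  have "E \<kappa> = \<iota> \<tau>"
  proof -
    have "E \<kappa> = (\<Sum>s\<in>supp. E (cas_left s) * E (snd s))"
      unfolding \<kappa>_def E_sum by (simp add: E_bimod E_N)
    also have "\<dots> = E (\<Sum>s\<in>supp. cas_left s * E (snd s * 1))"
      unfolding E_sum by (simp add: E_bimod E_N)
    also have "\<dots> = \<tau> \<cdot> E 1" unfolding xE using E_scale[of \<tau> 1] by simp
    finally show ?thesis by (simp add: E_1 io_sm)
  qed
  moreover have "E \<kappa> = \<kappa>" using E_scale[of c 1] by (simp add: c E_1 io_sm)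
  ultimately have \<kappa>\<tau>: "\<kappa> = \<iota> \<tau>" by simp

  define i\<tau> where "i\<tau> = inverse \<tau>"
  have inv: "i\<tau> * \<tau> = 1" using tau_nonzero by (simp add: i\<tau>_def)
  obtain h where h: "bij_betw h {0..<card supp} supp" using ex_bij_betw_nat_finite[OF finA] by blast
  have re: "(\<Sum>i<card supp. F (h i)) = (\<Sum>s\<in>supp. F s)" for F :: "'m \<times> 'm \<Rightarrow> 'm"
    using sum.reindex_bij_betw[OF h, of F] by (simp add: atLeast0LessThan)
  have "(\<Sum>i<card supp. E (m * (i\<tau> \<cdot> cas_left (h i))) * snd (h i)) = m" for m
  proof -
    have "(\<Sum>i<card supp. E (m * (i\<tau> \<cdot> cas_left (h i))) * snd (h i)) = i\<tau> \<cdot> (\<Sum>s\<in>supp. E (m * cas_left s) * snd s)"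
      unfolding re[of "\<lambda>s. E (m * (i\<tau> \<cdot> cas_left s)) * snd s"]
      by (simp add: E_scale sm_sum_right)
    also have "\<dots> = m" using inv by (simp add: central \<kappa>_def[symmetric] \<kappa>\<tau> io_sm)
    finally show ?thesis .
  qed
  moreover have "(\<Sum>i<card supp. (i\<tau> \<cdot> cas_left (h i)) * E (snd (h i) * m)) = m" for m
  proof -
    have "(\<Sum>i<card supp. (i\<tau> \<cdot> cas_left (h i)) * E (snd (h i) * m)) = i\<tau> \<cdot> (\<Sum>s\<in>supp. cas_left s * E (snd s * m))"
      unfolding re[of "\<lambda>s. (i\<tau> \<cdot> cas_left s) * E (snd s * m)"] by (simp add: sm_sum_right)
    also have "\<dots> = m" using inv by (simp add: xE)
    finally show ?thesis .
  qed
  moreover have "(\<Sum>i<card supp. (i\<tau> \<cdot> cas_left (h i)) * snd (h i)) \<noteq> 0"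
  proof -
    have "(\<Sum>i<card supp. (i\<tau> \<cdot> cas_left (h i)) * snd (h i)) = i\<tau> \<cdot> 1"
      unfolding re[of "\<lambda>s. (i\<tau> \<cdot> cas_left s) * snd s"] by (simp add: sm_sum_right[symmetric] xy)
    then show ?thesis using tau_nonzero by (simp add: i\<tau>_def sm_def)
  qed
  ultimately show ?thesis
    unfolding strongly_separable_def using E_N E_add E_bimod E_1
    by (intro exI[of _ E] conjI allI ballI exI[of _ "card supp"] exI[of _ "\<lambda>i. i\<tau> \<cdot> cas_left (h i)"]
        exI[of _ "\<lambda>i. snd (h i)"]) auto
qed

end

lemma (in hopf_galois) strongly_separable: "strongly_separable (coinv d u \<iota> R)"
proof -
  obtain t :: "nat \<Rightarrow> 'k" where t: "(\<Sum>i<d. u i * t i) = 1"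
    "\<And>l i. l < d \<Longrightarrow> i < d \<Longrightarrow> (\<Sum>j<d. D i j l * t j) = u l * t i"
    "\<And>l i. l < d \<Longrightarrow> i < d \<Longrightarrow> (\<Sum>j<d. D i l j * t j) = u l * t i"
    using that by (rule cosemisimple_integral[OF hopf cosemisimple])
  obtain z :: "nat \<Rightarrow> 'k" where z: "(\<Sum>i<d. z i * e i) = 1"
    "\<And>l j. l < d \<Longrightarrow> j < d \<Longrightarrow> (\<Sum>i<d. z i * C i l j) = e l * z j"
    using that by (rule semisimple_integral[OF hopf semisimple])
  from hopf_antipode[OF hopf] obtain S where S: "\<forall>i<d. \<forall>q<d.
      (\<Sum>j<d. \<Sum>l<d. \<Sum>p<d. D i j l * S j p * C p l q) = e i * u q \<and>
      (\<Sum>j<d. \<Sum>l<d. \<Sum>p<d. D i j l * S l p * C j p q) = e i * u q"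
    by (rule exE)
  from galois[unfolded galois_def, THEN conjunct2, THEN spec, of "\<lambda>q. \<iota> (z q)"]
  obtain f where f: "finite {p. f p \<noteq> 0} \<and> (\<forall>q<d. galois_map \<iota> R f q = \<iota> (z q))"
    by (rule exE)
  interpret hopf_galois_integrals \<iota> d C u D e R t z S f
    by unfold_locales (use t z S f in blast)+
  show ?thesis by (rule strongly_separable_coinv)
qed

section \<open>Frobenius extensions of depth two\<close>

locale frobenius_ext = k_alg \<iota> for \<iota> :: "'k::field \<Rightarrow> 'm::ring_1" +
  fixes N :: "'m set" and E :: "'m \<Rightarrow> 'm" and n0 :: nat and x y :: "nat \<Rightarrow> 'm"
  assumes subalg: "subalg \<iota> N" and irreducible: "irreducible_ext \<iota> N"
    and E_N: "E m \<in> N" and E_add: "E (a + b) = E a + E b"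
    and E_left: "n \<in> N \<Longrightarrow> E (n * m) = n * E m"
    and E_right: "n \<in> N \<Longrightarrow> E (m * n) = E m * n"
    and dual_left: "(\<Sum>i<n0. E (m * x i) * y i) = m"
    and dual_right: "(\<Sum>i<n0. x i * E (y i * m)) = m"
begin

definition bimod_map :: "('m \<Rightarrow> 'm) \<Rightarrow> bool" where
  "bimod_map f \<longleftrightarrow> (\<forall>a b. f (a + b) = f a + f b) \<and> (\<forall>n\<in>N. \<forall>m. f (n * m) = n * f m \<and> f (m * n) = f m * n)"

lemma bimod_mapD:
  assumes "bimod_map f"
  shows "f (a + b) = f a + f b" "n \<in> N \<Longrightarrow> f (n * m) = n * f m" "n \<in> N \<Longrightarrow> f (m * n) = f m * n"
  using assms unfolding bimod_map_def by blast+

lemma io_in_N: "\<iota> c \<in> N"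
  using subalg by (auto simp: subalg_def)

lemma bimod_map_scale: "bimod_map f \<Longrightarrow> f (c \<cdot> a) = c \<cdot> f a"
  unfolding sm_def by (rule bimod_mapD(2)[OF _ io_in_N])

lemma bimod_map_zero: "bimod_map f \<Longrightarrow> f 0 = 0"
  by (drule bimod_mapD(1)[of f 0 0]) simp

lemma bimod_map_sum: "bimod_map f \<Longrightarrow> f (\<Sum>k\<in>K. h k) = (\<Sum>k\<in>K. f (h k))"
  by (induct K rule: infinite_finite_induct) (simp_all add: bimod_mapD(1)[of f] bimod_map_zero[of f])

lemma bimod_map_comp: "bimod_map f \<Longrightarrow> bimod_map g \<Longrightarrow> bimod_map (\<lambda>a. f (g a))"
  unfolding bimod_map_def by simp

lemma bimod_E: "bimod_map E"
  by (simp add: bimod_map_def E_add E_left E_right)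

lemmas E_sum = bimod_map_sum[OF bimod_E]
  and E_scale = bimod_map_scale[OF bimod_E]
  and E_zero = bimod_map_zero[OF bimod_E]

lemma E_E_left: "E (E a * m) = E a * E m"
  and E_E_right': "E (m * (m' * E a)) = E (m * m') * E a"
  using E_left[OF E_N] E_right[OF E_N] by (simp_all add: mult.assoc[symmetric])

lemma E_nondeg_right:
  assumes "\<And>m. E (a * m) = E (b * m)"
  shows "a = b"
  by (subst dual_left[of a, symmetric], subst dual_left[of b, symmetric]) (simp only: assms)

lemma E_nondeg_left:
  assumes "\<And>m. E (m * a) = E (m * b)"
  shows "a = b"
  by (subst dual_right[of a, symmetric], subst dual_right[of b, symmetric]) (simp only: assms)

lemma scalar_of_commutes:
  assumes "\<And>n. n \<in> N \<Longrightarrow> a * n = n * a"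
  obtains c where "a = c \<cdot> 1"
proof -
  have "a \<in> centralizer N" using assms by (simp add: centralizer_def)
  then show thesis using irreducible that by (auto simp: irreducible_ext_def io_sm)
qed

text \<open>\<open>\<Sum>i. x i \<otimes> y i\<close> commutes with \<open>M\<close>: expand
  \<open>m * x i\<close> in the \<open>x j\<close> and move the coefficient
  \<open>E (y j * m * x i)\<close>, an element of \<open>N\<close>, to the other leg. The form with
  a balanced \<open>F\<close> avoids working in the tensor product.\<close>

lemma casimir:
  fixes F :: "'m \<Rightarrow> 'm \<Rightarrow> 'm"
  assumes F: "\<And>a a' b. F (a + a') b = F a b + F a' b" "\<And>a b b'. F a (b + b') = F a b + F a b'"
    "\<And>a n b. n \<in> N \<Longrightarrow> F (a * n) b = F a (n * b)"
  shows "(\<Sum>i<n0. F (m * x i) (y i)) = (\<Sum>i<n0. F (x i) (y i * m))"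
proof -
  have F0: "F 0 b = 0" "F a 0 = 0" for a b using F(1)[of 0 0 b] F(2)[of a 0 0] by simp_all
  have Fsum1: "F (\<Sum>k\<in>K. h k) b = (\<Sum>k\<in>K. F (h k) b)" for h b and K :: "nat set"
    by (induct K rule: infinite_finite_induct) (auto simp: F F0)
  have Fsum2: "F a (\<Sum>k\<in>K. h k) = (\<Sum>k\<in>K. F a (h k))" for h a and K :: "nat set"
    by (induct K rule: infinite_finite_induct) (auto simp: F F0)
  have "(\<Sum>i<n0. F (m * x i) (y i)) = (\<Sum>i<n0. F (\<Sum>j<n0. x j * E (y j * (m * x i))) (y i))"
    by (simp add: dual_right)
  also have "\<dots> = (\<Sum>i<n0. \<Sum>j<n0. F (x j) (E (y j * m * x i) * y i))"
    by (simp add: Fsum1 F(3) E_N mult.assoc)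
  also have "\<dots> = (\<Sum>j<n0. \<Sum>i<n0. F (x j) (E (y j * m * x i) * y i))" by (rule sum.swap)
  also have "\<dots> = (\<Sum>j<n0. F (x j) (y j * m))" by (simp add: Fsum2[symmetric] dual_left)
  finally show ?thesis .
qed

text \<open>\<open>End M_N\<close> is spanned by the maps \<open>m \<mapsto> a * E (b * m)\<close>.
  Each functional \<open>m \<mapsto> E (y j * f m)\<close> is right \<open>N\<close>-linear with
  values in \<open>N\<close>, hence of the form \<open>m \<mapsto> E (w j * m)\<close>, with
  \<open>w j\<close> built from its values on the \<open>x i\<close>.\<close>

lemma E1_expand:
  assumes f: "f \<in> E1 N"
  shows "\<exists>w. \<forall>m. f m = (\<Sum>j<n0. x j * E (w j * m))"
proof -
  have add: "f (a + b) = f a + f b" and right: "n \<in> N \<Longrightarrow> f (m * n) = f m * n" for a b m n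
    using f by (auto simp: E1_def)
  have f0: "f 0 = 0" using add[of 0 0] by simp
  have fsum: "f (\<Sum>k\<in>K. h k) = (\<Sum>k\<in>K. f (h k))" for h and K :: "nat set"
    by (induct K rule: infinite_finite_induct) (auto simp: add f0)
  define w where "w j = (\<Sum>i<n0. E (y j * f (x i)) * y i)" for j
  have "E (w j * m) = E (y j * f m)" for j m
  proof -
    have "E (w j * m) = (\<Sum>i<n0. E (y j * (f (x i) * E (y i * m))))"
      by (simp add: w_def sum_distrib_right E_sum mult.assoc E_E_left E_E_right')
    also have "\<dots> = E (y j * f (\<Sum>i<n0. x i * E (y i * m)))"
      by (simp add: fsum right E_N E_sum sum_distrib_left)
    finally show ?thesis by (simp add: dual_right)
  qed
  then show ?thesis by (intro exI[of _ w]) (simp add: dual_right)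
qed

text \<open>Each map \<open>m \<mapsto> x j * E m\<close> involves finitely many elements of the
  given basis. By \<open>E1_expand\<close> these \<open>n0\<close> maps generate
  \<open>End M_N\<close> as a right \<open>M\<close>-module, so the union \<open>F\<close> of their
  supports is already a basis.\<close>

lemma depth2_basis:
  assumes "depth2 N"
  shows "\<exists>(d::nat) b. (\<forall>i<d. bimod_map (b i)) \<and>
    (\<forall>f\<in>E1 N. \<exists>c. \<forall>m. f m = (\<Sum>i<d. b i (c i * m))) \<and>
    (\<forall>c. (\<forall>m. (\<Sum>i<d. b i (c i * m)) = 0) \<longrightarrow> (\<forall>i<d. c i = 0))"
proof -
  from assms[unfolded depth2_def, THEN conjunct1] obtain B where Bu: "B \<subseteq> E1 N \<and>
      (\<forall>b\<in>B. \<forall>n\<in>N. b \<circ> lm n = lm n \<circ> b) \<and>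
      (\<forall>f\<in>E1 N. \<exists>!c. (\<forall>b. b \<notin> B \<longrightarrow> c b = 0) \<and> finite {b. c b \<noteq> 0} \<and>
           f = (\<lambda>x. \<Sum>b\<in>{b. c b \<noteq> 0}. b (c b * x)))"
    by (rule exE)
  note B = Bu[THEN conjunct1] Bu[THEN conjunct2, THEN conjunct1]
    and uniq = Bu[THEN conjunct2, THEN conjunct2, THEN bspec]
  have bi: "bimod_map b" if "b \<in> B" for b
  proof -
    have "b \<in> E1 N" using B(1) that by blast
    moreover have "b (n * m) = n * b m" if "n \<in> N" for n m
      using fun_cong[OF B(2)[rule_format, OF \<open>b \<in> B\<close> that], of m] by (simp add: lm_def)
    ultimately show ?thesis by (simp add: bimod_map_def E1_def)
  qed
  have xE1: "(\<lambda>m. x j * E m) \<in> E1 N" for j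
    by (simp add: E1_def E_add E_right distrib_left mult.assoc)
  have "\<forall>j. \<exists>c. (\<forall>b. b \<notin> B \<longrightarrow> c b = 0) \<and> finite {b. c b \<noteq> 0} \<and>
           (\<lambda>m. x j * E m) = (\<lambda>m. \<Sum>b\<in>{b. c b \<noteq> 0}. b (c b * m))"
    by (rule allI, rule ex1_implies_ex, rule uniq, rule xE1)
  from choice[OF this] obtain c where c': "\<forall>j. (\<forall>b. b \<notin> B \<longrightarrow> c j b = 0) \<and> finite {b. c j b \<noteq> 0} \<and>
           (\<lambda>m. x j * E m) = (\<lambda>m. \<Sum>b\<in>{b. c j b \<noteq> 0}. b (c j b * m))"
    by (rule exE)
  have c: "b \<notin> B \<Longrightarrow> c j b = 0" "finite {b. c j b \<noteq> 0}"
    "(\<lambda>m. x j * E m) = (\<lambda>m. \<Sum>b\<in>{b. c j b \<noteq> 0}. b (c j b * m))" for j b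
    using c'[rule_format, of j] by blast+
  define F where "F = (\<Union>j<n0. {b. c j b \<noteq> 0})"
  have finF: "finite F" using c(2) by (simp add: F_def)
  have FB: "F \<subseteq> B" using c(1) by (auto simp: F_def)
  have b0: "b 0 = 0" if "b \<in> F" for b using bimod_map_zero[OF bi] that FB by blast
  have xE: "x j * E m = (\<Sum>b\<in>F. b (c j b * m))" if "j < n0" for j m
  proof -
    have "x j * E m = (\<Sum>b\<in>{b. c j b \<noteq> 0}. b (c j b * m))" using fun_cong[OF c(3), of j m] .
    also have "\<dots> = (\<Sum>b\<in>F. b (c j b * m))"
      by (rule sum.mono_neutral_left[OF finF]) (use that b0 in \<open>auto simp: F_def\<close>)
    finally show ?thesis .
  qed
  have gen: "\<exists>c'. \<forall>m. f m = (\<Sum>b\<in>F. b (c' b * m))" if "f \<in> E1 N" for f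
  proof -
    from E1_expand[OF that] obtain w where w: "\<forall>m. f m = (\<Sum>j<n0. x j * E (w j * m))" by (rule exE)
    have "f m = (\<Sum>b\<in>F. b ((\<Sum>j<n0. c j b * w j) * m))" for m
    proof -
      have "f m = (\<Sum>j<n0. \<Sum>b\<in>F. b (c j b * (w j * m)))" unfolding w[rule_format] by (simp add: xE)
      also have "\<dots> = (\<Sum>b\<in>F. \<Sum>j<n0. b (c j b * (w j * m)))" by (rule sum.swap)
      also have "\<dots> = (\<Sum>b\<in>F. b (\<Sum>j<n0. c j b * (w j * m)))"
        by (intro sum.cong refl bimod_map_sum[symmetric] bi) (use FB in auto)
      finally show ?thesis by (simp add: sum_distrib_right mult.assoc)
    qed
    then show ?thesis by (intro exI allI)
  qed
  have ind: "c' b = 0" if z: "\<And>m. (\<Sum>b\<in>F. b (c' b * m)) = 0" and b: "b \<in> F" for c' b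
  proof -
    \<comment> \<open>Extension by zero outside \<open>F\<close>, as required by the uniqueness
      clause of \<open>depth2\<close>, which then compares it with the zero expansion of the zero
      map.\<close>
    define c'' where "c'' b = (if b \<in> F then c' b else 0)" for b
    have sub: "{b. c'' b \<noteq> 0} \<subseteq> F" by (auto simp: c''_def)
    have "(\<Sum>b\<in>{b. c'' b \<noteq> 0}. b (c'' b * m)) = (\<Sum>b\<in>F. b (c'' b * m))" for m
      by (rule sum.mono_neutral_left[OF finF sub]) (use b0 in auto)
    also have "(\<Sum>b\<in>F. b (c'' b * m)) = 0" for m using z[of m] by (simp add: c''_def)
    finally have 1: "(\<forall>b. b \<notin> B \<longrightarrow> c'' b = 0) \<and> finite {b. c'' b \<noteq> 0} \<and>
           (\<lambda>_. 0) = (\<lambda>x. \<Sum>b\<in>{b. c'' b \<noteq> 0}. b (c'' b * x))"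
      using finite_subset[OF sub finF] FB by (auto simp: c''_def)
    have 2: "(\<forall>b. b \<notin> B \<longrightarrow> (\<lambda>_::'m \<Rightarrow> 'm. 0::'m) b = 0) \<and> finite {b. (\<lambda>_::'m \<Rightarrow> 'm. 0::'m) b \<noteq> 0} \<and>
           (\<lambda>_. 0) = (\<lambda>x. \<Sum>b\<in>{b. (\<lambda>_::'m \<Rightarrow> 'm. 0::'m) b \<noteq> 0}. b (0 * x))"
      by simp
    have "(\<lambda>_. 0) \<in> E1 N" by (simp add: E1_def)
    from uniq[OF this] have "c'' = (\<lambda>_. 0)"
    proof (rule alt_ex1E)
      fix c0
      assume u: "\<forall>c c'. ((\<forall>b. b \<notin> B \<longrightarrow> c b = 0) \<and> finite {b. c b \<noteq> 0} \<and>
           (\<lambda>_. 0) = (\<lambda>x. \<Sum>b\<in>{b. c b \<noteq> 0}. b (c b * x))) \<and>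
         ((\<forall>b. b \<notin> B \<longrightarrow> c' b = 0) \<and> finite {b. c' b \<noteq> 0} \<and>
           (\<lambda>_. 0) = (\<lambda>x. \<Sum>b\<in>{b. c' b \<noteq> 0}. b (c' b * x))) \<longrightarrow> c = c'"
      show "c'' = (\<lambda>_. 0)" by (rule u[rule_format, OF conjI[OF 1 2]])
    qed
    from fun_cong[OF this, of b] show ?thesis using b by (simp add: c''_def)
  qed
  obtain h where h: "bij_betw h {0..<card F} F" using ex_bij_betw_nat_finite[OF finF] by blast
  have re: "(\<Sum>i<card F. G (h i)) = (\<Sum>b\<in>F. G b)" for G :: "('m \<Rightarrow> 'm) \<Rightarrow> 'm"
    using sum.reindex_bij_betw[OF h, of G] by (simp add: atLeast0LessThan)
  have hF: "h i \<in> F" if "i < card F" for i using h that by (auto simp: bij_betw_def)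
  show ?thesis
  proof (intro exI[of _ "card F"] exI[of _ h] conjI allI impI ballI)
    show "bimod_map (h i)" if "i < card F" for i using bi hF[OF that] FB by blast
  next
    fix f assume "f \<in> E1 N"
    then obtain c' where c': "\<forall>m. f m = (\<Sum>b\<in>F. b (c' b * m))" by (rule gen[THEN exE])
    show "\<exists>c. \<forall>m. f m = (\<Sum>i<card F. h i (c i * m))"
      by (rule exI[of _ "\<lambda>i. c' (h i)"]) (simp add: c' re[of "\<lambda>b. b (c' b * _)", symmetric])
  next
    fix c :: "nat \<Rightarrow> 'm" and i
    assume z: "\<forall>m. (\<Sum>i<card F. h i (c i * m)) = 0" and i: "i < card F"
    define c' where "c' b = c (the_inv_into {0..<card F} h b)" for b
    have inj: "inj_on h {0..<card F}" using h by (simp add: bij_betw_def)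
    have c'h: "c' (h i) = c i" if "i < card F" for i
      using the_inv_into_f_f[OF inj, of i] that by (simp add: c'_def)
    have "(\<Sum>b\<in>F. b (c' b * m)) = 0" for m
      using z by (simp add: re[of "\<lambda>b. b (c' b * m)", symmetric] c'h)
    then show "c i = 0" using ind[of c', OF _ hF[OF i]] c'h[OF i] by simp
  qed
qed

text \<open>The Frobenius homomorphism turns a right basis of \<open>End M\<^sub>N\<close> into a basis of \<open>End \<^sub>N M\<close>
  by passing to adjoints \<open>E (R i a * m) = E (a * b i m)\<close>.\<close>

lemma adjoint_basis:
  assumes "depth2 N"
  shows "\<exists>(d::nat) R. (\<forall>i<d. bimod_map (R i)) \<and>
    (\<forall>f. (\<forall>a b. f (a + b) = f a + f b) \<and> (\<forall>n\<in>N. \<forall>m. f (n * m) = n * f m)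
      \<longrightarrow> (\<exists>c. \<forall>m. f m = (\<Sum>i<d. R i m * c i))) \<and>
    (\<forall>c. (\<forall>m. (\<Sum>i<d. R i m * c i) = 0) \<longrightarrow> (\<forall>i<d. c i = 0))"
proof -
  from depth2_basis[OF assms] obtain d :: nat and b where
    bb: "(\<forall>i<d. bimod_map (b i)) \<and>
    (\<forall>f\<in>E1 N. \<exists>c. \<forall>m. f m = (\<Sum>i<d. b i (c i * m))) \<and>
    (\<forall>c. (\<forall>m. (\<Sum>i<d. b i (c i * m)) = 0) \<longrightarrow> (\<forall>i<d. c i = 0))"
    by (elim exE)
  note b = bb[THEN conjunct1, rule_format]
    and gen = bb[THEN conjunct2, THEN conjunct1, THEN bspec]
    and ind = bb[THEN conjunct2, THEN conjunct2, rule_format]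
  \<comment> \<open>The only possible choice: \<open>dual_left\<close> expands \<open>R i a\<close>
    through the values \<open>E (R i a * x k)\<close>, which adjointness prescribes as
    \<open>E (a * b i (x k))\<close>.\<close>
  define R where "R i a = (\<Sum>k<n0. E (a * b i (x k)) * y k)" for i a
  have adj: "E (R i a * m) = E (a * b i m)" if i: "i < d" for i a m
  proof -
    have "E (R i a * m) = (\<Sum>k<n0. E (a * b i (x k) * E (y k * m)))"
      by (simp add: R_def sum_distrib_right E_sum mult.assoc E_E_left E_E_right')
    also have "\<dots> = E (a * b i (\<Sum>k<n0. x k * E (y k * m)))"
      by (simp add: bimod_map_sum[OF b[OF i]] bimod_mapD(3)[OF b[OF i]] E_N E_sum sum_distrib_left mult.assoc)
    finally show ?thesis by (simp add: dual_right)
  qed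
  show ?thesis
  proof (intro exI[of _ d] exI[of _ R] conjI allI impI)
    fix i assume i: "i < d"
    show "bimod_map (R i)"
      unfolding bimod_map_def
    proof (intro conjI allI ballI)
      show "R i (a + b) = R i a + R i b" for a b
        by (simp add: R_def distrib_right E_add sum.distrib)
      fix n m assume n: "n \<in> N"
      show "R i (n * m) = n * R i m"
        using n by (simp add: R_def mult.assoc E_left sum_distrib_left)
      show "R i (m * n) = R i m * n"
      proof (rule E_nondeg_right)
        fix m'
        have "E (R i (m * n) * m') = E (m * (n * b i m'))" using i by (simp add: adj mult.assoc)
        also have "\<dots> = E (R i m * n * m')"
          using i n by (simp add: adj mult.assoc bimod_mapD(2)[OF b])
        finally show "E (R i (m * n) * m') = E (R i m * n * m')" .
      qed
    qed
  next
    fix f :: "'m \<Rightarrow> 'm" assume ff: "(\<forall>a b. f (a + b) = f a + f b) \<and> (\<forall>n\<in>N. \<forall>m. f (n * m) = n * f m)"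
    have f: "f (a + b) = f a + f b" "n \<in> N \<Longrightarrow> f (n * m) = n * f m" for a b n m
      using ff by auto
    have f0: "f 0 = 0" using f(1)[of 0 0] by simp
    have fsum: "f (\<Sum>k\<in>K. h k) = (\<Sum>k\<in>K. f (h k))" for h and K :: "nat set"
      by (induct K rule: infinite_finite_induct) (auto simp: f f0)
    \<comment> \<open>The adjoint of \<open>f\<close> in the other direction. It is right
      \<open>N\<close>-linear, so it expands in the \<open>b i\<close>, and nondegeneracy of
      \<open>E\<close> carries the expansion back to \<open>f\<close>.\<close>
    define g where "g m = (\<Sum>k<n0. x k * E (f (y k) * m))" for m
    have fg: "E (f a * m) = E (a * g m)" for a m
    proof -
      have "E (a * g m) = (\<Sum>k<n0. E (a * x k) * E (f (y k) * m))"
        by (simp add: g_def sum_distrib_left E_sum E_E_right')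
      also have "\<dots> = E (f (\<Sum>k<n0. E (a * x k) * y k) * m)"
        by (simp add: fsum f E_N sum_distrib_right E_sum mult.assoc E_E_left)
      finally show ?thesis by (simp add: dual_left)
    qed
    have "E (f (y k) * (m * n)) = E (f (y k) * m) * n" if "n \<in> N" for k m n
      using E_right[OF that, of "f (y k) * m"] by (simp add: mult.assoc)
    then have "g \<in> E1 N"
      by (simp add: E1_def g_def distrib_left E_add sum.distrib sum_distrib_right mult.assoc)
    then obtain c where c: "\<forall>m. g m = (\<Sum>i<d. b i (c i * m))" by (rule gen[THEN exE])
    have "f a = (\<Sum>i<d. R i a * c i)" for a
    proof (rule E_nondeg_right)
      fix m
      have "E (f a * m) = (\<Sum>i<d. E (R i a * (c i * m)))"
        by (simp add: fg c sum_distrib_left E_sum adj)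
      then show "E (f a * m) = E ((\<Sum>i<d. R i a * c i) * m)"
        by (simp add: sum_distrib_right E_sum mult.assoc)
    qed
    then show "\<exists>c. \<forall>m. f m = (\<Sum>i<d. R i m * c i)" by (intro exI allI)
  next
    fix c :: "nat \<Rightarrow> 'm" and i assume z: "\<forall>m. (\<Sum>i<d. R i m * c i) = 0" and i: "i < d"
    have "(\<Sum>i<d. b i (c i * m)) = 0" for m
    proof (rule E_nondeg_left)
      fix a
      have "E (a * (\<Sum>i<d. b i (c i * m))) = E ((\<Sum>i<d. R i a * c i) * m)"
        by (simp add: sum_distrib_left sum_distrib_right E_sum mult.assoc adj)
      then show "E (a * (\<Sum>i<d. b i (c i * m))) = E (a * 0)" by (simp add: z)
    qed
    then show "c i = 0" using ind[of c i] i by blast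
  qed
qed

end

section \<open>The Hopf algebra of a strongly separable extension of depth two\<close>

text \<open>If \<open>S * id\<close> is the convolution unit, then \<open>X \<mapsto> X * S\<close>
  followed by \<open>X \<mapsto> X * id\<close> is the identity. In finite dimension the composite
  in the other order is the identity as well, and its value at the convolution unit says that
  \<open>id * S\<close> is the unit.\<close>

lemma left_antipode_imp_right:
  fixes C D :: "nat \<Rightarrow> nat \<Rightarrow> nat \<Rightarrow> 'k::field"
  assumes assoc: "\<And>i j l q. i < d \<Longrightarrow> j < d \<Longrightarrow> l < d \<Longrightarrow> q < d \<Longrightarrow>
      (\<Sum>p<d. C i j p * C p l q) = (\<Sum>p<d. C j l p * C i p q)"
    and unit: "\<And>j q. j < d \<Longrightarrow> q < d \<Longrightarrow> (\<Sum>i<d. u i * C i j q) = (if j = q then 1 else 0)"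
      "\<And>j q. j < d \<Longrightarrow> q < d \<Longrightarrow> (\<Sum>i<d. u i * C j i q) = (if j = q then 1 else 0)"
    and coassoc: "\<And>i a b l. i < d \<Longrightarrow> a < d \<Longrightarrow> b < d \<Longrightarrow> l < d \<Longrightarrow>
      (\<Sum>j<d. D i j l * D j a b) = (\<Sum>p<d. D i a p * D p b l)"
    and counit: "\<And>i l. i < d \<Longrightarrow> l < d \<Longrightarrow> (\<Sum>j<d. e j * D i j l) = (if i = l then 1 else 0)"
      "\<And>i j. i < d \<Longrightarrow> j < d \<Longrightarrow> (\<Sum>l<d. e l * D i j l) = (if i = j then 1 else 0)"
    and left: "\<And>i q. i < d \<Longrightarrow> q < d \<Longrightarrow>
      (\<Sum>j<d. \<Sum>l<d. \<Sum>p<d. D i j l * S j p * C p l q) = e i * u q"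
    and iq: "i < d" "q < d"
  shows "(\<Sum>j<d. \<Sum>l<d. \<Sum>p<d. D i j l * S l p * C j p q) = e i * u q"
proof -
  text \<open>\<open>K\<close> and \<open>K'\<close> are the matrices of the convolutions \<open>X \<mapsto> X * id\<close> and \<open>X \<mapsto> X * S\<close>.\<close>
  define K where "K = (\<lambda>(i, q) (j, p). \<Sum>l<d. D i j l * C p l q)"
  define K' where "K' = (\<lambda>(i, q) (j, p). \<Sum>l<d. \<Sum>r<d. D i j l * S l r * C p r q)"
  let ?I = "{..<d} \<times> {..<d}"
  have pairs: "(\<Sum>k\<in>?I. G k) = (\<Sum>j<d. \<Sum>p<d. G (j, p))" for G :: "nat \<times> nat \<Rightarrow> 'k"
    by (simp add: sum.cartesian_product)
  \<comment> \<open>Coassociativity and associativity regroup \<open>(X * S) * id\<close> as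
    \<open>X * (S * id)\<close>.\<close>
  have KK': "(\<Sum>k\<in>?I. K v k * K' k w) = (if v = w then 1 else 0)" if vw: "v \<in> ?I" "w \<in> ?I" for v w
  proof -
    obtain i q a b where v: "v = (i, q)" and w: "w = (a, b)" by (metis surj_pair)
    have lt: "i < d" "q < d" "a < d" "b < d" using vw v w by auto
    have "(\<Sum>k\<in>?I. K v k * K' k w)
        = (\<Sum>j<d. \<Sum>p<d. \<Sum>l'<d. \<Sum>r<d. \<Sum>l<d. (D i j l * D j a l') * S l' r * (C b r p * C p l q))"
      unfolding pairs v w K_def K'_def split_conv
      by (simp only: sum_distrib_left sum_distrib_right mult_ac)
    also have "\<dots> = (\<Sum>j<d. \<Sum>p<d. \<Sum>l'<d. \<Sum>l<d. \<Sum>r<d. (D i j l * D j a l') * S l' r * (C b r p * C p l q))"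
      by (rule sum.cong[OF refl], rule sum.cong[OF refl], rule sum.cong[OF refl], rule sum.swap)
    also have "\<dots> = (\<Sum>j<d. \<Sum>p<d. \<Sum>l<d. \<Sum>l'<d. \<Sum>r<d. (D i j l * D j a l') * S l' r * (C b r p * C p l q))"
      by (rule sum.cong[OF refl], rule sum.cong[OF refl], rule sum.swap)
    also have "\<dots> = (\<Sum>j<d. \<Sum>l<d. \<Sum>p<d. \<Sum>l'<d. \<Sum>r<d. (D i j l * D j a l') * S l' r * (C b r p * C p l q))"
      by (rule sum.cong[OF refl], rule sum.swap)
    also have "\<dots> = (\<Sum>l<d. \<Sum>j<d. \<Sum>p<d. \<Sum>l'<d. \<Sum>r<d. (D i j l * D j a l') * S l' r * (C b r p * C p l q))"
      by (rule sum.swap)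
    also have "\<dots> = (\<Sum>l<d. \<Sum>j<d. \<Sum>l'<d. \<Sum>p<d. \<Sum>r<d. (D i j l * D j a l') * S l' r * (C b r p * C p l q))"
      by (rule sum.cong[OF refl], rule sum.cong[OF refl], rule sum.swap)
    also have "\<dots> = (\<Sum>l<d. \<Sum>j<d. \<Sum>l'<d. \<Sum>r<d. \<Sum>p<d. (D i j l * D j a l') * S l' r * (C b r p * C p l q))"
      by (rule sum.cong[OF refl], rule sum.cong[OF refl], rule sum.cong[OF refl], rule sum.swap)
    also have "\<dots> = (\<Sum>l<d. \<Sum>l'<d. \<Sum>j<d. \<Sum>r<d. \<Sum>p<d. (D i j l * D j a l') * S l' r * (C b r p * C p l q))"
      by (rule sum.cong[OF refl], rule sum.swap)
    also have "\<dots> = (\<Sum>l<d. \<Sum>l'<d. \<Sum>r<d. \<Sum>j<d. \<Sum>p<d. (D i j l * D j a l') * S l' r * (C b r p * C p l q))"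
      by (rule sum.cong[OF refl], rule sum.cong[OF refl], rule sum.swap)
    also have "\<dots> = (\<Sum>l<d. \<Sum>l'<d. \<Sum>r<d. (\<Sum>j<d. D i j l * D j a l') * S l' r * (\<Sum>p<d. C b r p * C p l q))"
      by (intro sum.cong refl) (simp only: sum_distrib_left sum_distrib_right, rule sum.swap)
    also have "\<dots> = (\<Sum>l<d. \<Sum>l'<d. \<Sum>r<d. (\<Sum>s<d. D i a s * D s l' l) * S l' r * (\<Sum>t<d. C r l t * C b t q))"
      by (intro sum.cong refl) (use coassoc assoc lt in simp)
    also have "\<dots> = (\<Sum>l<d. \<Sum>l'<d. \<Sum>r<d. \<Sum>s<d. \<Sum>t<d. (D i a s * C b t q) * (D s l' l * S l' r * C r l t))"
      by (intro sum.cong refl)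
        (simp only: sum_distrib_left sum_distrib_right, rule trans[OF sum.swap], intro sum.cong refl, simp only: mult_ac)
    also have "\<dots> = (\<Sum>l<d. \<Sum>l'<d. \<Sum>s<d. \<Sum>r<d. \<Sum>t<d. (D i a s * C b t q) * (D s l' l * S l' r * C r l t))"
      by (rule sum.cong[OF refl], rule sum.cong[OF refl], rule sum.swap)
    also have "\<dots> = (\<Sum>l<d. \<Sum>l'<d. \<Sum>s<d. \<Sum>t<d. \<Sum>r<d. (D i a s * C b t q) * (D s l' l * S l' r * C r l t))"
      by (rule sum.cong[OF refl], rule sum.cong[OF refl], rule sum.cong[OF refl], rule sum.swap)
    also have "\<dots> = (\<Sum>l'<d. \<Sum>l<d. \<Sum>s<d. \<Sum>t<d. \<Sum>r<d. (D i a s * C b t q) * (D s l' l * S l' r * C r l t))"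
      by (rule sum.swap)
    also have "\<dots> = (\<Sum>l'<d. \<Sum>s<d. \<Sum>l<d. \<Sum>t<d. \<Sum>r<d. (D i a s * C b t q) * (D s l' l * S l' r * C r l t))"
      by (rule sum.cong[OF refl], rule sum.swap)
    also have "\<dots> = (\<Sum>s<d. \<Sum>l'<d. \<Sum>l<d. \<Sum>t<d. \<Sum>r<d. (D i a s * C b t q) * (D s l' l * S l' r * C r l t))"
      by (rule sum.swap)
    also have "\<dots> = (\<Sum>s<d. \<Sum>l'<d. \<Sum>t<d. \<Sum>l<d. \<Sum>r<d. (D i a s * C b t q) * (D s l' l * S l' r * C r l t))"
      by (rule sum.cong[OF refl], rule sum.cong[OF refl], rule sum.swap)
    also have "\<dots> = (\<Sum>s<d. \<Sum>t<d. \<Sum>l'<d. \<Sum>l<d. \<Sum>r<d. (D i a s * C b t q) * (D s l' l * S l' r * C r l t))"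
      by (rule sum.cong[OF refl], rule sum.swap)
    also have "\<dots> = (\<Sum>s<d. \<Sum>t<d. (D i a s * C b t q) * (e s * u t))"
      by (intro sum.cong refl) (simp only: sum_distrib_left[symmetric], simp only: left lessThan_iff)
    also have "\<dots> = (\<Sum>s<d. e s * D i a s) * (\<Sum>t<d. u t * C b t q)"
      by (simp add: sum_product mult_ac)
    also have "\<dots> = (if v = w then 1 else 0)" using lt by (auto simp: counit unit v w)
    finally show ?thesis .
  qed
  have K'K: "(\<Sum>k\<in>?I. K' v k * K k w) = (if v = w then 1 else 0)" if "v \<in> ?I" "w \<in> ?I" for v w
    by (rule matrix_left_right_inverse[OF _ KK' that]) auto
  \<comment> \<open>\<open>K\<close> takes the convolution unit, with entries
    \<open>e a * u b\<close>, to the identity matrix.\<close>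
  have Ku: "(\<Sum>a<d. \<Sum>b<d. K (j, p) (a, b) * (e a * u b)) = (if j = p then 1 else 0)" if "j < d" "p < d" for j p
  proof -
    have "(\<Sum>a<d. \<Sum>b<d. K (j, p) (a, b) * (e a * u b))
        = (\<Sum>a<d. \<Sum>b<d. \<Sum>l<d. (e a * D j a l) * (u b * C b l p))"
      by (simp add: K_def sum_distrib_right sum_distrib_left mult_ac)
    also have "\<dots> = (\<Sum>a<d. \<Sum>l<d. \<Sum>b<d. (e a * D j a l) * (u b * C b l p))"
      by (rule sum.cong[OF refl], rule sum.swap)
    also have "\<dots> = (\<Sum>l<d. \<Sum>a<d. \<Sum>b<d. (e a * D j a l) * (u b * C b l p))" by (rule sum.swap)
    also have "\<dots> = (\<Sum>l<d. (\<Sum>a<d. e a * D j a l) * (\<Sum>b<d. u b * C b l p))"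
      by (simp only: sum_product)
    also have "\<dots> = (\<Sum>l<d. (if j = l then 1 else 0) * (if l = p then 1 else 0))"
      by (intro sum.cong refl) (use that counit unit in simp)
    also have "\<dots> = (if j = p then 1 else 0)"
      using sum_lessThan_delta(4)[OF that(1), of "\<lambda>l. if l = p then 1 else 0"] by simp
    finally show ?thesis .
  qed
  have "(\<Sum>a<d. \<Sum>b<d. (\<Sum>k\<in>?I. K' (i, q) k * K k (a, b)) * (e a * u b))
      = (\<Sum>a<d. \<Sum>b<d. (if (i, q) = (a, b) then 1 else 0) * (e a * u b))"
    by (intro sum.cong refl) (use K'K iq in simp)
  also have "\<dots> = (\<Sum>a<d. (if i = a then 1 else 0) * (\<Sum>b<d. (if q = b then 1 else 0) * (e a * u b)))"
    unfolding sum_distrib_left by (intro sum.cong refl) auto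
  also have "\<dots> = e i * u q" using iq by simp
  finally have "e i * u q = (\<Sum>a<d. \<Sum>b<d. (\<Sum>k\<in>?I. K' (i, q) k * K k (a, b)) * (e a * u b))" by simp
  also have "\<dots> = (\<Sum>a<d. \<Sum>b<d. \<Sum>k\<in>?I. K' (i, q) k * (K k (a, b) * (e a * u b)))"
    by (simp only: sum_distrib_right mult.assoc)
  also have "\<dots> = (\<Sum>a<d. \<Sum>k\<in>?I. \<Sum>b<d. K' (i, q) k * (K k (a, b) * (e a * u b)))"
    by (rule sum.cong[OF refl], rule sum.swap)
  also have "\<dots> = (\<Sum>k\<in>?I. \<Sum>a<d. \<Sum>b<d. K' (i, q) k * (K k (a, b) * (e a * u b)))" by (rule sum.swap)
  also have "\<dots> = (\<Sum>k\<in>?I. K' (i, q) k * (\<Sum>a<d. \<Sum>b<d. K k (a, b) * (e a * u b)))"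
    by (simp only: sum_distrib_left)
  also have "\<dots> = (\<Sum>j<d. \<Sum>p<d. K' (i, q) (j, p) * (\<Sum>a<d. \<Sum>b<d. K (j, p) (a, b) * (e a * u b)))"
    by (rule pairs)
  also have "\<dots> = (\<Sum>j<d. \<Sum>p<d. K' (i, q) (j, p) * (if j = p then 1 else 0))"
    by (intro sum.cong refl) (use Ku in simp)
  also have "\<dots> = (\<Sum>j<d. K' (i, q) (j, j))"
    by (intro sum.cong refl) simp
  finally show ?thesis by (simp add: K'_def)
qed

lemma (in k_alg) sm_one_inj: "a \<cdot> 1 = b \<cdot> 1 \<longleftrightarrow> a = b"
proof
  assume "a \<cdot> 1 = b \<cdot> 1"
  then have "(a - b) \<cdot> 1 = 0" using sm_add_left[of a "- b" 1] by (simp add: sm_minus_left)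
  then show "a = b" by (simp add: sm_def)
qed simp

locale depth2_frobenius = frobenius_ext \<iota> N E n0 x y
  for \<iota> :: "'k::field \<Rightarrow> 'm::ring_1" and N E n0 x y +
  fixes d :: nat and R :: "nat \<Rightarrow> 'm \<Rightarrow> 'm"
  assumes R_bimod: "i < d \<Longrightarrow> bimod_map (R i)"
    and R_gen: "(\<forall>a b. f (a + b) = f a + f b) \<and> (\<forall>n\<in>N. \<forall>m. f (n * m) = n * f m)
      \<Longrightarrow> \<exists>c. \<forall>m. f m = (\<Sum>i<d. R i m * c i)"
    and R_ind: "(\<forall>m. (\<Sum>i<d. R i m * c i) = 0) \<Longrightarrow> \<forall>i<d. c i = 0"
    and E_1: "E 1 \<noteq> 0" and index: "(\<Sum>i<n0. x i * y i) \<noteq> 0"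
begin

section \<open>Expansion and uniqueness in the basis \<open>R\<close>\<close>

lemma R_add: "i < d \<Longrightarrow> R i (a + b) = R i a + R i b"
  by (rule bimod_mapD(1)[OF R_bimod])

lemma R_left: "i < d \<Longrightarrow> n \<in> N \<Longrightarrow> R i (n * m) = n * R i m"
  by (rule bimod_mapD(2)[OF R_bimod])

lemma R_right: "i < d \<Longrightarrow> n \<in> N \<Longrightarrow> R i (m * n) = R i m * n"
  by (rule bimod_mapD(3)[OF R_bimod])

lemma R_scale: "i < d \<Longrightarrow> R i (c \<cdot> m) = c \<cdot> R i m"
  by (rule bimod_map_scale[OF R_bimod])

lemma R_sum: "i < d \<Longrightarrow> R i (\<Sum>k\<in>K. h k) = (\<Sum>k\<in>K. R i (h k))"
  by (rule bimod_map_sum[OF R_bimod])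

lemma right_unique:
  assumes "\<And>m. (\<Sum>i<d. R i m * a i) = (\<Sum>i<d. R i m * b i)" "i < d"
  shows "a i = b i"
proof -
  have "\<forall>m. (\<Sum>i<d. R i m * (a i - b i)) = 0"
    using assms(1) by (simp add: right_diff_distrib sum_subtractf)
  from R_ind[OF this] have "a i - b i = 0" using assms(2) by blast
  then show ?thesis by simp
qed

lemma scalar_unique:
  assumes "\<And>m. (\<Sum>i<d. a i \<cdot> R i m) = (\<Sum>i<d. b i \<cdot> R i m)" "i < d"
  shows "a i = b i"
proof -
  have "a i \<cdot> 1 = b i \<cdot> 1"
    by (rule right_unique[where a = "\<lambda>i. a i \<cdot> 1" and b = "\<lambda>i. b i \<cdot> 1"]) (use assms in simp_all)
  then show ?thesis by (simp add: sm_one_inj)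
qed

text \<open>For fixed \<open>w\<close> the inner sum is a right coefficient of \<open>R i v\<close>,
  so right \<open>M\<close>-independence removes one factor at a time.\<close>

lemma scalar_unique2:
  assumes "\<And>v w. (\<Sum>i<d. \<Sum>j<d. a i j \<cdot> (R i v * R j w)) = (\<Sum>i<d. \<Sum>j<d. b i j \<cdot> (R i v * R j w))"
    and "i < d" "j < d"
  shows "a i j = b i j"
proof (rule scalar_unique[OF _ assms(3)])
  fix w
  show "(\<Sum>j<d. a i j \<cdot> R j w) = (\<Sum>j<d. b i j \<cdot> R j w)"
    by (rule right_unique[where a = "\<lambda>i. \<Sum>j<d. a i j \<cdot> R j w" and b = "\<lambda>i. \<Sum>j<d. b i j \<cdot> R j w"])
      (use assms in \<open>simp_all add: sum_distrib_left\<close>)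
qed

lemma scalar_unique3:
  assumes "\<And>v w z. (\<Sum>i<d. \<Sum>j<d. \<Sum>l<d. a i j l \<cdot> (R i v * (R j w * R l z)))
      = (\<Sum>i<d. \<Sum>j<d. \<Sum>l<d. b i j l \<cdot> (R i v * (R j w * R l z)))"
    and "i < d" "j < d" "l < d"
  shows "a i j l = b i j l"
proof (rule scalar_unique2[OF _ assms(3,4)])
  fix w z
  show "(\<Sum>j<d. \<Sum>l<d. a i j l \<cdot> (R j w * R l z)) = (\<Sum>j<d. \<Sum>l<d. b i j l \<cdot> (R j w * R l z))"
    by (rule right_unique[where a = "\<lambda>i. \<Sum>j<d. \<Sum>l<d. a i j l \<cdot> (R j w * R l z)"
          and b = "\<lambda>i. \<Sum>j<d. \<Sum>l<d. b i j l \<cdot> (R j w * R l z)"])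
      (use assms in \<open>simp_all add: sum_distrib_left\<close>)
qed

text \<open>A bimodule map is left \<open>N\<close>-linear, so it has right coefficients
  \<open>c i\<close> in \<open>M\<close>. Comparing \<open>f m * n\<close> with
  \<open>f (m * n)\<close> shows that they commute with \<open>N\<close>, and irreducibility makes
  them scalars.\<close>

lemma bimod_expand:
  assumes f: "bimod_map f"
  shows "\<exists>c. \<forall>m. f m = (\<Sum>i<d. c i \<cdot> R i m)"
proof -
  have "(\<forall>a b. f (a + b) = f a + f b) \<and> (\<forall>n\<in>N. \<forall>m. f (n * m) = n * f m)"
    using bimod_mapD(1,2)[OF f] by blast
  from R_gen[OF this] obtain c where c: "\<forall>m. f m = (\<Sum>i<d. R i m * c i)" by (rule exE)
  have "\<exists>s. c i = s \<cdot> 1" if i: "i < d" for i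
  proof -
    have "c i * n = n * c i" if n: "n \<in> N" for n
    proof (rule right_unique[where a = "\<lambda>i. c i * n" and b = "\<lambda>i. n * c i", OF _ i])
      fix m
      have "(\<Sum>i<d. R i m * (c i * n)) = f m * n" by (simp add: c sum_distrib_right mult.assoc)
      also have "\<dots> = f (m * n)" by (rule bimod_mapD(3)[OF f n, symmetric])
      also have "\<dots> = (\<Sum>i<d. R i m * (n * c i))" unfolding c[rule_format]
        by (intro sum.cong refl) (simp add: R_right n mult.assoc)
      finally show "(\<Sum>i<d. R i m * (c i * n)) = (\<Sum>i<d. R i m * (n * c i))" .
    qed
    then obtain s where "c i = s \<cdot> 1" by (rule scalar_of_commutes)
    then show ?thesis by blast
  qed
  then have "\<forall>i. \<exists>s. i < d \<longrightarrow> c i = s \<cdot> 1" by blast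
  from choice[OF this] obtain s where s: "\<forall>i. i < d \<longrightarrow> c i = s i \<cdot> 1" by (rule exE)
  have "f m = (\<Sum>i<d. s i \<cdot> R i m)" for m
    unfolding c[rule_format] by (intro sum.cong refl) (simp add: s)
  then show ?thesis by (intro exI allI)
qed

definition coef :: "('m \<Rightarrow> 'm) \<Rightarrow> nat \<Rightarrow> 'k" where
  "coef f = (SOME c. \<forall>m. f m = (\<Sum>i<d. c i \<cdot> R i m))"

lemma coef: "bimod_map f \<Longrightarrow> f m = (\<Sum>i<d. coef f i \<cdot> R i m)"
  unfolding coef_def using someI_ex[OF bimod_expand, rule_format] .

definition bimod_map2 :: "('m \<Rightarrow> 'm \<Rightarrow> 'm) \<Rightarrow> bool" where
  "bimod_map2 F \<longleftrightarrow> (\<forall>a a' b. F (a + a') b = F a b + F a' b) \<and> (\<forall>a b b'. F a (b + b') = F a b + F a b') \<and>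
    (\<forall>n\<in>N. \<forall>a b. F (n * a) b = n * F a b \<and> F (a * n) b = F a (n * b) \<and> F a (b * n) = F a b * n)"

text \<open>Fix \<open>b\<close> and expand in the first argument. By uniqueness the right
  coefficients are bimodule maps in \<open>b\<close>: balancing gives left linearity, and right
  linearity is inherited from \<open>F\<close>.\<close>

lemma bilinear_expand:
  assumes F: "bimod_map2 F"
  shows "\<exists>c. \<forall>a b. F a b = (\<Sum>i<d. \<Sum>j<d. c i j \<cdot> (R i a * R j b))"
proof -
  have F1: "F (a + a') b = F a b + F a' b" "F a (b + b') = F a b + F a b'" for a a' b b'
    using F unfolding bimod_map2_def by blast+
  have F2: "F (n * a) b = n * F a b" "F (a * n) b = F a (n * b)" "F a (b * n) = F a b * n"
    if "n \<in> N" for n a b using F that unfolding bimod_map2_def by blast+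
  have "\<exists>c. \<forall>a. F a b = (\<Sum>i<d. R i a * c i)" for b
    by (rule R_gen) (use F1(1) F2(1) in blast)
  then have "\<forall>b. \<exists>c. \<forall>a. F a b = (\<Sum>i<d. R i a * c i)" by (rule allI)
  from choice[OF this] obtain h where h: "\<forall>b a. F a b = (\<Sum>i<d. R i a * h b i)" by (rule exE)
  have bh: "bimod_map (\<lambda>b. h b i)" if i: "i < d" for i
    unfolding bimod_map_def
  proof (intro conjI allI ballI)
    show "h (b + b') i = h b i + h b' i" for b b'
      by (rule right_unique[where a = "h (b + b')" and b = "\<lambda>i. h b i + h b' i", OF _ i])
        (simp add: h[rule_format, symmetric] F1 distrib_left sum.distrib)
    fix n b assume n: "n \<in> N"
    show "h (n * b) i = n * h b i"
    proof (rule right_unique[where a = "h (n * b)" and b = "\<lambda>i. n * h b i", OF _ i])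
      fix m
      have "(\<Sum>i<d. R i m * h (n * b) i) = F (m * n) b" by (simp add: h[rule_format, symmetric] F2 n)
      also have "\<dots> = (\<Sum>i<d. R i m * (n * h b i))" unfolding h[rule_format]
        by (intro sum.cong refl) (simp add: R_right n mult.assoc)
      finally show "(\<Sum>i<d. R i m * h (n * b) i) = (\<Sum>i<d. R i m * (n * h b i))" .
    qed
    show "h (b * n) i = h b i * n"
      by (rule right_unique[where a = "h (b * n)" and b = "\<lambda>i. h b i * n", OF _ i])
        (simp only: h[rule_format, symmetric] F2 n mult.assoc[symmetric] sum_distrib_right[symmetric])
  qed
  have "F a b = (\<Sum>i<d. \<Sum>j<d. coef (\<lambda>b. h b i) j \<cdot> (R i a * R j b))" for a b
  proof -
    have "F a b = (\<Sum>i<d. R i a * h b i)" using h by blast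
    also have "\<dots> = (\<Sum>i<d. R i a * (\<Sum>j<d. coef (\<lambda>b. h b i) j \<cdot> R j b))"
      by (intro sum.cong refl arg_cong2[where f = times] coef[OF bh]) simp
    finally show ?thesis by (simp add: sum_distrib_left)
  qed
  then show ?thesis by (intro exI allI)
qed

definition coef2 :: "('m \<Rightarrow> 'm \<Rightarrow> 'm) \<Rightarrow> nat \<Rightarrow> nat \<Rightarrow> 'k" where
  "coef2 F = (SOME c. \<forall>a b. F a b = (\<Sum>i<d. \<Sum>j<d. c i j \<cdot> (R i a * R j b)))"

lemma coef2: "bimod_map2 F \<Longrightarrow> F a b = (\<Sum>i<d. \<Sum>j<d. coef2 F i j \<cdot> (R i a * R j b))"
  unfolding coef2_def using someI_ex[OF bilinear_expand, rule_format] .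

definition scal :: "'m \<Rightarrow> 'k" where
  "scal a = (SOME c. a = c \<cdot> 1)"

lemma scal:
  assumes "\<And>n. n \<in> N \<Longrightarrow> a * n = n * a"
  shows "a = scal a \<cdot> 1"
proof -
  obtain c where "a = c \<cdot> 1" using assms by (rule scalar_of_commutes)
  then show ?thesis unfolding scal_def by (rule someI)
qed

text \<open>\<open>n * f 1 = f n = f 1 * n\<close>, so irreducibility applies.\<close>

lemma scal_bimod: "bimod_map f \<Longrightarrow> f 1 = scal (f 1) \<cdot> 1"
  by (rule scal) (metis bimod_mapD(2,3) mult_1 mult_1_right)

section \<open>Structure constants and the antipode\<close>

text \<open>As the \<open>R i\<close> act as the dual basis, composition of these maps encodes the
  coproduct of \<open>H\<close> and the identity map its counit, while products in \<open>M\<close>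
  encode the multiplication of \<open>H\<close> and values at 1 its unit.\<close>

definition "D p j i = coef (\<lambda>m. R j (R i m)) p"

definition "e i = coef (\<lambda>m. m) i"

definition "C i j q = coef2 (\<lambda>a b. R q (a * b)) i j"

definition "u q = scal (R q 1)"

text \<open>\<open>\<gamma>\<close> is the coproduct of the integral \<open>E\<close>.\<close>
definition "\<gamma> i j = coef2 (\<lambda>a b. E (a * b)) i j"

lemma R_R: "j < d \<Longrightarrow> i < d \<Longrightarrow> R j (R i a) = (\<Sum>p<d. D p j i \<cdot> R p a)"
  unfolding D_def by (rule coef[where f = "\<lambda>m. R j (R i m)"]) (rule bimod_map_comp[OF R_bimod R_bimod])

lemma counit: "(\<Sum>i<d. e i \<cdot> R i a) = a"
  unfolding e_def by (rule coef[symmetric]) (simp add: bimod_map_def)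

lemma bimod_map2_mult: "bimod_map f \<Longrightarrow> bimod_map2 (\<lambda>a b. f (a * b))"
  unfolding bimod_map2_def by (auto simp: distrib_left distrib_right mult.assoc bimod_mapD(1)[of f] bimod_mapD(2)[of f])
    (metis bimod_mapD(3) mult.assoc)

lemma R_mult: "q < d \<Longrightarrow> R q (a * b) = (\<Sum>i<d. \<Sum>j<d. C i j q \<cdot> (R i a * R j b))"
  unfolding C_def by (rule coef2[OF bimod_map2_mult[OF R_bimod]])

lemma E_mult: "E (a * b) = (\<Sum>i<d. \<Sum>j<d. \<gamma> i j \<cdot> (R i a * R j b))"
  unfolding \<gamma>_def by (rule coef2[OF bimod_map2_mult[OF bimod_E]])

lemma R_one: "q < d \<Longrightarrow> R q 1 = u q \<cdot> 1"
  unfolding u_def by (rule scal_bimod[OF R_bimod])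

definition "\<epsilon> = scal (E 1)"

lemma E_one: "E 1 = \<epsilon> \<cdot> 1"
  unfolding \<epsilon>_def by (rule scal_bimod[OF bimod_E])

lemma \<epsilon>: "\<epsilon> \<noteq> 0"
  using E_1 E_one by auto

lemma E_of_N: "n \<in> N \<Longrightarrow> E n = \<epsilon> \<cdot> n"
  using E_left[of n 1] by (simp add: E_one)

text \<open>The antipode of the dual Hopf algebra is the adjoint with respect to \<open>E\<close>.\<close>

definition SA :: "nat \<Rightarrow> 'm \<Rightarrow> 'm" where
  "SA p m = (\<Sum>k<n0. x k * E (R p (y k) * m))"

lemma SA_adj:
  assumes p: "p < d" shows "E (R p a * m) = E (a * SA p m)"
proof -
  have "E (a * SA p m) = (\<Sum>k<n0. E (a * x k) * E (R p (y k) * m))"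
    by (simp add: SA_def sum_distrib_left E_sum E_E_right')
  also have "\<dots> = E (R p (\<Sum>k<n0. E (a * x k) * y k) * m)"
    by (simp add: R_sum p R_left E_N sum_distrib_right E_sum mult.assoc E_E_left)
  finally show ?thesis by (simp add: dual_left)
qed

lemma SA_bimod:
  assumes p: "p < d" shows "bimod_map (SA p)"
  unfolding bimod_map_def
proof (intro conjI allI ballI)
  show "SA p (a + b) = SA p a + SA p b" for a b
    by (simp add: SA_def distrib_left E_add sum.distrib)
  fix n m assume n: "n \<in> N"
  show "SA p (m * n) = SA p m * n"
    using E_right[OF n] by (simp add: SA_def sum_distrib_right mult.assoc[symmetric])
  show "SA p (n * m) = n * SA p m"
  proof (rule E_nondeg_left)
    fix a
    have "E (a * SA p (n * m)) = E (R p (a * n) * m)"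
      using p n by (simp add: SA_adj[symmetric] R_right mult.assoc)
    then show "E (a * SA p (n * m)) = E (a * (n * SA p m))"
      using p by (simp add: SA_adj mult.assoc)
  qed
qed

text \<open>The indices are transposed: \<open>SA\<close> acts on the dual basis, and
  \<open>S j p\<close> has to be the coefficient of \<open>h_p\<close> in the antipode of
  \<open>h_j\<close>.\<close>

definition "S j p = coef (SA p) j"

lemma SA_S: "p < d \<Longrightarrow> SA p m = (\<Sum>j<d. S j p \<cdot> R j m)"
  unfolding S_def by (rule coef[OF SA_bimod])

text \<open>\<open>E (R q a) = E (a * SA q 1)\<close> and \<open>SA q 1\<close> is a scalar; the
  case \<open>a = 1\<close>, where \<open>E 1\<close> is nonzero, identifies it with
  \<open>u q\<close>.\<close>

lemma E_R:
  assumes q: "q < d" shows "E (R q a) = u q \<cdot> E a"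
proof -
  have E_Rs: "E (R q a) = scal (SA q 1) \<cdot> E a" for a
  proof -
    have "E (R q a) = E (a * SA q 1)" using SA_adj[OF q, of a 1] by simp
    also have "SA q 1 = scal (SA q 1) \<cdot> 1" by (rule scal_bimod[OF SA_bimod[OF q]])
    finally show ?thesis using E_scale[of "scal (SA q 1)" a] by (simp only: mult_sm mult_1_right)
  qed
  have "(u q * \<epsilon>) \<cdot> 1 = (scal (SA q 1) * \<epsilon>) \<cdot> 1"
    using E_Rs[of 1] q by (simp add: R_one E_scale E_one)
  then have "u q = scal (SA q 1)" using \<epsilon> by (simp add: sm_one_inj)
  then show ?thesis using E_Rs by simp
qed

section \<open>Hopf algebra axioms\<close>

text \<open>Both sides are the coefficients of \<open>R q (v * w * z)\<close>. The other bialgebra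
  axioms below arise likewise, by expanding one map in two ways and comparing coefficients.\<close>

lemma mult_assoc:
  assumes "i < d" "j < d" "l < d" and q: "q < d"
  shows "(\<Sum>p<d. C i j p * C p l q) = (\<Sum>p<d. C j l p * C i p q)"
proof (rule scalar_unique3[where a = "\<lambda>i j l. \<Sum>p<d. C i j p * C p l q"
      and b = "\<lambda>i j l. \<Sum>p<d. C j l p * C i p q", OF _ assms(1-3)])
  fix v w z
  have "(\<Sum>i<d. \<Sum>j<d. \<Sum>l<d. (\<Sum>p<d. C i j p * C p l q) \<cdot> (R i v * (R j w * R l z)))
      = (\<Sum>i<d. \<Sum>j<d. \<Sum>l<d. \<Sum>p<d. (C i j p * C p l q) \<cdot> (R i v * (R j w * R l z)))"
    by (simp only: sm_sum_left)
  also have "\<dots> = (\<Sum>i<d. \<Sum>j<d. \<Sum>p<d. \<Sum>l<d. (C i j p * C p l q) \<cdot> (R i v * (R j w * R l z)))"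
    by (rule sum.cong[OF refl], rule sum.cong[OF refl], rule sum.swap)
  also have "\<dots> = (\<Sum>i<d. \<Sum>p<d. \<Sum>j<d. \<Sum>l<d. (C i j p * C p l q) \<cdot> (R i v * (R j w * R l z)))"
    by (rule sum.cong[OF refl], rule sum.swap)
  also have "\<dots> = (\<Sum>p<d. \<Sum>i<d. \<Sum>j<d. \<Sum>l<d. (C i j p * C p l q) \<cdot> (R i v * (R j w * R l z)))"
    by (rule sum.swap)
  also have "\<dots> = (\<Sum>p<d. \<Sum>i<d. \<Sum>l<d. \<Sum>j<d. (C i j p * C p l q) \<cdot> (R i v * (R j w * R l z)))"
    by (rule sum.cong[OF refl], rule sum.cong[OF refl], rule sum.swap)
  also have "\<dots> = (\<Sum>p<d. \<Sum>l<d. \<Sum>i<d. \<Sum>j<d. (C i j p * C p l q) \<cdot> (R i v * (R j w * R l z)))"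
    by (rule sum.cong[OF refl], rule sum.swap)
  also have "\<dots> = (\<Sum>p<d. \<Sum>l<d. C p l q \<cdot> (R p (v * w) * R l z))"
    by (intro sum.cong refl) (simp add: R_mult[of _ v w] sum_distrib_right sm_sum_right mult.assoc mult.commute[of "C _ _ q"])
  also have "\<dots> = R q (v * w * z)" by (simp only: R_mult[OF q])
  also have "\<dots> = R q (v * (w * z))" by (simp only: mult.assoc)
  also have "\<dots> = (\<Sum>i<d. \<Sum>p<d. C i p q \<cdot> (R i v * R p (w * z)))" by (simp only: R_mult[OF q])
  also have "\<dots> = (\<Sum>i<d. \<Sum>p<d. \<Sum>j<d. \<Sum>l<d. (C j l p * C i p q) \<cdot> (R i v * (R j w * R l z)))"
    by (intro sum.cong refl) (simp add: R_mult[of _ w z] sum_distrib_left sm_sum_right mult.assoc mult.commute[of "C _ _ q"])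
  also have "\<dots> = (\<Sum>i<d. \<Sum>j<d. \<Sum>p<d. \<Sum>l<d. (C j l p * C i p q) \<cdot> (R i v * (R j w * R l z)))"
    by (rule sum.cong[OF refl], rule sum.swap)
  also have "\<dots> = (\<Sum>i<d. \<Sum>j<d. \<Sum>l<d. \<Sum>p<d. (C j l p * C i p q) \<cdot> (R i v * (R j w * R l z)))"
    by (rule sum.cong[OF refl], rule sum.cong[OF refl], rule sum.swap)
  finally show "(\<Sum>i<d. \<Sum>j<d. \<Sum>l<d. (\<Sum>p<d. C i j p * C p l q) \<cdot> (R i v * (R j w * R l z)))
    = (\<Sum>i<d. \<Sum>j<d. \<Sum>l<d. (\<Sum>p<d. C j l p * C i p q) \<cdot> (R i v * (R j w * R l z)))"
    by (simp only: sm_sum_left)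
qed

lemma sum_delta:
  assumes "q < d"
  shows "(\<Sum>j<d. (if j = q then 1 else 0) \<cdot> R j w) = R q w"
proof -
  have "(\<Sum>j<d. (if j = q then 1 else 0) \<cdot> R j w) = (\<Sum>j<d. if j = q then R j w else 0)"
    by (rule sum.cong) auto
  then show ?thesis using assms by simp
qed

lemma unit_left:
  assumes "j < d" and q: "q < d"
  shows "(\<Sum>i<d. u i * C i j q) = (if j = q then 1 else 0)"
proof (rule scalar_unique[where a = "\<lambda>j. \<Sum>i<d. u i * C i j q", OF _ assms(1)])
  fix w
  have "(\<Sum>j<d. (\<Sum>i<d. u i * C i j q) \<cdot> R j w) = (\<Sum>i<d. \<Sum>j<d. C i j q \<cdot> (R i 1 * R j w))"
    by (subst sum.swap) (simp add: sm_sum_left R_one mult.commute)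
  also have "\<dots> = R q w" using R_mult[OF q, of 1 w] by simp
  finally show "(\<Sum>j<d. (\<Sum>i<d. u i * C i j q) \<cdot> R j w) = (\<Sum>j<d. (if j = q then 1 else 0) \<cdot> R j w)"
    by (simp add: sum_delta q)
qed

lemma unit_right:
  assumes "j < d" and q: "q < d"
  shows "(\<Sum>i<d. u i * C j i q) = (if j = q then 1 else 0)"
proof (rule scalar_unique[where a = "\<lambda>j. \<Sum>i<d. u i * C j i q", OF _ assms(1)])
  fix w
  have "(\<Sum>j<d. (\<Sum>i<d. u i * C j i q) \<cdot> R j w) = (\<Sum>j<d. \<Sum>i<d. C j i q \<cdot> (R j w * R i 1))"
    by (simp add: sm_sum_left R_one mult.commute)
  also have "\<dots> = R q w" using R_mult[OF q, of w 1] by simp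
  finally show "(\<Sum>j<d. (\<Sum>i<d. u i * C j i q) \<cdot> R j w) = (\<Sum>j<d. (if j = q then 1 else 0) \<cdot> R j w)"
    by (simp add: sum_delta q)
qed

lemma coassoc:
  assumes "i < d" and lt: "a < d" "b < d" "l < d"
  shows "(\<Sum>j<d. D i j l * D j a b) = (\<Sum>p<d. D i a p * D p b l)"
proof (rule scalar_unique[where a = "\<lambda>i. \<Sum>j<d. D i j l * D j a b", OF _ assms(1)])
  fix m
  have "(\<Sum>i<d. (\<Sum>j<d. D i j l * D j a b) \<cdot> R i m) = (\<Sum>j<d. D j a b \<cdot> R j (R l m))"
    unfolding sm_sum_left by (subst sum.swap) (simp add: R_R lt sm_sum_right mult.commute)
  also have "\<dots> = R a (R b (R l m))" by (simp add: R_R[of a b] lt)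
  also have "\<dots> = (\<Sum>p<d. D p b l \<cdot> R a (R p m))" by (simp add: R_R[of b l] R_sum R_scale lt)
  also have "\<dots> = (\<Sum>i<d. (\<Sum>p<d. D i a p * D p b l) \<cdot> R i m)"
    unfolding sm_sum_left by (subst sum.swap) (simp add: R_R lt sm_sum_right mult.commute)
  finally show "(\<Sum>i<d. (\<Sum>j<d. D i j l * D j a b) \<cdot> R i m) = (\<Sum>i<d. (\<Sum>p<d. D i a p * D p b l) \<cdot> R i m)" .
qed

lemma counit_left:
  assumes "i < d" and l: "l < d"
  shows "(\<Sum>j<d. e j * D i j l) = (if i = l then 1 else 0)"
proof (rule scalar_unique[where a = "\<lambda>i. \<Sum>j<d. e j * D i j l", OF _ assms(1)])
  fix w
  have "(\<Sum>i<d. (\<Sum>j<d. e j * D i j l) \<cdot> R i w) = (\<Sum>j<d. e j \<cdot> R j (R l w))"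
    by (simp add: sm_sum_left R_R l sm_sum_right) (rule sum.swap)
  then show "(\<Sum>i<d. (\<Sum>j<d. e j * D i j l) \<cdot> R i w) = (\<Sum>i<d. (if i = l then 1 else 0) \<cdot> R i w)"
    by (simp add: counit sum_delta l)
qed

lemma counit_right:
  assumes "i < d" and j: "j < d"
  shows "(\<Sum>l<d. e l * D i j l) = (if i = j then 1 else 0)"
proof (rule scalar_unique[where a = "\<lambda>i. \<Sum>l<d. e l * D i j l", OF _ assms(1)])
  fix w
  have "(\<Sum>i<d. (\<Sum>l<d. e l * D i j l) \<cdot> R i w) = (\<Sum>l<d. e l \<cdot> R j (R l w))"
    by (simp add: sm_sum_left R_R j sm_sum_right) (rule sum.swap)
  also have "\<dots> = R j (\<Sum>l<d. e l \<cdot> R l w)" by (simp add: R_sum R_scale j)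
  finally show "(\<Sum>i<d. (\<Sum>l<d. e l * D i j l) \<cdot> R i w) = (\<Sum>i<d. (if i = j then 1 else 0) \<cdot> R i w)"
    by (simp add: counit sum_delta j)
qed

text \<open>Compare the coefficients of \<open>R a (R b (v * w))\<close>: either compose first and
  then expand the product, or expand the product under each map in turn.\<close>

lemma mult_comult:
  assumes "i < d" "j < d" and ab: "a < d" "b < d"
  shows "(\<Sum>p<d. C i j p * D p a b) =
      (\<Sum>a1<d. \<Sum>b1<d. \<Sum>a2<d. \<Sum>b2<d. D i a1 b1 * D j a2 b2 * C a1 a2 a * C b1 b2 b)"
proof (rule scalar_unique2[where a = "\<lambda>i j. \<Sum>p<d. C i j p * D p a b" and
      b = "\<lambda>i j. \<Sum>a1<d. \<Sum>b1<d. \<Sum>a2<d. \<Sum>b2<d. D i a1 b1 * D j a2 b2 * C a1 a2 a * C b1 b2 b", OF _ assms(1,2)])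
  fix v w
  let ?t = "\<lambda>i j a1 b1 a2 b2. (D i a1 b1 * D j a2 b2 * C a1 a2 a * C b1 b2 b) \<cdot> (R i v * R j w)"
  have "(\<Sum>i<d. \<Sum>j<d. (\<Sum>p<d. C i j p * D p a b) \<cdot> (R i v * R j w))
     = (\<Sum>i<d. \<Sum>j<d. \<Sum>p<d. (C i j p * D p a b) \<cdot> (R i v * R j w))" by (simp only: sm_sum_left)
  also have "\<dots> = (\<Sum>i<d. \<Sum>p<d. \<Sum>j<d. (C i j p * D p a b) \<cdot> (R i v * R j w))"
    by (rule sum.cong[OF refl], rule sum.swap)
  also have "\<dots> = (\<Sum>p<d. \<Sum>i<d. \<Sum>j<d. (C i j p * D p a b) \<cdot> (R i v * R j w))" by (rule sum.swap)
  also have "\<dots> = (\<Sum>p<d. D p a b \<cdot> R p (v * w))"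
    by (simp add: R_mult sm_sum_right mult.commute)
  also have "\<dots> = R a (R b (v * w))" by (simp add: R_R ab)
  also have "\<dots> = (\<Sum>b1<d. \<Sum>b2<d. C b1 b2 b \<cdot> R a (R b1 v * R b2 w))"
    by (simp add: R_mult[OF ab(2)] R_sum R_scale ab)
  also have "\<dots> = (\<Sum>b1<d. \<Sum>b2<d. \<Sum>a1<d. \<Sum>a2<d. (C b1 b2 b * C a1 a2 a) \<cdot> (R a1 (R b1 v) * R a2 (R b2 w)))"
    by (simp add: R_mult[OF ab(1)] sm_sum_right)
  also have "\<dots> = (\<Sum>b1<d. \<Sum>b2<d. \<Sum>a1<d. \<Sum>a2<d. \<Sum>i<d. \<Sum>j<d. ?t i j a1 b1 a2 b2)"
    by (intro sum.cong refl) (simp add: R_R sum_product sm_sum_right mult_ac)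
  also have "\<dots> = (\<Sum>b1<d. \<Sum>b2<d. \<Sum>a1<d. \<Sum>i<d. \<Sum>a2<d. \<Sum>j<d. ?t i j a1 b1 a2 b2)"
    by (rule sum.cong[OF refl], rule sum.cong[OF refl], rule sum.cong[OF refl], rule sum.swap)
  also have "\<dots> = (\<Sum>b1<d. \<Sum>b2<d. \<Sum>i<d. \<Sum>a1<d. \<Sum>a2<d. \<Sum>j<d. ?t i j a1 b1 a2 b2)"
    by (rule sum.cong[OF refl], rule sum.cong[OF refl], rule sum.swap)
  also have "\<dots> = (\<Sum>b1<d. \<Sum>i<d. \<Sum>b2<d. \<Sum>a1<d. \<Sum>a2<d. \<Sum>j<d. ?t i j a1 b1 a2 b2)"
    by (rule sum.cong[OF refl], rule sum.swap)
  also have "\<dots> = (\<Sum>i<d. \<Sum>b1<d. \<Sum>b2<d. \<Sum>a1<d. \<Sum>a2<d. \<Sum>j<d. ?t i j a1 b1 a2 b2)"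
    by (rule sum.swap)
  also have "\<dots> = (\<Sum>i<d. \<Sum>b1<d. \<Sum>b2<d. \<Sum>a1<d. \<Sum>j<d. \<Sum>a2<d. ?t i j a1 b1 a2 b2)"
    by (rule sum.cong[OF refl], rule sum.cong[OF refl], rule sum.cong[OF refl], rule sum.cong[OF refl], rule sum.swap)
  also have "\<dots> = (\<Sum>i<d. \<Sum>b1<d. \<Sum>b2<d. \<Sum>j<d. \<Sum>a1<d. \<Sum>a2<d. ?t i j a1 b1 a2 b2)"
    by (rule sum.cong[OF refl], rule sum.cong[OF refl], rule sum.cong[OF refl], rule sum.swap)
  also have "\<dots> = (\<Sum>i<d. \<Sum>b1<d. \<Sum>j<d. \<Sum>b2<d. \<Sum>a1<d. \<Sum>a2<d. ?t i j a1 b1 a2 b2)"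
    by (rule sum.cong[OF refl], rule sum.cong[OF refl], rule sum.swap)
  also have "\<dots> = (\<Sum>i<d. \<Sum>j<d. \<Sum>b1<d. \<Sum>b2<d. \<Sum>a1<d. \<Sum>a2<d. ?t i j a1 b1 a2 b2)"
    by (rule sum.cong[OF refl], rule sum.swap)
  also have "\<dots> = (\<Sum>i<d. \<Sum>j<d. \<Sum>b1<d. \<Sum>a1<d. \<Sum>b2<d. \<Sum>a2<d. ?t i j a1 b1 a2 b2)"
    by (rule sum.cong[OF refl], rule sum.cong[OF refl], rule sum.cong[OF refl], rule sum.swap)
  also have "\<dots> = (\<Sum>i<d. \<Sum>j<d. \<Sum>a1<d. \<Sum>b1<d. \<Sum>b2<d. \<Sum>a2<d. ?t i j a1 b1 a2 b2)"
    by (rule sum.cong[OF refl], rule sum.cong[OF refl], rule sum.swap)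
  also have "\<dots> = (\<Sum>i<d. \<Sum>j<d. \<Sum>a1<d. \<Sum>b1<d. \<Sum>a2<d. \<Sum>b2<d. ?t i j a1 b1 a2 b2)"
    by (rule sum.cong[OF refl], rule sum.cong[OF refl], rule sum.cong[OF refl], rule sum.cong[OF refl], rule sum.swap)
  finally show "(\<Sum>i<d. \<Sum>j<d. (\<Sum>p<d. C i j p * D p a b) \<cdot> (R i v * R j w))
      = (\<Sum>i<d. \<Sum>j<d. (\<Sum>a1<d. \<Sum>b1<d. \<Sum>a2<d. \<Sum>b2<d. D i a1 b1 * D j a2 b2 * C a1 a2 a * C b1 b2 b) \<cdot> (R i v * R j w))"
    by (simp only: sm_sum_left)
qed

lemma comult_unit:
  assumes ab: "a < d" "b < d"
  shows "(\<Sum>i<d. u i * D i a b) = u a * u b"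
proof -
  have "(\<Sum>i<d. u i * D i a b) \<cdot> 1 = R a (R b 1)"
    unfolding R_R[OF ab] by (simp add: R_one sm_sum_left mult.commute)
  also have "\<dots> = (u a * u b) \<cdot> 1" using ab by (simp add: R_one R_scale mult.commute)
  finally show ?thesis by (simp add: sm_one_inj)
qed

lemma counit_mult:
  assumes "i < d" "j < d"
  shows "(\<Sum>p<d. C i j p * e p) = e i * e j"
proof (rule scalar_unique2[where a = "\<lambda>i j. \<Sum>p<d. C i j p * e p" and b = "\<lambda>i j. e i * e j", OF _ assms])
  fix v w
  have "(\<Sum>i<d. \<Sum>j<d. (\<Sum>p<d. C i j p * e p) \<cdot> (R i v * R j w))
     = (\<Sum>i<d. \<Sum>j<d. \<Sum>p<d. (C i j p * e p) \<cdot> (R i v * R j w))" by (simp only: sm_sum_left)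
  also have "\<dots> = (\<Sum>i<d. \<Sum>p<d. \<Sum>j<d. (C i j p * e p) \<cdot> (R i v * R j w))"
    by (rule sum.cong[OF refl], rule sum.swap)
  also have "\<dots> = (\<Sum>p<d. \<Sum>i<d. \<Sum>j<d. (C i j p * e p) \<cdot> (R i v * R j w))" by (rule sum.swap)
  also have "\<dots> = (\<Sum>p<d. e p \<cdot> R p (v * w))"
    by (simp add: R_mult sm_sum_right mult.commute)
  also have "\<dots> = (\<Sum>i<d. e i \<cdot> R i v) * (\<Sum>j<d. e j \<cdot> R j w)" by (simp only: counit)
  also have "\<dots> = (\<Sum>i<d. \<Sum>j<d. (e i * e j) \<cdot> (R i v * R j w))"
    by (simp add: sum_product mult.commute)
  finally show "(\<Sum>i<d. \<Sum>j<d. (\<Sum>p<d. C i j p * e p) \<cdot> (R i v * R j w))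
    = (\<Sum>i<d. \<Sum>j<d. (e i * e j) \<cdot> (R i v * R j w))" .
qed

lemma counit_unit: "(\<Sum>i<d. u i * e i) = 1"
proof -
  have "(\<Sum>i<d. u i * e i) \<cdot> 1 = (\<Sum>i<d. e i \<cdot> R i 1)"
    by (simp add: R_one sm_sum_left mult.commute)
  also have "\<dots> = 1 \<cdot> 1" by (simp add: counit)
  finally show ?thesis by (simp only: sm_one_inj)
qed

text \<open>This is \<open>S(a_1) a_2 = \<epsilon>(a)\<close> in the dual, with its counit on the
  right. Tested under \<open>E (a * _)\<close>, adjointness turns the left side into
  \<open>E (R q (a * m))\<close>, and \<open>E_R\<close> evaluates it.\<close>

lemma antipode_left:
  assumes "i < d" and q: "q < d"
  shows "(\<Sum>j<d. \<Sum>l<d. \<Sum>p<d. D i j l * S j p * C p l q) = e i * u q"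
proof (rule scalar_unique[where a = "\<lambda>i. \<Sum>j<d. \<Sum>l<d. \<Sum>p<d. D i j l * S j p * C p l q"
      and b = "\<lambda>i. e i * u q", OF _ assms(1)])
  fix m
  have eq: "(\<Sum>p<d. \<Sum>l<d. C p l q \<cdot> SA p (R l m)) = u q \<cdot> m"
  proof (rule E_nondeg_left)
    fix a
    have "E (a * (\<Sum>p<d. \<Sum>l<d. C p l q \<cdot> SA p (R l m))) = (\<Sum>p<d. \<Sum>l<d. C p l q \<cdot> E (R p a * R l m))"
      by (simp add: sum_distrib_left E_sum E_scale SA_adj)
    also have "\<dots> = E (R q (a * m))" by (simp add: R_mult q E_sum E_scale)
    also have "\<dots> = E (a * (u q \<cdot> m))" by (simp add: E_R q E_scale)
    finally show "E (a * (\<Sum>p<d. \<Sum>l<d. C p l q \<cdot> SA p (R l m))) = E (a * (u q \<cdot> m))" .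
  qed
  have "(\<Sum>i<d. (\<Sum>j<d. \<Sum>l<d. \<Sum>p<d. D i j l * S j p * C p l q) \<cdot> R i m)
      = (\<Sum>i<d. \<Sum>j<d. \<Sum>l<d. \<Sum>p<d. (D i j l * S j p * C p l q) \<cdot> R i m)" by (simp only: sm_sum_left)
  also have "\<dots> = (\<Sum>j<d. \<Sum>i<d. \<Sum>l<d. \<Sum>p<d. (D i j l * S j p * C p l q) \<cdot> R i m)" by (rule sum.swap)
  also have "\<dots> = (\<Sum>j<d. \<Sum>l<d. \<Sum>i<d. \<Sum>p<d. (D i j l * S j p * C p l q) \<cdot> R i m)"
    by (rule sum.cong[OF refl], rule sum.swap)
  also have "\<dots> = (\<Sum>j<d. \<Sum>l<d. \<Sum>p<d. \<Sum>i<d. (D i j l * S j p * C p l q) \<cdot> R i m)"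
    by (rule sum.cong[OF refl], rule sum.cong[OF refl], rule sum.swap)
  also have "\<dots> = (\<Sum>j<d. \<Sum>l<d. \<Sum>p<d. (C p l q * S j p) \<cdot> R j (R l m))"
    by (intro sum.cong refl) (simp add: R_R sm_sum_right mult_ac)
  also have "\<dots> = (\<Sum>j<d. \<Sum>p<d. \<Sum>l<d. (C p l q * S j p) \<cdot> R j (R l m))"
    by (rule sum.cong[OF refl], rule sum.swap)
  also have "\<dots> = (\<Sum>p<d. \<Sum>j<d. \<Sum>l<d. (C p l q * S j p) \<cdot> R j (R l m))" by (rule sum.swap)
  also have "\<dots> = (\<Sum>p<d. \<Sum>l<d. \<Sum>j<d. (C p l q * S j p) \<cdot> R j (R l m))"
    by (rule sum.cong[OF refl], rule sum.swap)
  also have "\<dots> = (\<Sum>p<d. \<Sum>l<d. C p l q \<cdot> SA p (R l m))"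
    by (intro sum.cong refl) (simp add: SA_S sm_sum_right)
  also have "\<dots> = u q \<cdot> (\<Sum>i<d. e i \<cdot> R i m)" by (simp only: eq counit)
  finally show "(\<Sum>i<d. (\<Sum>j<d. \<Sum>l<d. \<Sum>p<d. D i j l * S j p * C p l q) \<cdot> R i m) = (\<Sum>i<d. (e i * u q) \<cdot> R i m)"
    by (simp add: sm_sum_right mult.commute)
qed

lemma antipode_right:
  assumes "i < d" "q < d"
  shows "(\<Sum>j<d. \<Sum>l<d. \<Sum>p<d. D i j l * S l p * C j p q) = e i * u q"
  using left_antipode_imp_right[OF mult_assoc unit_left unit_right coassoc counit_left counit_right antipode_left assms] .

lemma hopf: "hopf_alg d C u D e"
  unfolding hopf_alg_def
  using mult_assoc unit_left unit_right coassoc counit_left counit_right mult_comult comult_unit counit_mult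
    counit_unit antipode_left antipode_right
  by (intro conjI allI impI exI[of _ S]) simp_all

lemma comodule: "comodule_alg d C u D e \<iota> R"
  unfolding comodule_alg_def mult_io sm_def[symmetric]
  by (intro conjI allI impI R_add R_scale R_R counit R_mult) (simp_all add: R_one io_sm)

section \<open>Coinvariants and the Galois map\<close>

text \<open>For a coinvariant \<open>b\<close>, expanding \<open>E\<close> in the \<open>R i\<close>
  gives \<open>E b = E 1 * b\<close>; since \<open>E 1\<close> is an invertible scalar and
  \<open>E b\<close> lies in \<open>N\<close>, so does \<open>b\<close>.\<close>

lemma N_eq_coinv: "N = coinv d u \<iota> R"
proof (intro equalityI subsetI)
  fix b assume b: "b \<in> N"
  have "R q b = u q \<cdot> b" if "q < d" for q
    using R_right[OF that b, of 1] that by (simp add: R_one)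
  then show "b \<in> coinv d u \<iota> R" by (simp add: coinv_def sm_def)
next
  fix b assume "b \<in> coinv d u \<iota> R"
  then have b: "R q b = u q \<cdot> b" if "q < d" for q using that by (simp add: coinv_def sm_def)
  have Ec: "E m = (\<Sum>i<d. coef E i \<cdot> R i m)" for m by (rule coef[OF bimod_E])
  have "E b = E 1 * b"
    unfolding Ec[of b] Ec[of 1] sum_distrib_right by (intro sum.cong refl) (simp add: b R_one)
  also have "\<dots> = \<epsilon> \<cdot> b" by (simp add: E_one)
  finally have "inverse \<epsilon> \<cdot> E b = b" using \<epsilon> by simp
  moreover have "\<iota> (inverse \<epsilon>) * E b \<in> N"
    using subalg io_in_N E_N by (auto simp: subalg_def)
  ultimately show "b \<in> N" by (simp add: sm_def)
qed

text \<open>Apply \<open>R q\<close> to \<open>m = (\<Sum>i. E (m * x i) * y i)\<close>, expand by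
  \<open>E_mult\<close> and compare the coefficients of \<open>R p m\<close>. This makes a preimage
  of \<open>1 \<otimes> h_p\<close> under the Galois map explicit.\<close>

lemma gamma_dual:
  assumes "p < d" "q < d"
  shows "(\<Sum>i<n0. (\<Sum>j<d. \<gamma> p j \<cdot> R j (x i)) * R q (y i)) = (if p = q then 1 else 0)"
proof (rule right_unique[where a = "\<lambda>p. \<Sum>i<n0. (\<Sum>j<d. \<gamma> p j \<cdot> R j (x i)) * R q (y i)"
      and b = "\<lambda>p. if p = q then 1 else 0", OF _ assms(1)])
  fix m
  have "(\<Sum>p<d. R p m * (\<Sum>i<n0. (\<Sum>j<d. \<gamma> p j \<cdot> R j (x i)) * R q (y i)))
      = (\<Sum>i<n0. \<Sum>p<d. (\<Sum>j<d. \<gamma> p j \<cdot> (R p m * R j (x i))) * R q (y i))"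
    by (subst sum.swap) (simp add: sum_distrib_left sum_distrib_right mult.assoc)
  also have "\<dots> = (\<Sum>i<n0. E (m * x i) * R q (y i))"
    by (simp add: E_mult sum_distrib_right)
  also have "\<dots> = R q (\<Sum>i<n0. E (m * x i) * y i)"
    using assms(2) by (simp add: R_sum R_left E_N)
  also have "\<dots> = (\<Sum>p<d. R p m * (if p = q then 1 else 0))" using assms(2) by (simp add: dual_left)
  finally show "(\<Sum>p<d. R p m * (\<Sum>i<n0. (\<Sum>j<d. \<gamma> p j \<cdot> R j (x i)) * R q (y i)))
      = (\<Sum>p<d. R p m * (if p = q then 1 else 0))" .
qed

lemma tens_rel_add:
  assumes "f \<in> tens_rel \<iota> N" "g \<in> tens_rel \<iota> N"
  shows "(\<lambda>p. f p + c * g p) \<in> tens_rel \<iota> N"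
  using assms(2)
proof (induct arbitrary: c)
  case zero
  then show ?case using assms(1) by simp
next
  case (step f' g c')
  have "(\<lambda>p. (f p + c * f' p) + (c * c') * g p) \<in> tens_rel \<iota> N"
    by (rule tens_rel.step) (use step in auto)
  then show ?case by (simp add: distrib_left mult.assoc add.assoc)
qed

lemma tens_rel_gen: "g \<in> tens_gens \<iota> N \<Longrightarrow> g \<in> tens_rel \<iota> N"
  using tens_rel.step[OF tens_rel.zero, of g \<iota> N 1] by simp

lemma tens_rel_sum:
  assumes "\<And>k. k \<in> K \<Longrightarrow> f k \<in> tens_rel \<iota> N"
  shows "(\<lambda>p. \<Sum>k\<in>K. c k * f k p) \<in> tens_rel \<iota> N"
  using assms
proof (induct K rule: infinite_finite_induct)
  case (insert k K)
  have "(\<lambda>p. (\<Sum>k\<in>K. c k * f k p) + c k * f k p) \<in> tens_rel \<iota> N"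
    by (rule tens_rel_add) (use insert in auto)
  then show ?case using insert by (simp add: add.commute)
qed (auto intro: tens_rel.zero)

definition teq :: "('m \<times> 'm \<Rightarrow> 'k) \<Rightarrow> ('m \<times> 'm \<Rightarrow> 'k) \<Rightarrow> bool" where
  "teq f g \<longleftrightarrow> (\<lambda>p. f p - g p) \<in> tens_rel \<iota> N"

lemma teq_trans: "teq f g \<Longrightarrow> teq g h \<Longrightarrow> teq f h"
  unfolding teq_def by (drule tens_rel_add[where c = 1], assumption) simp

lemma teq_sym: "teq f g \<Longrightarrow> teq g f"
  unfolding teq_def by (drule tens_rel_add[OF tens_rel.zero, where c = "-1"]) simp

lemma teq_sum:
  assumes "\<And>k. k \<in> K \<Longrightarrow> teq (f k) (g k)"
  shows "teq (\<lambda>p. \<Sum>k\<in>K. c k * f k p) (\<lambda>p. \<Sum>k\<in>K. c k * g k p)"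
proof -
  have "(\<lambda>p. \<Sum>k\<in>K. c k * (f k p - g k p)) \<in> tens_rel \<iota> N"
    by (rule tens_rel_sum) (use assms in \<open>simp add: teq_def\<close>)
  then show ?thesis by (simp add: teq_def right_diff_distrib sum_subtractf)
qed

lemma teq_sum1:
  assumes "\<And>k. k \<in> K \<Longrightarrow> teq (f k) (g k)"
  shows "teq (\<lambda>p. \<Sum>k\<in>K. f k p) (\<lambda>p. \<Sum>k\<in>K. g k p)"
  using teq_sum[OF assms, where c = "\<lambda>_. 1"] by simp

lemma teq_add_left: "teq (dlt (a + a') b) (\<lambda>p. dlt a b p + dlt a' b p)"
proof -
  have "(\<lambda>p. dlt (a + a') b p - dlt a b p - dlt a' b p) \<in> tens_gens \<iota> N"
    unfolding tens_gens_def by blast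
  from tens_rel_gen[OF this] show ?thesis by (simp add: teq_def diff_diff_eq)
qed

lemma teq_add_right: "teq (dlt a (b + b')) (\<lambda>p. dlt a b p + dlt a b' p)"
proof -
  have "(\<lambda>p. dlt a (b + b') p - dlt a b p - dlt a b' p) \<in> tens_gens \<iota> N"
    unfolding tens_gens_def by blast
  from tens_rel_gen[OF this] show ?thesis by (simp add: teq_def diff_diff_eq)
qed

lemma teq_move: "n \<in> N \<Longrightarrow> teq (dlt (a * n) b) (dlt a (n * b))"
  unfolding teq_def by (rule tens_rel_gen) (unfold tens_gens_def, blast)

lemma teq_scale: "teq (dlt (c \<cdot> a) b) (\<lambda>p. c * dlt a b p)"
  unfolding teq_def sm_def by (rule tens_rel_gen) (unfold tens_gens_def, blast)

lemma teq_zero_left: "teq (dlt 0 b) (\<lambda>_. 0)"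
  using teq_scale[of 0 0 b] by simp

lemma teq_zero_right: "teq (dlt a 0) (\<lambda>_. 0)"
  using teq_sym[OF teq_add_right[of a 0 0]] by (simp add: teq_def)

lemma teq_sum_left:
  assumes "finite K" shows "teq (dlt (\<Sum>k\<in>K. h k) b) (\<lambda>p. \<Sum>k\<in>K. dlt (h k) b p)"
  using assms
proof induct
  case (insert k K)
  have "teq (\<lambda>p. dlt (h k) b p + dlt (\<Sum>k\<in>K. h k) b p) (\<lambda>p. dlt (h k) b p + (\<Sum>k\<in>K. dlt (h k) b p))"
    using insert by (simp add: teq_def)
  from teq_trans[OF teq_add_left this] show ?case using insert by simp
qed (simp add: teq_zero_left)

lemma teq_sum_right:
  assumes "finite K" shows "teq (dlt a (\<Sum>k\<in>K. h k)) (\<lambda>p. \<Sum>k\<in>K. dlt a (h k) p)"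
  using assms
proof induct
  case (insert k K)
  have "teq (\<lambda>p. dlt a (h k) p + dlt a (\<Sum>k\<in>K. h k) p) (\<lambda>p. dlt a (h k) p + (\<Sum>k\<in>K. dlt a (h k) p))"
    using insert by (simp add: teq_def)
  from teq_trans[OF teq_add_right this] show ?case using insert by simp
qed (simp add: teq_zero_right)

text \<open>In the tensor product \<open>a \<otimes> b = \<Sum>i. a E(b x_i) \<otimes> y_i\<close>.
  The left \<open>N\<close>-linear map \<open>b \<mapsto> E (b * x i)\<close> is a right
  \<open>M\<close>-combination of the \<open>R q\<close>, so the left legs vanish once the Galois
  image does.\<close>

lemma galois_injective:
  assumes fin: "finite {p. f p \<noteq> 0}" and z: "\<And>q. q < d \<Longrightarrow> galois_map \<iota> R f q = 0"
  shows "f \<in> tens_rel \<iota> N"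
proof -
  let ?K = "{p. f p \<noteq> 0}"
  have zf: "(\<Sum>s\<in>?K. f s \<cdot> (fst s * E (snd s * x i))) = 0" for i
  proof -
    have "\<exists>c. \<forall>m. E (m * x i) = (\<Sum>q<d. R q m * c q)"
      by (rule R_gen) (simp add: distrib_right E_add mult.assoc E_left)
    then obtain c where c: "\<forall>m. E (m * x i) = (\<Sum>q<d. R q m * c q)" by (rule exE)
    have "(\<Sum>s\<in>?K. f s \<cdot> (fst s * E (snd s * x i))) = (\<Sum>q<d. \<Sum>s\<in>?K. f s \<cdot> (fst s * R q (snd s)) * c q)"
      by (subst sum.swap) (simp add: c sum_distrib_left sm_sum_right mult.assoc)
    also have "\<dots> = (\<Sum>q<d. galois_map \<iota> R f q * c q)"
      by (simp add: galois_map_eq_lin lin_def sum_distrib_right)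
    finally show ?thesis by (simp add: z)
  qed
  have "f = (\<lambda>p. \<Sum>s\<in>?K. f s * dlt (fst s) (snd s) p)"
  proof
    fix p
    have "(\<Sum>s\<in>?K. f s * dlt (fst s) (snd s) p) = (\<Sum>s\<in>?K. if s = p then f s else 0)"
      by (rule sum.cong) (auto simp: dlt_def)
    then show "f p = (\<Sum>s\<in>?K. f s * dlt (fst s) (snd s) p)" using fin by simp
  qed
  moreover have "teq (\<lambda>p. \<Sum>s\<in>?K. f s * dlt (fst s) (snd s) p)
      (\<lambda>p. \<Sum>s\<in>?K. f s * (\<Sum>i<n0. dlt (fst s * E (snd s * x i)) (y i) p))"
  proof (rule teq_sum)
    fix s
    have "teq (dlt (fst s) (\<Sum>i<n0. E (snd s * x i) * y i)) (\<lambda>p. \<Sum>i<n0. dlt (fst s) (E (snd s * x i) * y i) p)"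
      by (rule teq_sum_right) simp
    moreover have "teq (\<lambda>p. \<Sum>i<n0. dlt (fst s) (E (snd s * x i) * y i) p)
        (\<lambda>p. \<Sum>i<n0. dlt (fst s * E (snd s * x i)) (y i) p)"
      by (rule teq_sum1, rule teq_sym, rule teq_move, rule E_N)
    ultimately show "teq (dlt (fst s) (snd s)) (\<lambda>p. \<Sum>i<n0. dlt (fst s * E (snd s * x i)) (y i) p)"
      unfolding dual_left by (rule teq_trans)
  qed
  moreover have "(\<lambda>p. \<Sum>s\<in>?K. f s * (\<Sum>i<n0. dlt (fst s * E (snd s * x i)) (y i) p))
      = (\<lambda>p. \<Sum>i<n0. \<Sum>s\<in>?K. f s * dlt (fst s * E (snd s * x i)) (y i) p)"
    by (simp only: sum_distrib_left) (subst sum.swap, rule refl)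
  moreover have "teq (\<lambda>p. \<Sum>i<n0. \<Sum>s\<in>?K. f s * dlt (fst s * E (snd s * x i)) (y i) p) (\<lambda>p. \<Sum>i<n0. dlt 0 (y i) p)"
  proof (rule teq_sum1)
    fix i
    have "teq (dlt (\<Sum>s\<in>?K. f s \<cdot> (fst s * E (snd s * x i))) (y i))
        (\<lambda>p. \<Sum>s\<in>?K. dlt (f s \<cdot> (fst s * E (snd s * x i))) (y i) p)"
      by (rule teq_sum_left[OF fin])
    moreover have "teq (\<lambda>p. \<Sum>s\<in>?K. dlt (f s \<cdot> (fst s * E (snd s * x i))) (y i) p)
        (\<lambda>p. \<Sum>s\<in>?K. f s * dlt (fst s * E (snd s * x i)) (y i) p)"
      by (rule teq_sum1, rule teq_scale)
    ultimately have "teq (dlt 0 (y i)) (\<lambda>p. \<Sum>s\<in>?K. f s * dlt (fst s * E (snd s * x i)) (y i) p)"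
      unfolding zf by (rule teq_trans)
    then show "teq (\<lambda>p. \<Sum>s\<in>?K. f s * dlt (fst s * E (snd s * x i)) (y i) p) (dlt 0 (y i))"
      by (rule teq_sym)
  qed
  moreover have "teq (\<lambda>p. \<Sum>i<n0. dlt 0 (y i) p) (\<lambda>p. \<Sum>i<n0. 0)"
    by (rule teq_sum1, rule teq_zero_left)
  ultimately have "teq f (\<lambda>p. \<Sum>i<n0. 0)" by (metis (no_types, lifting) teq_trans)
  then show ?thesis by (simp add: teq_def)
qed

lemma galois_surjective:
  obtains f where "finite {p. f p \<noteq> 0}" "\<And>q. q < d \<Longrightarrow> galois_map \<iota> R f q = v q"
proof -
  define G where "G p i = (\<Sum>j<d. \<gamma> p j \<cdot> R j (x i))" for p i
  define f :: "'m \<times> 'm \<Rightarrow> 'k"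
    where "f = (\<lambda>r. \<Sum>s\<in>{..<d} \<times> {..<n0}. 1 * dlt (v (fst s) * G (fst s) (snd s)) (y (snd s)) r)"
  have fin: "finite ({..<d} \<times> {..<n0})" by simp
  show thesis
  proof (rule that)
    show "finite {p. f p \<noteq> 0}" unfolding f_def by (rule lin_comb(1)[OF fin]) simp
    fix q assume q: "q < d"
    have "galois_map \<iota> R f q = (\<Sum>s\<in>{..<d} \<times> {..<n0}. v (fst s) * G (fst s) (snd s) * R q (y (snd s)))"
      unfolding galois_map_eq_lin f_def by (subst lin_comb(2)[OF fin]) simp_all
    also have "\<dots> = (\<Sum>p<d. \<Sum>i<n0. v p * G p i * R q (y i))"
      by (simp add: sum.cartesian_product split_beta)
    also have "\<dots> = (\<Sum>p<d. v p * (\<Sum>i<n0. G p i * R q (y i)))"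
      by (simp add: sum_distrib_left mult.assoc)
    also have "\<dots> = (\<Sum>p<d. v p * (if p = q then 1 else 0))"
      by (intro sum.cong refl arg_cong2[where f = times]) (simp add: G_def gamma_dual q)
    finally show "galois_map \<iota> R f q = v q" using q by simp
  qed
qed

lemma galois: "galois d \<iota> N R"
  unfolding galois_def
proof (intro conjI allI impI)
  fix f :: "'m \<times> 'm \<Rightarrow> 'k"
  assume "finite {p. f p \<noteq> 0}" "\<forall>q<d. galois_map \<iota> R f q = 0"
  then show "f \<in> tens_rel \<iota> N" by (intro galois_injective) auto
next
  fix v :: "nat \<Rightarrow> 'm"
  obtain f where "finite {p. f p \<noteq> 0}" "\<And>q. q < d \<Longrightarrow> galois_map \<iota> R f q = v q"
    using that by (rule galois_surjective[where v = v])
  then show "\<exists>f. finite {p. f p \<noteq> 0} \<and> (\<forall>q<d. galois_map \<iota> R f q = v q)" by blast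
qed

section \<open>Semisimplicity from the index\<close>

definition "W p q = scal (\<Sum>i<n0. R p (x i) * R q (y i))"

lemma W:
  assumes "p < d" "q < d"
  shows "(\<Sum>i<n0. R p (x i) * R q (y i)) = W p q \<cdot> 1"
  unfolding W_def
proof (rule scal)
  fix n assume n: "n \<in> N"
  have "(\<Sum>i<n0. R p (n * x i) * R q (y i)) = (\<Sum>i<n0. R p (x i) * R q (y i * n))"
    by (rule casimir[where F = "\<lambda>a b. R p a * R q b"])
      (use assms in \<open>simp_all add: R_add R_left R_right distrib_left distrib_right mult.assoc\<close>)
  then show "(\<Sum>i<n0. R p (x i) * R q (y i)) * n = n * (\<Sum>i<n0. R p (x i) * R q (y i))"
    using assms n by (simp add: R_left R_right sum_distrib_left sum_distrib_right mult.assoc)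
qed

definition "\<mu> = scal (\<Sum>i<n0. x i * y i)"

lemma \<mu>: "(\<Sum>i<n0. x i * y i) = \<mu> \<cdot> 1" "\<mu> \<noteq> 0"
proof -
  show 1: "(\<Sum>i<n0. x i * y i) = \<mu> \<cdot> 1"
    unfolding \<mu>_def
  proof (rule scal)
    fix n
    show "(\<Sum>i<n0. x i * y i) * n = n * (\<Sum>i<n0. x i * y i)"
      using casimir[where F = "\<lambda>a b. a * b", of n]
      by (simp add: distrib_left distrib_right mult.assoc sum_distrib_left sum_distrib_right)
  qed
  show "\<mu> \<noteq> 0" using 1 index by auto
qed

text \<open>\<open>casimir\<close> for \<open>R p a * R m b\<close> says that the element
  \<open>\<Sum> W p q h_p \<otimes> h_q\<close> commutes with \<open>H\<close>; multiplying its legs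
  gives \<open>\<mu>\<close> times the unit.\<close>

lemma semisimple: "semisimple_alg d C"
  unfolding semisimple_alg_def left_ideal_eq_stable
proof (rule complemented_of_separability_element[where c = C and s = "\<lambda>l m. inverse \<mu> * W l m"])
  show "mop d C k (mop d C l v) = (\<lambda>j. \<Sum>p<d. C k l p * mop d C p v j)" if "k < d" "l < d" for k l v
    by (rule mop_mop_alg[OF mult_assoc that])
next
  fix k m p assume k: "k < d" and m: "m < d" and p: "p < d"
  have "(\<Sum>l<d. W l m * C k l p) = (\<Sum>l<d. W p l * C l k m)"
  proof (rule scalar_unique[where a = "\<lambda>k. \<Sum>l<d. W l m * C k l p" and b = "\<lambda>k. \<Sum>l<d. W p l * C l k m", OF _ k])
    fix v
    have "(\<Sum>k<d. (\<Sum>l<d. W l m * C k l p) \<cdot> R k v) = (\<Sum>k<d. \<Sum>l<d. \<Sum>i<n0. C k l p \<cdot> (R k v * (R l (x i) * R m (y i))))"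
      by (simp add: sm_sum_left W m mult.commute flip: sm_sum_right sum_distrib_left)
    also have "\<dots> = (\<Sum>i<n0. \<Sum>k<d. \<Sum>l<d. C k l p \<cdot> (R k v * (R l (x i) * R m (y i))))"
      by (rule trans[OF sum.cong[OF refl sum.swap] sum.swap])
    also have "\<dots> = (\<Sum>i<n0. R p (v * x i) * R m (y i))"
      by (simp add: R_mult p sum_distrib_right mult.assoc)
    also have "\<dots> = (\<Sum>i<n0. R p (x i) * R m (y i * v))"
      by (rule casimir[where F = "\<lambda>a b. R p a * R m b"])
        (use p m in \<open>simp_all add: R_add R_left R_right distrib_left distrib_right mult.assoc\<close>)
    also have "\<dots> = (\<Sum>i<n0. \<Sum>l<d. \<Sum>k<d. C l k m \<cdot> (R p (x i) * R l (y i) * R k v))"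
      by (simp add: R_mult m sum_distrib_left mult.assoc)
    also have "\<dots> = (\<Sum>l<d. \<Sum>k<d. \<Sum>i<n0. C l k m \<cdot> (R p (x i) * R l (y i) * R k v))"
      by (subst sum.swap, rule sum.cong[OF refl], rule sum.swap)
    also have "\<dots> = (\<Sum>l<d. \<Sum>k<d. (W p l * C l k m) \<cdot> R k v)"
      by (simp add: W p mult.commute flip: sm_sum_right sum_distrib_right)
    also have "\<dots> = (\<Sum>k<d. (\<Sum>l<d. W p l * C l k m) \<cdot> R k v)"
      by (subst sum.swap) (simp add: sm_sum_left)
    finally show "(\<Sum>k<d. (\<Sum>l<d. W l m * C k l p) \<cdot> R k v) = (\<Sum>k<d. (\<Sum>l<d. W p l * C l k m) \<cdot> R k v)" .
  qed
  then show "(\<Sum>l<d. inverse \<mu> * W l m * C k l p) = (\<Sum>l<d. inverse \<mu> * W p l * C l k m)"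
    by (simp add: mult.assoc flip: sum_distrib_left)
next
  fix v :: "nat \<Rightarrow> 'k" and j assume v: "v \<in> vecs d"
  \<comment> \<open>Both sides are the scalar \<open>R p (\<Sum>i<n0. x i * y i)\<close>.\<close>
  have Wu: "(\<Sum>l<d. \<Sum>m<d. W l m * C l m p) = \<mu> * u p" if p: "p < d" for p
  proof -
    have "(\<Sum>l<d. \<Sum>m<d. W l m * C l m p) \<cdot> 1 = (\<Sum>l<d. \<Sum>m<d. \<Sum>i<n0. C l m p \<cdot> (R l (x i) * R m (y i)))"
      by (simp add: sm_sum_left W mult.commute flip: sm_sum_right)
    also have "\<dots> = (\<Sum>i<n0. \<Sum>l<d. \<Sum>m<d. C l m p \<cdot> (R l (x i) * R m (y i)))"
      by (rule trans[OF sum.cong[OF refl sum.swap] sum.swap])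
    also have "\<dots> = R p (\<Sum>i<n0. x i * y i)" by (simp add: R_sum R_mult p)
    also have "\<dots> = (\<mu> * u p) \<cdot> 1" by (simp add: \<mu> R_scale R_one p)
    finally show ?thesis by (simp only: sm_one_inj)
  qed
  have "(\<Sum>l<d. \<Sum>m<d. inverse \<mu> * W l m * mop d C l (mop d C m v) j)
      = inverse \<mu> * (\<Sum>l<d. \<Sum>m<d. \<Sum>p<d. W l m * C l m p * mop d C p v j)"
    by (simp add: mop_mop_alg[OF mult_assoc] sum_distrib_left mult.assoc)
  also have "(\<Sum>l<d. \<Sum>m<d. \<Sum>p<d. W l m * C l m p * mop d C p v j)
      = (\<Sum>p<d. (\<Sum>l<d. \<Sum>m<d. W l m * C l m p) * mop d C p v j)"
    unfolding sum_distrib_right by (rule trans[OF sum.cong[OF refl sum.swap] sum.swap])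
  also have "\<dots> = \<mu> * (\<Sum>p<d. u p * mop d C p v j)"
    by (simp add: Wu sum_distrib_left mult.assoc)
  also have "(\<Sum>p<d. u p * mop d C p v j) = v j"
  proof (cases "j < d")
    case True
    have "(\<Sum>p<d. u p * mop d C p v j) = (\<Sum>i<d. v i * (\<Sum>p<d. u p * C p i j))"
      using True by (simp add: mop_def sum_distrib_left mult.left_commute) (rule sum.swap)
    also have "\<dots> = (\<Sum>i<d. v i * (if i = j then 1 else 0))"
      by (intro sum.cong refl) (simp add: unit_left True)
    finally show ?thesis using True by simp
  next
    case False
    then show ?thesis using v by (simp add: mop_def vecs_def)
  qed
  finally show "(\<Sum>l<d. \<Sum>m<d. inverse \<mu> * W l m * mop d C l (mop d C m v) j) = v j"
    using \<mu>(2) by simp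
qed

section \<open>Cosemisimplicity from the value \<open>E 1\<close>\<close>

text \<open>\<open>S(E_1) E_2\<close> is \<open>\<epsilon>\<close> times the identity: under
  \<open>E (a * _)\<close> the two legs recombine to \<open>E (E (a * v))\<close>, and
  \<open>E\<close> acts on \<open>N\<close> as the scalar \<open>\<epsilon>\<close>.\<close>

lemma SA_gamma_unit: "(\<Sum>p<d. \<Sum>m<d. \<gamma> p m \<cdot> SA p (R m v)) = \<epsilon> \<cdot> v"
proof (rule E_nondeg_left)
  fix a
  have "E (a * (\<Sum>p<d. \<Sum>m<d. \<gamma> p m \<cdot> SA p (R m v))) = (\<Sum>p<d. \<Sum>m<d. \<gamma> p m \<cdot> E (R p a * R m v))"
    by (simp add: sum_distrib_left E_sum E_scale SA_adj)
  also have "\<dots> = E (E (a * v))" by (simp add: E_mult[of a v] E_sum E_scale)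
  also have "\<dots> = E (a * (\<epsilon> \<cdot> v))" by (simp add: E_of_N E_N E_scale)
  finally show "E (a * (\<Sum>p<d. \<Sum>m<d. \<gamma> p m \<cdot> SA p (R m v))) = E (a * (\<epsilon> \<cdot> v))" .
qed

text \<open>Writing \<open>R k\<close> as the antipode of \<open>b\<close>, both sides are the image of \<open>\<gamma> * (b \<otimes> 1)\<close> under
  the antipode in the first factor.\<close>

lemma SA_gamma_central:
  assumes k: "k < d"
  shows "(\<Sum>p<d. \<Sum>m<d. \<gamma> p m \<cdot> (R k (SA p v) * R m w)) = (\<Sum>p<d. \<Sum>m<d. \<gamma> p m \<cdot> (SA p v * R m (R k w)))"
proof -
  \<comment> \<open>The preimage of \<open>R k\<close> under the antipode, constructed directly as
    an adjoint, so that no inverse of \<open>S\<close> has to be computed.\<close>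
  define b where "b a = (\<Sum>i<n0. E (a * R k (x i)) * y i)" for a
  have adj: "E (b a * m) = E (a * R k m)" for a m
  proof -
    have "E (b a * m) = (\<Sum>i<n0. E (a * R k (x i)) * E (y i * m))"
      by (simp add: b_def sum_distrib_right E_sum mult.assoc E_E_left)
    also have "\<dots> = E (a * R k (\<Sum>i<n0. x i * E (y i * m)))"
      using k by (simp add: R_sum R_right E_N sum_distrib_left E_sum E_E_right')
    finally show ?thesis by (simp add: dual_right)
  qed
  have b: "bimod_map b"
    unfolding bimod_map_def
  proof (intro conjI allI ballI)
    show "b (a + a') = b a + b a'" for a a'
      by (simp add: b_def distrib_right E_add sum.distrib)
    fix n m assume n: "n \<in> N"
    show "b (n * m) = n * b m" using n by (simp add: b_def mult.assoc E_left sum_distrib_left)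
    show "b (m * n) = b m * n"
    proof (rule E_nondeg_right)
      fix m'
      show "E (b (m * n) * m') = E (b m * n * m')"
        using k n by (simp add: adj mult.assoc R_left)
    qed
  qed
  define B where "B r p = coef (\<lambda>a. R p (b a)) r" for r p
  have B: "R p (b a) = (\<Sum>r<d. B r p \<cdot> R r a)" if "p < d" for p a
    unfolding B_def by (rule coef[where f = "\<lambda>a. R p (b a)"]) (rule bimod_map_comp[OF R_bimod[OF that] b])
  \<comment> \<open>Coefficients of \<open>E (b a * w) = E (a * R k w)\<close>: a factor
    \<open>b\<close> on the first leg of \<open>\<gamma>\<close> becomes \<open>R k\<close> on the
    second.\<close>
  have Bg: "(\<Sum>p<d. \<Sum>m<d. (\<gamma> p m * B r p) \<cdot> R m w) = (\<Sum>m<d. \<gamma> r m \<cdot> R m (R k w))" if r: "r < d" for r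
  proof (rule right_unique[where a = "\<lambda>r. \<Sum>p<d. \<Sum>m<d. (\<gamma> p m * B r p) \<cdot> R m w"
        and b = "\<lambda>r. \<Sum>m<d. \<gamma> r m \<cdot> R m (R k w)", OF _ r])
    fix a
    have "(\<Sum>r<d. R r a * (\<Sum>p<d. \<Sum>m<d. (\<gamma> p m * B r p) \<cdot> R m w))
        = (\<Sum>r<d. \<Sum>p<d. \<Sum>m<d. (\<gamma> p m * B r p) \<cdot> (R r a * R m w))"
      by (simp add: sum_distrib_left)
    also have "\<dots> = (\<Sum>p<d. \<Sum>m<d. \<Sum>r<d. (\<gamma> p m * B r p) \<cdot> (R r a * R m w))"
      by (subst sum.swap, rule sum.cong[OF refl], rule sum.swap)
    also have "\<dots> = (\<Sum>p<d. \<Sum>m<d. \<gamma> p m \<cdot> (R p (b a) * R m w))"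
      by (simp add: B sum_distrib_right sm_sum_right)
    also have "\<dots> = E (b a * w)" by (simp only: E_mult)
    also have "\<dots> = E (a * R k w)" by (rule adj)
    also have "\<dots> = (\<Sum>r<d. R r a * (\<Sum>m<d. \<gamma> r m \<cdot> R m (R k w)))"
      by (simp only: E_mult sum_distrib_left mult_sm)
    finally show "(\<Sum>r<d. R r a * (\<Sum>p<d. \<Sum>m<d. (\<gamma> p m * B r p) \<cdot> R m w))
      = (\<Sum>r<d. R r a * (\<Sum>m<d. \<gamma> r m \<cdot> R m (R k w)))" .
  qed
  \<comment> \<open>The antipode reverses composition: \<open>R k\<close> after \<open>SA p\<close>
    is the antipode of \<open>R p\<close> after \<open>b\<close>.\<close>
  have RSA: "R k (SA p v) = (\<Sum>r<d. B r p \<cdot> SA r v)" if p: "p < d" for p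
  proof (rule E_nondeg_left)
    fix a
    have "E (a * R k (SA p v)) = E (R p (b a) * v)" using p by (simp add: adj[symmetric] SA_adj)
    also have "\<dots> = E (a * (\<Sum>r<d. B r p \<cdot> SA r v))"
      using p by (simp add: B sum_distrib_left sum_distrib_right E_sum E_scale SA_adj)
    finally show "E (a * R k (SA p v)) = E (a * (\<Sum>r<d. B r p \<cdot> SA r v))" .
  qed
  have "(\<Sum>p<d. \<Sum>m<d. \<gamma> p m \<cdot> (R k (SA p v) * R m w))
      = (\<Sum>p<d. \<Sum>m<d. \<Sum>r<d. (\<gamma> p m * B r p) \<cdot> (SA r v * R m w))"
    by (simp add: RSA sum_distrib_right sm_sum_right)
  also have "\<dots> = (\<Sum>r<d. \<Sum>p<d. \<Sum>m<d. (\<gamma> p m * B r p) \<cdot> (SA r v * R m w))"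
    by (rule trans[OF sum.cong[OF refl sum.swap] sum.swap])
  also have "\<dots> = (\<Sum>r<d. SA r v * (\<Sum>p<d. \<Sum>m<d. (\<gamma> p m * B r p) \<cdot> R m w))"
    by (simp add: sum_distrib_left)
  also have "\<dots> = (\<Sum>r<d. SA r v * (\<Sum>m<d. \<gamma> r m \<cdot> R m (R k w)))"
    by (simp add: Bg)
  finally show ?thesis by (simp add: sum_distrib_left)
qed

text \<open>The separability element of the dual algebra is \<open>(S \<otimes> 1) \<gamma>\<close>
  divided by \<open>\<epsilon>\<close>; \<open>SA_gamma_central\<close> and
  \<open>SA_gamma_unit\<close> are its two defining properties.\<close>

lemma cosemisimple: "cosemisimple_coalg d D"
  unfolding cosemisimple_coalg_def right_coideal_eq_stable
proof (rule complemented_of_separability_element[where c = "\<lambda>k l p. D p k l"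
      and s = "\<lambda>l m. inverse \<epsilon> * (\<Sum>p<d. S l p * \<gamma> p m)"])
  let ?mop = "mop d (\<lambda>l i j. D i j l)"
  let ?s = "\<lambda>l m. \<Sum>p<d. S l p * \<gamma> p m"
  show "?mop k (?mop l v) = (\<lambda>j. \<Sum>p<d. D p k l * ?mop p v j)" if "k < d" "l < d" for k l v
    by (rule mop_mop_coalg[OF coassoc that])
  \<comment> \<open>Rewrites \<open>SA p\<close> in the basis inside any linear context; the
    resulting coefficients \<open>?s\<close> are those of
    \<open>(S \<otimes> 1) \<gamma>\<close>.\<close>
  have SAs: "(\<Sum>p<d. \<Sum>m<d. \<gamma> p m \<cdot> F (SA p v) m) = (\<Sum>l<d. \<Sum>m<d. ?s l m \<cdot> F (R l v) m)"
    if F: "\<And>a b m. F (a + b) m = F a m + F b m" "\<And>c a m. F (c \<cdot> a) m = c \<cdot> F a m" for F v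
  proof -
    have F0: "F 0 m = 0" for m using F(1)[of 0 0 m] by simp
    have Fsum: "F (\<Sum>k\<in>K. h k) m = (\<Sum>k\<in>K. F (h k) m)" for h m and K :: "nat set"
      by (induct K rule: infinite_finite_induct) (auto simp: F F0)
    have "(\<Sum>p<d. \<Sum>m<d. \<gamma> p m \<cdot> F (SA p v) m) = (\<Sum>p<d. \<Sum>m<d. \<Sum>l<d. (S l p * \<gamma> p m) \<cdot> F (R l v) m)"
      by (simp add: SA_S Fsum F sm_sum_right mult.commute)
    also have "\<dots> = (\<Sum>l<d. \<Sum>p<d. \<Sum>m<d. (S l p * \<gamma> p m) \<cdot> F (R l v) m)"
      by (rule trans[OF sum.cong[OF refl sum.swap] sum.swap])
    also have "\<dots> = (\<Sum>l<d. \<Sum>m<d. \<Sum>p<d. (S l p * \<gamma> p m) \<cdot> F (R l v) m)"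
      by (rule sum.cong[OF refl], rule sum.swap)
    finally show ?thesis by (simp only: sm_sum_left)
  qed
  {
    fix k m p assume k: "k < d" and m: "m < d" and p: "p < d"
    have "(\<Sum>l<d. ?s l m * D p k l) = (\<Sum>l<d. ?s p l * D m l k)"
    proof (rule scalar_unique2[where a = "\<lambda>p m. \<Sum>l<d. ?s l m * D p k l" and b = "\<lambda>p m. \<Sum>l<d. ?s p l * D m l k", OF _ p m])
      fix v w
      have "(\<Sum>p<d. \<Sum>m<d. (\<Sum>l<d. ?s l m * D p k l) \<cdot> (R p v * R m w))
          = (\<Sum>p<d. \<Sum>m<d. \<Sum>l<d. (?s l m * D p k l) \<cdot> (R p v * R m w))" by (simp only: sm_sum_left)
      also have "\<dots> = (\<Sum>m<d. \<Sum>p<d. \<Sum>l<d. (?s l m * D p k l) \<cdot> (R p v * R m w))" by (rule sum.swap)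
      also have "\<dots> = (\<Sum>m<d. \<Sum>l<d. \<Sum>p<d. (?s l m * D p k l) \<cdot> (R p v * R m w))"
        by (rule sum.cong[OF refl], rule sum.swap)
      also have "\<dots> = (\<Sum>l<d. \<Sum>m<d. \<Sum>p<d. (?s l m * D p k l) \<cdot> (R p v * R m w))" by (rule sum.swap)
      also have "\<dots> = (\<Sum>l<d. \<Sum>m<d. ?s l m \<cdot> (R k (R l v) * R m w))"
        by (intro sum.cong refl) (simp add: R_R k sum_distrib_right[of _ _ "R _ w"] sm_sum_right)
      also have "\<dots> = (\<Sum>p<d. \<Sum>m<d. \<gamma> p m \<cdot> (R k (SA p v) * R m w))"
        by (rule SAs[where F = "\<lambda>a m. R k a * R m w", symmetric]) (simp_all add: R_add R_scale k distrib_right)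
      also have "\<dots> = (\<Sum>p<d. \<Sum>m<d. \<gamma> p m \<cdot> (SA p v * R m (R k w)))" by (rule SA_gamma_central[OF k])
      also have "\<dots> = (\<Sum>p<d. \<Sum>l<d. ?s p l \<cdot> (R p v * R l (R k w)))"
        by (rule SAs[where F = "\<lambda>a m. a * R m (R k w)"]) (simp_all add: distrib_right)
      also have "\<dots> = (\<Sum>p<d. \<Sum>l<d. \<Sum>m<d. (?s p l * D m l k) \<cdot> (R p v * R m w))"
        by (intro sum.cong refl) (simp add: R_R k sum_distrib_left[of "R _ v"] sm_sum_right)
      also have "\<dots> = (\<Sum>p<d. \<Sum>m<d. \<Sum>l<d. (?s p l * D m l k) \<cdot> (R p v * R m w))"
        by (rule sum.cong[OF refl], rule sum.swap)
      finally show "(\<Sum>p<d. \<Sum>m<d. (\<Sum>l<d. ?s l m * D p k l) \<cdot> (R p v * R m w))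
        = (\<Sum>p<d. \<Sum>m<d. (\<Sum>l<d. ?s p l * D m l k) \<cdot> (R p v * R m w))" by (simp only: sm_sum_left)
    qed
    then show "(\<Sum>l<d. inverse \<epsilon> * ?s l m * D p k l) = (\<Sum>l<d. inverse \<epsilon> * ?s p l * D m l k)"
      by (simp only: mult.assoc sum_distrib_left[symmetric, of "inverse \<epsilon>"])
  }
  fix v :: "nat \<Rightarrow> 'k" and j assume v: "v \<in> vecs d"
  have se: "(\<Sum>l<d. \<Sum>m<d. ?s l m * D p l m) = \<epsilon> * e p" if p: "p < d" for p
  proof (rule scalar_unique[where a = "\<lambda>p. \<Sum>l<d. \<Sum>m<d. ?s l m * D p l m" and b = "\<lambda>p. \<epsilon> * e p", OF _ p])
    fix w
    have "(\<Sum>p<d. (\<Sum>l<d. \<Sum>m<d. ?s l m * D p l m) \<cdot> R p w) = (\<Sum>p<d. \<Sum>l<d. \<Sum>m<d. (?s l m * D p l m) \<cdot> R p w)"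
      by (simp only: sm_sum_left)
    also have "\<dots> = (\<Sum>l<d. \<Sum>m<d. \<Sum>p<d. (?s l m * D p l m) \<cdot> R p w)"
      by (subst sum.swap, rule sum.cong[OF refl], rule sum.swap)
    also have "\<dots> = (\<Sum>l<d. \<Sum>m<d. ?s l m \<cdot> R l (R m w))"
      by (intro sum.cong refl) (simp add: R_R sm_sum_right)
    also have "\<dots> = (\<Sum>m<d. \<Sum>l<d. ?s l m \<cdot> R l (R m w))" by (rule sum.swap)
    also have "\<dots> = (\<Sum>m<d. \<Sum>l<d. \<Sum>p<d. (S l p * \<gamma> p m) \<cdot> R l (R m w))" by (simp only: sm_sum_left)
    also have "\<dots> = (\<Sum>m<d. \<Sum>p<d. \<Sum>l<d. (S l p * \<gamma> p m) \<cdot> R l (R m w))"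
      by (rule sum.cong[OF refl], rule sum.swap)
    also have "\<dots> = (\<Sum>p<d. \<Sum>m<d. \<Sum>l<d. (S l p * \<gamma> p m) \<cdot> R l (R m w))" by (rule sum.swap)
    also have "\<dots> = (\<Sum>p<d. \<Sum>m<d. \<gamma> p m \<cdot> SA p (R m w))"
      by (intro sum.cong refl) (simp add: SA_S sm_sum_right mult.commute)
    also have "\<dots> = \<epsilon> \<cdot> w" by (rule SA_gamma_unit)
    also have "\<dots> = (\<Sum>p<d. (\<epsilon> * e p) \<cdot> R p w)"
      by (subst counit[of w, symmetric]) (simp only: sm_sum_right sm_sm)
    finally show "(\<Sum>p<d. (\<Sum>l<d. \<Sum>m<d. ?s l m * D p l m) \<cdot> R p w) = (\<Sum>p<d. (\<epsilon> * e p) \<cdot> R p w)" .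
  qed
  have "(\<Sum>l<d. \<Sum>m<d. inverse \<epsilon> * ?s l m * ?mop l (?mop m v) j)
      = inverse \<epsilon> * (\<Sum>l<d. \<Sum>m<d. \<Sum>p<d. ?s l m * D p l m * ?mop p v j)"
    unfolding sum_distrib_left[of "inverse \<epsilon>"]
    by (intro sum.cong refl)
      (simp add: mop_mop_coalg[OF coassoc] mult.assoc sum_distrib_left[symmetric, of "?s _ _"] sum_distrib_left[symmetric, of "inverse \<epsilon>"])
  also have "(\<Sum>l<d. \<Sum>m<d. \<Sum>p<d. ?s l m * D p l m * ?mop p v j)
      = (\<Sum>p<d. (\<Sum>l<d. \<Sum>m<d. ?s l m * D p l m) * ?mop p v j)"
    unfolding sum_distrib_right[of _ _ "?mop _ v j"] by (rule trans[OF sum.cong[OF refl sum.swap] sum.swap])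
  also have "\<dots> = \<epsilon> * (\<Sum>p<d. e p * ?mop p v j)"
    by (simp add: se sum_distrib_left mult.assoc)
  also have "(\<Sum>p<d. e p * ?mop p v j) = v j"
  proof (cases "j < d")
    case True
    have "(\<Sum>p<d. e p * ?mop p v j) = (\<Sum>i<d. v i * (\<Sum>p<d. e p * D i j p))"
      using True by (simp add: mop_def sum_distrib_left mult.left_commute) (rule sum.swap)
    also have "\<dots> = (\<Sum>i<d. v i * (if i = j then 1 else 0))"
      by (intro sum.cong refl) (simp add: counit_right True)
    finally show ?thesis using True by simp
  next
    case False
    then show ?thesis using v by (simp add: mop_def vecs_def)
  qed
  finally show "(\<Sum>l<d. \<Sum>m<d. inverse \<epsilon> * ?s l m * ?mop l (?mop m v) j) = v j"
    using \<epsilon> by simp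
qed

end

theorem theorem1p3:
  fixes \<iota> :: "'k::field \<Rightarrow> 'm::ring_1" and N :: "'m set"
  assumes "kalg \<iota>" and "subalg \<iota> N" and "irreducible_ext \<iota> N" and "depth2 N"
  shows "strongly_separable N \<longleftrightarrow>
    (\<exists>(d::nat) C u D e R. hopf_alg d C u D e \<and> semisimple_alg d C \<and> cosemisimple_coalg d D \<and>
        comodule_alg d C u D e \<iota> R \<and> N = coinv d u \<iota> R \<and> galois d \<iota> N R)"
proof
  assume "strongly_separable N"
  then obtain E n0 x y where E: "\<forall>m. E m \<in> N" "\<forall>a b. E (a + b) = E a + E b"
      "\<forall>n\<in>N. \<forall>m. E (n * m) = n * E m \<and> E (m * n) = E m * n"
    and xy: "\<forall>m. (\<Sum>i<n0::nat. E (m * x i) * y i) = m \<and> (\<Sum>i<n0. x i * E (y i * m)) = m"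
    and nz: "E 1 \<noteq> 0" "(\<Sum>i<n0. x i * y i) \<noteq> 0"
    unfolding strongly_separable_def by (elim exE conjE) (rule that)
  interpret frobenius_ext \<iota> N E n0 x y
    by unfold_locales (use assms E xy in blast)+
  from adjoint_basis[OF assms(4)] obtain d :: nat and R where R: "(\<forall>i<d. bimod_map (R i)) \<and>
    (\<forall>f. (\<forall>a b. f (a + b) = f a + f b) \<and> (\<forall>n\<in>N. \<forall>m. f (n * m) = n * f m)
      \<longrightarrow> (\<exists>c. \<forall>m. f m = (\<Sum>i<d. R i m * c i))) \<and>
    (\<forall>c. (\<forall>m. (\<Sum>i<d. R i m * c i) = 0) \<longrightarrow> (\<forall>i<d. c i = 0))"
    by (elim exE)
  interpret depth2_frobenius \<iota> N E n0 x y d R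
    by unfold_locales (use R nz in simp_all)
  show "\<exists>(d::nat) C u D e R. hopf_alg d C u D e \<and> semisimple_alg d C \<and> cosemisimple_coalg d D \<and>
        comodule_alg d C u D e \<iota> R \<and> N = coinv d u \<iota> R \<and> galois d \<iota> N R"
    using hopf semisimple cosemisimple comodule N_eq_coinv galois by (intro exI conjI)
next
  assume "\<exists>(d::nat) C u D e R. hopf_alg d C u D e \<and> semisimple_alg d C \<and> cosemisimple_coalg d D \<and>
        comodule_alg d C u D e \<iota> R \<and> N = coinv d u \<iota> R \<and> galois d \<iota> N R"
  then obtain d C u D e R where H: "hopf_alg d C u D e" "semisimple_alg d C" "cosemisimple_coalg d D"
      "comodule_alg d C u D e \<iota> R" and N: "N = coinv d u \<iota> R" and G: "galois d \<iota> N R"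
    by (elim exE conjE) (rule that)
  interpret hopf_galois \<iota> d C u D e R
    by unfold_locales (use assms(1,3) H G N in simp_all)
  show "strongly_separable N" unfolding N by (rule strongly_separable)
qed

end
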